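(* For integers $d>300000000$ such that $-d$ is a fundamental discriminant, let $\chi(n)=\left(\frac{-d}{n}\right)$, let $L(s,\chi)$ be the associated Dirichlet $L$-function, and let $h(-d)$ be the class number of $\mathbb{Q}(\sqrt{-d})$. Then, for those $d$ for which $L(s,\chi)$ has a positive real zero and with $\beta$ denoting the largest such zero, \[ 1-\beta > \Big(2\pi+o(1)\Big)\frac{h(-d)}{(\log h(-d))^2\, \sqrt{d}}\quad \text{ as } h(-d)\to \infty, \] i.e. there is a function $\varepsilon(h)$ with $\varepsilon(h)\to 0$ as $h\to\infty$ such that for all such $d$ one has $1-\beta > (2\pi+\varepsilon(h(-d)))\,h(-d)/((\log h(-d))^2\sqrt{d})$.
   Context: $\left(\frac{-d}{n}\right)$ is the Kronecker symbol; $L(s,\chi)=\sum_{n\ge1}\chi(n)n^{-s}$, analytically continued to $\mathbb{C}$. *)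

theory Defs
  imports
    "HOL-Number_Theory.Number_Theory"
    "HOL-Computational_Algebra.Squarefree"
    "HOL-Complex_Analysis.Complex_Analysis"
    "HOL-Algebra.Algebra"
begin

definition fundamental_discriminant :: "int \<Rightarrow> bool" where
  "fundamental_discriminant D \<longleftrightarrow>
     D \<noteq> 1 \<and>
     (D mod 4 = 1 \<and> squarefree D \<or>
      (\<exists>m. D = 4 * m \<and> (m mod 4 = 2 \<or> m mod 4 = 3) \<and> squarefree m))"

definition kronecker_prime :: "int \<Rightarrow> int \<Rightarrow> int" where
  "kronecker_prime a p =
     (if p = 2
      then (if even a then 0 else if a mod 8 = 1 \<or> a mod 8 = 7 then 1 else -1)
      else Legendre a p)"

definition kronecker :: "int \<Rightarrow> int \<Rightarrow> int" where
  "kronecker a n =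
     (if n = 0 then (if \<bar>a\<bar> = 1 then 1 else 0)
      else (if n < 0 \<and> a < 0 then -1 else 1) *
           (\<Prod>p\<in>prime_factors n. kronecker_prime a p ^ multiplicity p n))"

text \<open>
  The L-function of \<open>chi\<close>, as the entire function that extends the Dirichlet series. The
  description denotes only if such an extension exists, as it does for every non-principal
  Dirichlet character; by the lemma below it is then the only one.
\<close>

definition L_continuation :: "(nat \<Rightarrow> complex) \<Rightarrow> (complex \<Rightarrow> complex) \<Rightarrow> bool" where
  "L_continuation chi F \<longleftrightarrow>
     F holomorphic_on UNIV \<and>
     (\<forall>s. Re s > 1 \<longrightarrow> (\<lambda>n. chi (Suc n) * of_nat (Suc n) powr (-s)) sums F s)"

definition Dirichlet_L :: "(nat \<Rightarrow> complex) \<Rightarrow> complex \<Rightarrow> complex" where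
  "Dirichlet_L chi = (THE F. L_continuation chi F)"

lemma L_continuation_unique:
  assumes F: "L_continuation chi F" and G: "L_continuation chi G"
  shows "F = G"
proof
  fix s
  have "F s = G s"
  proof (rule analytic_continuation_open[where s = "{s. Re s > 1}" and s' = UNIV and f = F and g = G])
    show "{s. 1 < Re s} \<noteq> {}"
      by (auto intro: exI[of _ 2])
  next
    fix z assume "z \<in> {s. 1 < Re s}"
    then show "F z = G z"
      using F G unfolding L_continuation_def by (blast intro: sums_unique2)
  qed (use F G in \<open>auto simp: L_continuation_def open_halfspace_Re_gt\<close>)
  then show "F s = G s" .
qed

lemma Dirichlet_L_eq: "L_continuation chi F \<Longrightarrow> Dirichlet_L chi = F"
  unfolding Dirichlet_L_def using L_continuation_unique by blast

definition quadratic_field :: "int \<Rightarrow> complex set" where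
  "quadratic_field D = {of_rat a + of_rat b * csqrt (of_int D) | a b. True}"

definition ring_of_integers :: "complex set \<Rightarrow> complex ring" where
  "ring_of_integers K =
     \<lparr>carrier = {z \<in> K. algebraic_int z}, monoid.mult = (*), one = 1, ring.zero = 0, add = (+)\<rparr>"

text \<open>Ideal classes: nonzero ideals modulo \<open>I \<sim> J \<longleftrightarrow> aI = bJ\<close> for some nonzero \<open>a, b\<close>.\<close>

definition nonzero_ideals :: "('a, 'b) ring_scheme \<Rightarrow> 'a set set" where
  "nonzero_ideals R = {I. ideal I R \<and> I \<noteq> {\<zero>\<^bsub>R\<^esub>}}"

definition ideal_class_rel :: "('a, 'b) ring_scheme \<Rightarrow> ('a set \<times> 'a set) set" where
  "ideal_class_rel R =
     {(I, J). I \<in> nonzero_ideals R \<and> J \<in> nonzero_ideals R \<and>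
       (\<exists>a\<in>carrier R - {\<zero>\<^bsub>R\<^esub>}. \<exists>b\<in>carrier R - {\<zero>\<^bsub>R\<^esub>}. a <#\<^bsub>R\<^esub> I = b <#\<^bsub>R\<^esub> J)}"

lemma equiv_ideal_class_rel:
  fixes R (structure)
  assumes "domain R"
  shows "equiv (nonzero_ideals R) (ideal_class_rel R)"
proof -
  interpret domain R by fact
  have sub: "I \<subseteq> carrier R" if "I \<in> nonzero_ideals R" for I
    using that by (auto simp: nonzero_ideals_def dest: additive_subgroup.a_subset[OF ideal.axioms(1)])
  show ?thesis
  proof (rule equivI)
    show "ideal_class_rel R \<subseteq> nonzero_ideals R \<times> nonzero_ideals R"
      by (auto simp: ideal_class_rel_def)
    show "refl_on (nonzero_ideals R) (ideal_class_rel R)"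
      unfolding refl_on_def ideal_class_rel_def
      by (auto intro!: bexI[of _ "\<one>"])
    show "sym (ideal_class_rel R)"
      by (rule symI, unfold ideal_class_rel_def mem_Collect_eq case_prod_conv, metis)
    show "trans (ideal_class_rel R)"
    proof (rule transI)
      fix I J K assume "(I, J) \<in> ideal_class_rel R" "(J, K) \<in> ideal_class_rel R"
      then obtain a b c d where
        mem: "I \<in> nonzero_ideals R" "J \<in> nonzero_ideals R" "K \<in> nonzero_ideals R" and
        carr: "a \<in> carrier R - {\<zero>}" "b \<in> carrier R - {\<zero>}" "c \<in> carrier R - {\<zero>}" "d \<in> carrier R - {\<zero>}" and
        e1: "a <# I = b <# J" and e2: "c <# J = d <# K"
        by (auto simp: ideal_class_rel_def)
      have assoc: "x <# (y <# M) = (x \<otimes> y) <# M"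
        if "x \<in> carrier R" "y \<in> carrier R" "M \<subseteq> carrier R" for x y M
        using that by (force simp: l_coset_def m_assoc subset_iff)
      note S = sub[OF mem(1)] sub[OF mem(2)] sub[OF mem(3)]
      have "(c \<otimes> a) <# I = c <# (a <# I)" using S carr by (simp add: assoc)
      also have "\<dots> = (c \<otimes> b) <# J" using S carr e1 by (simp add: assoc)
      also have "\<dots> = (b \<otimes> c) <# J" using carr by (simp add: m_comm)
      also have "\<dots> = b <# (c <# J)" using S carr by (simp add: assoc)
      also have "\<dots> = (b \<otimes> d) <# K" using S carr e2 by (simp add: assoc)
      finally have "(c \<otimes> a) <# I = (b \<otimes> d) <# K" .
      moreover have "c \<otimes> a \<in> carrier R - {\<zero>}" "b \<otimes> d \<in> carrier R - {\<zero>}"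
        using carr by (auto simp: integral_iff)
      ultimately show "(I, K) \<in> ideal_class_rel R"
        using mem unfolding ideal_class_rel_def by blast
    qed
  qed
qed

definition class_number :: "complex set \<Rightarrow> nat" where
  "class_number K =
     card (nonzero_ideals (ring_of_integers K) // ideal_class_rel (ring_of_integers K))"

end

theory Submission
  imports Defs
begin

text \<open>
  Let \<open>r = 1 * \<chi>\<close>. Partial summation shows that at a real zero \<open>\<beta>\<close> the difference of
  \<open>\<Sum>\<^sub>N\<^sub>\<le>\<^sub>X r(N) N\<^sup>-\<^sup>\<beta>\<close> and its main term \<open>L(1) X\<^sup>1\<^sup>-\<^sup>\<beta>/(1-\<beta>)\<close> tends to \<open>0\<close>. Now \<open>r(N)\<close> is the number of ideals
  of norm \<open>N\<close>, hence half the number of representations of \<open>N\<close> by reduced forms \<open>(a, b, c)\<close>, one for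
  each ideal class. The points \<open>(x, 0)\<close> contribute at most \<open>a\<^sup>-\<^sup>\<beta> \<zeta>(2\<beta>)\<close> for each form, and all other points
  have values at least \<open>d/(4a)\<close>; counting these row by row gives, with \<open>t = 1 - \<beta>\<close> and \<open>S = \<Sum> 1/a\<close>,
  \<open>t \<zeta>(2 - 2t) S \<ge> (h/\<surd>d) (1 - t) (\<pi> (1 - t) - 10 t)\<close>.
  No more than \<open>r(N)\<close> of the pairs (form, \<open>x\<close>) satisfy \<open>a x\<^sup>2 = N\<close>, and \<open>r(N)\<close> is at most the number of
  divisors of \<open>N\<close>. Summing this over \<open>N \<le> h K\<^sup>2\<close> with weight \<open>1/N\<close> bounds \<open>\<zeta>(2) S\<close> by \<open>(1/2 + o(1)) log\<^sup>2 h\<close>; the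
  same count gives \<open>h/\<surd>d \<le> 1 + log h\<close>, so that \<open>t\<close> may be assumed small.
\<close>

text \<open>The constant 2\<pi> is \<pi> divided by 1/2: the points with y > 0 of one form have
  density \<pi>/\<surd>d, half the area of its ellipse, and 1/2 is the coefficient of log^2 in the
  sum of \<tau>(N)/N. The main terms in X diverge; they drop out because the same count shows h
  \<pi>/\<surd>d \<le> L(1). The obstacle is the error of the row count, of order \<surd>(a N/d).
  Weighted by N^(-\<beta>) it sums to a multiple of (d/a)^(-\<beta>), because the rows y > 0 are
  empty below d/(4a); as a \<le> \<surd>(d/3), in the final inequality it costs only a multiple of
  t/\<surd>d per form, the term 10 t. The row y = 0 has small values and no such saving, so it
  supplies S. That log h appears and not log d is due to a cut-off: the forms with a > h, at most h
  in number, contribute at most 1 to S. All estimates hold for every positive zero; the largest one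
  enters only at the end, where the zeros must be seen to have a maximum.\<close>

hide_const (open) Divisibility.prime

section \<open>Periodicity of the Kronecker symbol\<close>

lemma Legendre_range: "Legendre a p \<in> {-1, 0, 1}"
  by (simp add: Legendre_def)

text \<open>Two numbers of absolute value at most 1 differ by at most 2 < p. This turns Euler's
  criterion, a congruence, into identities between Legendre symbols.\<close>

lemma eq_of_cong_small:
  fixes x y :: int
  assumes "[x = y] (mod p)" "x \<in> {-1, 0, 1}" "y \<in> {-1, 0, 1}" "2 < p"
  shows "x = y"
proof -
  have "p dvd x - y" using assms(1) by (simp add: cong_iff_dvd_diff)
  moreover have "\<bar>x - y\<bar> < p" using assms(2-4) by auto
  ultimately show ?thesis using zdvd_not_zless[of "\<bar>x - y\<bar>" p] by (cases "x = y") auto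
qed

lemma Legendre_mult:
  fixes p :: nat
  assumes "prime p" "2 < p"
  shows "Legendre (a * b) p = Legendre a p * Legendre b p"
proof (rule eq_of_cong_small)
  have "[Legendre (a * b) p = (a * b) ^ ((p - 1) div 2)] (mod p)"
    by (rule euler_criterion[OF assms])
  moreover have "[Legendre a p * Legendre b p = a ^ ((p - 1) div 2) * b ^ ((p - 1) div 2)] (mod p)"
    by (intro cong_mult euler_criterion[OF assms])
  ultimately show "[Legendre (a * b) p = Legendre a p * Legendre b p] (mod p)"
    by (metis cong_sym cong_trans power_mult_distrib)
  show "Legendre a p * Legendre b p \<in> {-1, 0, 1}"
    using Legendre_range[of a p] Legendre_range[of b p] by auto
  show "2 < int p" using assms by simp
qed (rule Legendre_range)

lemma Legendre_cong:
  assumes "[a = b] (mod p)"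
  shows "Legendre a p = Legendre b p"
proof -
  have "[a = 0] (mod p) \<longleftrightarrow> [b = 0] (mod p)"
    using assms by (metis cong_sym cong_trans)
  moreover have "QuadRes p a \<longleftrightarrow> QuadRes p b"
    unfolding QuadRes_def using assms by (metis cong_sym cong_trans)
  ultimately show ?thesis by (simp add: Legendre_def)
qed

lemma Legendre_minus_one:
  fixes p :: nat
  assumes "prime p" "2 < p"
  shows "Legendre (-1) p = (if p mod 4 = 1 then 1 else -1)"
proof -
  have "odd p" using assms prime_odd_nat by blast
  have "[Legendre (-1) p = (-1) ^ ((p - 1) div 2)] (mod p)"
    by (rule euler_criterion[OF assms])
  then have "Legendre (-1) p = (-1) ^ ((p - 1) div 2)"
    by (rule eq_of_cong_small)
      (use assms Legendre_range in \<open>auto simp: minus_one_power_iff\<close>)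
  moreover have "even ((p - 1) div 2) \<longleftrightarrow> p mod 4 = 1"
    using \<open>odd p\<close> by presburger
  ultimately show ?thesis by (simp add: minus_one_power_iff)
qed

text \<open>Gauss's lemma with multiplier 2: the doubles of 1, ..., m with m = (p - 1)/2 are already
  reduced modulo p, so the exponent counts the x with m/2 < x \<le> m. Its parity depends on m mod
  4, hence on p mod 8.\<close>

lemma Legendre_two:
  fixes p :: nat
  assumes "prime p" "2 < p"
  shows "Legendre 2 p = (if p mod 8 = 1 \<or> p mod 8 = 7 then 1 else -1)"
proof -
  have "odd p" using assms prime_odd_nat by blast
  interpret GAUSS p 2
  proof
    show "[2 \<noteq> 0] (mod int p)"
      using assms by (auto simp: cong_0_iff dest: zdvd_imp_le)
  qed (use assms in auto)
  define m where "m = (int p - 1) div 2"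
  have m: "int p = 2 * m + 1" using \<open>odd p\<close> unfolding m_def by presburger
  have m0: "m \<ge> 0" using m assms by linarith
  have C: "C = (\<lambda>x. 2 * x) ` {0<..m}"
    unfolding C_def B_def A_def m_def[symmetric] image_image using m by (intro image_cong) auto
  have "E = (\<lambda>x. 2 * x) ` {m div 2<..m}"
    unfolding E_def m_def[symmetric] C by auto
  then have "card E = card {m div 2<..m}"
    by (simp add: card_image inj_on_def)
  also have "\<dots> = nat (m - m div 2)" by simp
  finally have E: "card E = nat (m - m div 2)" .
  have "even (nat (m - m div 2)) \<longleftrightarrow> even (m - m div 2)"
    using m0 by (subst even_nat_iff) auto
  also have "\<dots> \<longleftrightarrow> m mod 4 = 0 \<or> m mod 4 = 3" by presburger
  also have "\<dots> \<longleftrightarrow> (2 * m + 1) mod 8 = 1 \<or> (2 * m + 1) mod 8 = 7"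
  proof -
    have "2 * m + 1 = 2 * (m mod 4) + 1 + 8 * (m div 4)"
      using div_mult_mod_eq[of m 4] by linarith
    then have "(2 * m + 1) mod 8 = (2 * (m mod 4) + 1) mod 8" by (metis mod_mult_self2)
    moreover have "0 \<le> m mod 4" "m mod 4 < 4" by simp_all
    ultimately have "(2 * m + 1) mod 8 = 2 * (m mod 4) + 1" by simp
    then show ?thesis by linarith
  qed
  also have "\<dots> \<longleftrightarrow> p mod 8 = 1 \<or> p mod 8 = 7"
  proof -
    have "int p mod 8 = int (p mod 8)" by (simp add: zmod_int)
    then show ?thesis unfolding m[symmetric] by simp
  qed
  finally have "even (nat (m - m div 2)) \<longleftrightarrow> p mod 8 = 1 \<or> p mod 8 = 7" .
  moreover have "Legendre 2 p = (-1) ^ card E" using gauss_lemma by simp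
  ultimately show ?thesis unfolding E by (simp add: minus_one_power_iff)
qed

section \<open>Kronecker symbols at primes and the factorization into prime discriminants\<close>

lemma kronecker_prime_mult:
  fixes q :: nat
  assumes "prime q"
  shows "kronecker_prime (a * b) q = kronecker_prime a q * kronecker_prime b q"
proof (cases "q = 2")
  case True
  have mod8: "(a * b) mod 8 = ((a mod 8) * (b mod 8)) mod 8" by (simp add: mod_mult_eq)
  consider "even a \<or> even b" | "odd a" "odd b" by blast
  then show ?thesis
  proof cases
    case 1
    then show ?thesis using True by (auto simp: kronecker_prime_def)
  next
    case 2
    have a: "a mod 8 \<in> {1, 3, 5, 7}" using 2(1) by (simp, presburger)
    have b: "b mod 8 \<in> {1, 3, 5, 7}" using 2(2) by (simp, presburger)
    define x y where xy: "x = a mod 8" "y = b mod 8"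
    show ?thesis using 2 True a b unfolding kronecker_prime_def mod8 xy[symmetric]
      by (elim insertE emptyE) simp_all
  qed
next
  case False
  then have "2 < q" using assms prime_ge_2_nat[of q] by linarith
  then show ?thesis using Legendre_mult[OF assms] False by (simp add: kronecker_prime_def)
qed

text \<open>The odd prime discriminant belonging to p; its sign absorbs the sign of quadratic
  reciprocity.\<close>

definition pstar :: "nat \<Rightarrow> int" where
  "pstar p = (if p mod 4 = 1 then int p else - int p)"

lemma pstar_mod4:
  assumes "odd p"
  shows "pstar p mod 4 = 1"
  using assms unfolding pstar_def by (simp, presburger)

text \<open>Reciprocity without signs. The case q = 2 is the supplementary law for 2, and for q = p
  both sides vanish. The right-hand side depends only on q modulo p, which is where the periodicity
  of the Kronecker symbol in its lower argument comes from.\<close>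

lemma kronecker_prime_pstar:
  fixes p q :: nat
  assumes p: "prime p" "2 < p" and q: "prime q"
  shows "kronecker_prime (pstar p) q = Legendre q p"
proof -
  have op: "odd p" using p prime_odd_nat by blast
  consider "q = 2" | "q = p" | "q \<noteq> 2" "q \<noteq> p" by blast
  then show ?thesis
  proof cases
    case 1
    have "odd (pstar p)" using op by (simp add: pstar_def)
    moreover have "(pstar p mod 8 = 1 \<or> pstar p mod 8 = 7) \<longleftrightarrow> (p mod 8 = 1 \<or> p mod 8 = 7)"
    proof -
      have p8: "p mod 8 \<in> {1, 3, 5, 7}" using op by (simp, presburger)
      have p4: "p mod 4 = (p mod 8) mod 4" by (simp add: mod_mod_cancel)
      have "int p mod 8 = int (p mod 8)" by (simp add: zmod_int)
      moreover have "(- int p) mod 8 = (- int (p mod 8)) mod 8" by (simp add: zmod_int mod_minus_eq)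
      ultimately have "pstar p mod 8 = (if p mod 8 mod 4 = 1 then int (p mod 8) else (- int (p mod 8)) mod 8)"
        unfolding pstar_def p4 by (simp only: if_distrib[of "\<lambda>x. x mod 8"])
      then show ?thesis using p8 by (elim insertE emptyE) simp_all
    qed
    ultimately show ?thesis using 1 Legendre_two[OF p] by (simp add: kronecker_prime_def)
  next
    case 2
    then show ?thesis using p by (simp add: kronecker_prime_def Legendre_def pstar_def cong_0_iff)
  next
    case 3
    then have q2: "2 < q" using q prime_ge_2_nat[of q] by linarith
    then have oq: "odd q" using q prime_odd_nat by blast
    have QR: "Legendre p q * Legendre q p = (-1) ^ ((p - 1) div 2 * ((q - 1) div 2))"
      using Quadratic_Reciprocity[OF p q q2] 3 by auto
    have ep: "even ((p - 1) div 2) \<longleftrightarrow> p mod 4 = 1" using op by presburger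
    have eq: "even ((q - 1) div 2) \<longleftrightarrow> q mod 4 = 1" using oq by presburger
    have "pstar p = (if p mod 4 = 1 then 1 else -1) * int p" by (simp add: pstar_def)
    then have "Legendre (pstar p) q = Legendre (if p mod 4 = 1 then 1 else -1) q * Legendre p q"
      by (simp only: Legendre_mult[OF q q2])
    also have "Legendre (if p mod 4 = 1 then 1 else -1) q = (-1) ^ ((p - 1) div 2 * ((q - 1) div 2))"
    proof -
      have "\<not> [1 = 0] (mod int q)" using q2 by (auto simp: cong_0_iff)
      then have "Legendre 1 q = 1" by (auto simp: Legendre_def QuadRes_def intro: exI[of _ 1])
      then show ?thesis using ep eq Legendre_minus_one[OF q q2]
        by (simp add: minus_one_power_iff)
    qed
    finally have "Legendre (pstar p) q = (Legendre p q * Legendre q p) * Legendre p q"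
      using QR by simp
    moreover have "Legendre p q * Legendre p q = 1"
    proof -
      have "Legendre p q \<noteq> 0" using QR by auto
      then show ?thesis using Legendre_range[of p q] by auto
    qed
    ultimately show ?thesis using 3 by (simp add: kronecker_prime_def algebra_simps)
  qed
qed

text \<open>The symbol \<open>n \<mapsto> (e/n)\<close> for the even prime discriminants \<open>e = -4, 8, -8\<close> and for \<open>e = 1\<close>.\<close>

definition even_char :: "int \<Rightarrow> int \<Rightarrow> int" where
  "even_char e n =
     (if e = 1 then 1
      else if even n then 0
      else if e = -4 then (if n mod 8 = 1 \<or> n mod 8 = 5 then 1 else -1)
      else if e = 8 then (if n mod 8 = 1 \<or> n mod 8 = 7 then 1 else -1)
      else (if n mod 8 = 1 \<or> n mod 8 = 3 then 1 else -1))"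

lemma even_char_cong: "[m = n] (mod 8) \<Longrightarrow> even_char e m = even_char e n"
proof -
  assume "[m = n] (mod 8)"
  then have "m mod 8 = n mod 8" unfolding Cong.cong_def .
  moreover from this have "even m = even n" by presburger
  ultimately show ?thesis by (simp add: even_char_def)
qed

lemma even_char_mult: "even_char e (m * n) = even_char e m * even_char e n"
proof -
  have mod8: "(m * n) mod 8 = ((m mod 8) * (n mod 8)) mod 8" by (simp add: mod_mult_eq)
  consider "even m \<or> even n" | "odd m" "odd n" by blast
  then show ?thesis
  proof cases
    case 1
    moreover have "even_char e k = 0" if "even k" "e \<noteq> 1" for k
      using that by (simp add: even_char_def)
    moreover have "even_char 1 k = 1" for k by (simp add: even_char_def)
    ultimately show ?thesis by (cases "e = 1") auto
  next
    case 2
    have m: "m mod 8 \<in> {1, 3, 5, 7}" using 2(1) by (simp, presburger)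
    have n: "n mod 8 \<in> {1, 3, 5, 7}" using 2(2) by (simp, presburger)
    define x y where xy: "x = m mod 8" "y = n mod 8"
    show ?thesis using 2 m n unfolding even_char_def mod8 xy[symmetric]
      by (elim insertE emptyE) simp_all
  qed
qed

lemma kronecker_prime_even:
  fixes q :: nat
  assumes e: "e \<in> {1, -4, 8, -8}" and q: "prime q"
  shows "kronecker_prime e q = even_char e q"
proof (cases "q = 2")
  case True
  then show ?thesis using e by (auto simp: kronecker_prime_def even_char_def)
next
  case False
  then have q2: "2 < q" using q prime_ge_2_nat[of q] by linarith
  then have oq: "odd q" using q prime_odd_nat by blast
  have L1: "Legendre 1 q = 1"
    using q2 by (auto simp: Legendre_def QuadRes_def cong_0_iff intro: exI[of _ 1])
  have m8: "int q mod 8 = int (q mod 8)" by (simp add: zmod_int)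
  have q8: "q mod 8 \<in> {1, 3, 5, 7}" using oq by (simp, presburger)
  have q4: "q mod 4 = 1 \<longleftrightarrow> q mod 8 = 1 \<or> q mod 8 = 5"
    using q8 mod_mod_cancel[of 4 8 q] by auto
  \<comment> \<open>Everything is reduced to the symbols of -1 and 2, so that the two supplementary
    laws and q mod 8 decide each case.\<close>
  have f: "Legendre (-4) q = Legendre (-1) q * (Legendre 2 q * Legendre 2 q)"
    "Legendre 8 q = Legendre 2 q * (Legendre 2 q * Legendre 2 q)"
    "Legendre (-8) q = Legendre (-1) q * (Legendre 2 q * (Legendre 2 q * Legendre 2 q))"
    by (simp_all flip: Legendre_mult[OF q q2])
  show ?thesis
    using e q8 oq False unfolding kronecker_prime_def even_char_def m8
    by (elim insertE emptyE)
      (simp_all only: f L1 Legendre_minus_one[OF q q2] Legendre_two[OF q q2] q4, simp_all)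
qed

text \<open>Up to sign both sides are the product of the primes dividing m, as m is squarefree. The
  sign is read off modulo 4, where every \<open>pstar p\<close> is 1.\<close>

lemma squarefree_odd_part:
  assumes "odd m" "squarefree (m::int)"
  shows "m = (if m mod 4 = 1 then 1 else -1) * (\<Prod>p\<in>prime_factors (nat \<bar>m\<bar>). pstar p)"
proof -
  define P where "P = prime_factors (nat \<bar>m\<bar>)"
  have m0: "m \<noteq> 0" using assms(1) by auto
  have odd: "odd p" if "p \<in> P" for p
  proof
    assume "even p"
    then have "even (nat \<bar>m\<bar>)" using that unfolding P_def by (meson dvd_trans in_prime_factors_iff)
    then show False using assms(1) by (simp add: even_nat_iff)
  qed
  have sf: "squarefree (nat \<bar>m\<bar>)"
    unfolding squarefree_def
  proof (intro allI impI)
    fix x :: nat assume "x\<^sup>2 dvd nat \<bar>m\<bar>"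
    then have "(int x)\<^sup>2 dvd m" by (simp flip: int_dvd_int_iff)
    then have "is_unit (int x)" using assms(2) unfolding squarefree_def by blast
    then show "is_unit x" by simp
  qed
  have "int (\<Prod>P) = \<bar>m\<bar>"
  proof -
    have "nat \<bar>m\<bar> = (\<Prod>p\<in>P. p ^ multiplicity p (nat \<bar>m\<bar>))"
      unfolding P_def using m0 by (intro prime_factorization_nat) simp
    also have "\<dots> = \<Prod>P"
    proof (rule prod.cong)
      fix p assume "p \<in> P"
      then have "multiplicity p (nat \<bar>m\<bar>) = 1"
        using sf m0 unfolding P_def by (simp add: squarefree_factorial_semiring')
      then show "p ^ multiplicity p (nat \<bar>m\<bar>) = p" by simp
    qed simp
    finally have "int (\<Prod>P) = int (nat \<bar>m\<bar>)" by (simp only:)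
    then show ?thesis by (simp only: int_nat_eq abs_ge_zero if_True)
  qed
  moreover have "\<bar>\<Prod>p\<in>P. pstar p\<bar> = int (\<Prod>P)"
  proof -
    have "\<bar>pstar p\<bar> = int p" for p by (simp add: pstar_def)
    then show ?thesis by (simp add: abs_prod)
  qed
  ultimately have abs: "\<bar>\<Prod>p\<in>P. pstar p\<bar> = \<bar>m\<bar>" by simp
  define Q where "Q = (\<Prod>p\<in>P. pstar p)"
  have "[Q = (\<Prod>p\<in>P. 1)] (mod 4)"
    unfolding Q_def by (rule cong_prod) (use odd pstar_mod4 in \<open>simp add: Cong.cong_def\<close>)
  then have Q4: "Q mod 4 = 1" by (simp add: Cong.cong_def)
  have "Q = m \<or> Q = - m" using abs unfolding Q_def[symmetric] abs_eq_iff .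
  then have "m = (if m mod 4 = 1 then 1 else -1) * Q"
  proof
    assume "Q = - m"
    moreover from this have "m mod 4 \<noteq> 1" using Q4 by presburger
    ultimately show ?thesis by simp
  qed (use Q4 in simp)
  then show ?thesis unfolding Q_def P_def .
qed

text \<open>The classical factorization into prime discriminants. Here e = 1 if D is odd; for D = 4
  m, e = -4 if m is odd, and e = 8 or -8 if m is even, according to m/2 modulo 4.\<close>

lemma fundamental_discriminant_factors:
  assumes "fundamental_discriminant D"
  shows "\<exists>e P. e \<in> {1, -4, 8, -8} \<and> finite P \<and> (\<forall>p\<in>P. prime p \<and> 2 < p) \<and> D = e * (\<Prod>p\<in>P. pstar p)"
proof -
  have main: "\<exists>P. finite P \<and> (\<forall>p\<in>P. prime p \<and> 2 < p) \<and>
      m = (if m mod 4 = 1 then 1 else -1) * (\<Prod>p\<in>P. pstar p)"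
    if "odd m" "squarefree m" for m :: int
  proof (intro exI conjI ballI)
    show "m = (if m mod 4 = 1 then 1 else -1) * (\<Prod>p\<in>prime_factors (nat \<bar>m\<bar>). pstar p)"
      by (rule squarefree_odd_part[OF that])
    fix p assume p: "p \<in> prime_factors (nat \<bar>m\<bar>)"
    then show "prime p" by auto
    have "p \<noteq> 2"
    proof
      assume "p = 2"
      then have "even (nat \<bar>m\<bar>)" using p by auto
      then show False using that(1) by (simp add: even_nat_iff)
    qed
    then show "2 < p" using \<open>prime p\<close> prime_ge_2_nat[of p] by linarith
  qed auto
  from assms consider "D mod 4 = 1" "squarefree D"
    | m where "D = 4 * m" "m mod 4 = 2 \<or> m mod 4 = 3" "squarefree m"
    unfolding fundamental_discriminant_def by blast
  then show ?thesis
  proof cases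
    case 1
    then have "odd D" by presburger
    from main[OF this 1(2)] 1(1) obtain P where "finite P" "\<forall>p\<in>P. prime p \<and> 2 < p"
      "D = 1 * (\<Prod>p\<in>P. pstar p)" by auto
    then show ?thesis by blast
  next
    case 2
    show ?thesis
    proof (cases "odd m")
      case True
      then have "m mod 4 = 3" using 2(2) by presburger
      with main[OF True 2(3)] obtain P where "finite P" "\<forall>p\<in>P. prime p \<and> 2 < p"
        "m = - (\<Prod>p\<in>P. pstar p)" by auto
      moreover from this have "D = -4 * (\<Prod>p\<in>P. pstar p)" using 2(1) by linarith
      ultimately show ?thesis by blast
    next
      case False
      then obtain k where k: "m = 2 * k" by auto
      have "odd k" using 2(2) k by presburger
      have "squarefree k" using 2(3) k squarefree_mono[of k m] by auto
      from main[OF \<open>odd k\<close> this] obtain P where P: "finite P" "\<forall>p\<in>P. prime p \<and> 2 < p"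
        "k = (if k mod 4 = 1 then 1 else -1) * (\<Prod>p\<in>P. pstar p)" by blast
      have "D = (if k mod 4 = 1 then 8 else -8) * (\<Prod>p\<in>P. pstar p)"
        using P(3) 2(1) k by (auto split: if_splits)
      then show ?thesis using P by (intro exI[of _ "if k mod 4 = 1 then 8 else -8"]) auto
    qed
  qed
qed

section \<open>Complete multiplicativity and periodicity of the symbol in its lower argument\<close>

lemma prod_prime_factors_mult:
  fixes f :: "nat \<Rightarrow> int"
  assumes "m \<noteq> 0" "n \<noteq> 0"
  shows "(\<Prod>p\<in>prime_factors (m * n). f p ^ multiplicity p (m * n)) =
    (\<Prod>p\<in>prime_factors m. f p ^ multiplicity p m) * (\<Prod>p\<in>prime_factors n. f p ^ multiplicity p n)"
proof -
  let ?S = "prime_factors (m * n)"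
  have ext: "(\<Prod>p\<in>prime_factors k. f p ^ multiplicity p k) = (\<Prod>p\<in>?S. f p ^ multiplicity p k)"
    if "k dvd m * n" "k \<noteq> 0" for k
  proof (rule prod.mono_neutral_left)
    show "prime_factors k \<subseteq> ?S" using that assms by (intro dvd_prime_factors) auto
    show "\<forall>p\<in>?S - prime_factors k. f p ^ multiplicity p k = 1"
      using that by (auto simp: prime_factors_multiplicity)
  qed simp
  have "(\<Prod>p\<in>?S. f p ^ multiplicity p (m * n)) =
      (\<Prod>p\<in>?S. f p ^ multiplicity p m * f p ^ multiplicity p n)"
  proof (rule prod.cong)
    fix p assume "p \<in> ?S"
    then have "multiplicity p (m * n) = multiplicity p m + multiplicity p n"
      using assms by (intro prime_elem_multiplicity_mult_distrib) auto
    then show "f p ^ multiplicity p (m * n) = f p ^ multiplicity p m * f p ^ multiplicity p n"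
      by (simp only: power_add)
  qed (rule refl)
  also have "\<dots> = (\<Prod>p\<in>?S. f p ^ multiplicity p m) * (\<Prod>p\<in>?S. f p ^ multiplicity p n)"
    by (rule prod.distrib)
  finally show ?thesis
    by (simp only: ext[OF dvd_triv_left assms(1)] ext[OF dvd_triv_right assms(2)])
qed

lemma multiplicity_int:
  assumes "prime p" "n \<noteq> 0"
  shows "multiplicity (int p) (int n) = multiplicity p n"
proof (rule multiplicity_eqI)
  have "p ^ multiplicity p n dvd n" by (rule multiplicity_dvd)
  then show "int p ^ multiplicity p n dvd int n" by (simp flip: of_nat_power)
  have "\<not> p ^ Suc (multiplicity p n) dvd n"
    using assms by (subst power_dvd_iff_le_multiplicity) (auto dest: not_prime_unit)
  then show "\<not> int p ^ Suc (multiplicity p n) dvd int n" by (simp flip: of_nat_power of_nat_mult)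
qed

lemma kronecker_nat:
  assumes "n \<noteq> 0"
  shows "kronecker a (int n) = (\<Prod>p\<in>prime_factors n. kronecker_prime a (int p) ^ multiplicity p n)"
proof -
  have "prime_factors (int n) = int ` prime_factors n"
  proof (intro Set.set_eqI iffI)
    fix x assume x: "x \<in> prime_factors (int n)"
    then have x: "prime x" "x dvd int n" by auto
    from prime_ge_0_int[OF x(1)] obtain k where "x = int k" by (rule nonneg_int_cases)
    moreover from this x have "k \<in> prime_factors n" using assms by (simp add: in_prime_factors_iff)
    ultimately show "x \<in> int ` prime_factors n" by blast
  qed (use assms in \<open>auto simp: in_prime_factors_iff\<close>)
  then have "(\<Prod>p\<in>prime_factors (int n). kronecker_prime a p ^ multiplicity p (int n)) =
      (\<Prod>p\<in>prime_factors n. kronecker_prime a p ^ multiplicity (int p) (int n))"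
    by (simp add: prod.reindex)
  also have "\<dots> = (\<Prod>p\<in>prime_factors n. kronecker_prime a (int p) ^ multiplicity p n)"
    using assms by (intro prod.cong) (auto dest!: in_prime_factors_imp_prime simp: multiplicity_int)
  finally show ?thesis using assms by (simp add: kronecker_def)
qed

lemma kronecker_mult:
  assumes "m \<noteq> 0" "n \<noteq> 0"
  shows "kronecker a (int (m * n)) = kronecker a (int m) * kronecker a (int n)"
  using assms prod_prime_factors_mult[OF assms, of "\<lambda>p. kronecker_prime a (int p)"]
  by (simp add: kronecker_nat del: of_nat_mult)

lemma kronecker_one: "kronecker a 1 = 1"
  using kronecker_nat[of 1 a] by simp

lemma kronecker_of_prime:
  fixes p :: nat
  assumes "prime p"
  shows "kronecker a (int p) = kronecker_prime a p"
proof -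
  have "p \<noteq> 0" using assms by auto
  then show ?thesis using assms by (simp add: kronecker_nat prime_factorization_prime)
qed

text \<open>The function g is the product of the characters of the prime discriminants of D, each
  written with n as the residue variable, so it is periodic on all integers. It is completely
  multiplicative and agrees with the symbol at primes, hence at all n > 0. At -1 each factor is the
  sign of its prime discriminant, so g(-1) is the sign of D; for D < 0 this makes g odd.\<close>

lemma kronecker_periodic_extension:
  assumes "fundamental_discriminant D" "D < 0"
  shows "\<exists>g M. M > 0 \<and> (\<forall>n. kronecker D (int n) = g (int n)) \<and>
    (\<forall>m n. [m = n] (mod (int M)) \<longrightarrow> g m = g n) \<and> (\<forall>n. g (- n) = - g n)"
proof -
  from fundamental_discriminant_factors[OF assms(1)] obtain e P where
    e: "e \<in> {1, -4, 8, -8}" and P: "finite P" "\<And>p. p \<in> P \<Longrightarrow> prime p \<and> 2 < p"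
    and D: "D = e * (\<Prod>p\<in>P. pstar p)" by blast
  define g where "g n = even_char e n * (\<Prod>p\<in>P. Legendre n p)" for n :: int
  have g_mult: "g (m * n) = g m * g n" for m n
  proof -
    have "(\<Prod>p\<in>P. Legendre (m * n) p) = (\<Prod>p\<in>P. Legendre m p * Legendre n p)"
      using P Legendre_mult by (intro prod.cong) auto
    then show ?thesis by (simp add: g_def even_char_mult prod.distrib)
  qed
  have g_1: "g 1 = 1"
  proof -
    have "Legendre 1 p = 1" if "p \<in> P" for p
      using P(2)[OF that] by (auto simp: Legendre_def QuadRes_def cong_0_iff intro: exI[of _ 1])
    then show ?thesis using e by (auto simp: g_def even_char_def)
  qed
  have g_prime: "kronecker_prime D q = g (int q)" if q: "prime q" for q :: nat
  proof -
    have "kronecker_prime (\<Prod>p\<in>Q. pstar p) q = (\<Prod>p\<in>Q. Legendre q p)" if "Q \<subseteq> P" for Q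
      using finite_subset[OF that P(1)] that
    proof (induction Q)
      case empty
      then show ?case using kronecker_prime_even[of 1, OF _ q] by (simp add: even_char_def)
    next
      case (insert p Q)
      then show ?case using kronecker_prime_pstar[OF _ _ q] P(2)[of p]
        by (simp add: kronecker_prime_mult[OF q])
    qed
    then show ?thesis
      using e by (simp add: D kronecker_prime_mult[OF q] g_def kronecker_prime_even[OF e q])
  qed
  \<comment> \<open>The symbol at 0 is 0 because |D| is not 1. On the other side some factor of g
    has to vanish at 0: if there is no odd prime discriminant, D < 0 forces e to differ from
    1.\<close>
  have g_0: "g 0 = 0"
  proof (cases "P = {}")
    case True
    then have "e \<noteq> 1" using D assms(2) by auto
    then show ?thesis by (simp add: g_def even_char_def)
  next
    case False
    then have "\<exists>p\<in>P. Legendre 0 p = 0" by (auto simp: Legendre_def)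
    then have "(\<Prod>p\<in>P. Legendre 0 p) = 0" using P(1) by (simp add: prod_zero_iff)
    then show ?thesis by (simp add: g_def)
  qed
  have D1: "\<bar>D\<bar> \<noteq> 1"
  proof
    assume "\<bar>D\<bar> = 1"
    then have "D = -1" using assms(2) by auto
    then show False using assms(1) by (auto simp: fundamental_discriminant_def)
  qed
  have "kronecker D (int n) = g (int n)" for n
  proof (cases "n = 0")
    case True
    then show ?thesis using g_0 D1 by (simp add: kronecker_def)
  next
    case False
    then show ?thesis
    proof (induction n rule: prime_divisors_induct)
      case (factor p x)
      show ?case
      proof (cases "x = 0")
        case False
        then have "kronecker D (int (p * x)) = kronecker D (int p) * kronecker D (int x)"
          using factor by (intro kronecker_mult) auto
        then show ?thesis using False factor g_prime[of p] kronecker_of_prime[of p D] by (simp add: g_mult)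
      qed (use factor in auto)
    qed (auto simp: kronecker_one g_1)
  qed
  moreover have "g m = g n" if "[m = n] (mod (int (8 * \<Prod>P)))" for m n
  proof -
    have "Legendre m p = Legendre n p" if "p \<in> P" for p
    proof (rule Legendre_cong)
      have "int p dvd int (8 * \<Prod>P)" using that P(1) by (simp add: dvd_prod_eqI dvd_mult)
      then show "[m = n] (mod int p)" using \<open>[m = n] (mod _)\<close> cong_dvd_modulus by blast
    qed
    moreover have "even_char e m = even_char e n"
      by (rule even_char_cong, rule cong_dvd_modulus[OF that]) simp
    ultimately show ?thesis by (simp add: g_def)
  qed
  moreover have "g (- n) = - g n" for n
  proof -
    have L: "Legendre (-1) p = sgn (pstar p)" if "p \<in> P" for p
      using P(2)[OF that] Legendre_minus_one[of p] unfolding pstar_def by (cases "p mod 4 = 1") simp_all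
    have "even_char e (-1) = sgn e" using e unfolding even_char_def by (elim insertE emptyE) simp_all
    moreover have "sgn (\<Prod>p\<in>P. pstar p) = (\<Prod>p\<in>P. sgn (pstar p))"
      by (induction P rule: infinite_finite_induct) (simp_all add: sgn_mult)
    moreover have "(\<Prod>p\<in>P. sgn (pstar p)) = (\<Prod>p\<in>P. Legendre (-1) p)"
      by (rule prod.cong) (simp_all only: L)
    ultimately have "g (-1) = sgn D" unfolding g_def D sgn_mult by (simp only:)
    then have "g (-1) = -1" using assms(2) by (simp only: sgn_neg)
    then show ?thesis using g_mult[of "-1" n] by (simp only: mult_minus1)
  qed
  moreover have "8 * \<Prod>P > (0::nat)" using P(2) by (auto intro!: prod_pos dest: prime_gt_0_nat)
  ultimately show ?thesis by (intro exI[of _ g] exI[of _ "8 * \<Prod>P"] conjI allI impI) 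
qed

text \<open>The extension is odd and has period M, so n \<mapsto> M - n negates the terms of one
  period and the sum equals its own negative. Mean zero over a period is the input for the entire
  continuation and for bounded partial sums.\<close>

theorem kronecker_periodic:
  assumes "fundamental_discriminant D" "D < 0"
  shows "\<exists>M>0. (\<forall>n. kronecker D (int (n + M)) = kronecker D (int n)) \<and>
    (\<Sum>n<M. kronecker D (int n)) = 0"
proof -
  from kronecker_periodic_extension[OF assms] obtain g M where
    M: "M > 0" and g: "\<And>n. kronecker D (int n) = g (int n)"
    and per: "\<And>m n. [m = n] (mod (int M)) \<Longrightarrow> g m = g n" and odd: "\<And>n. g (- n) = - g n"
    by blast
  have "g (int (n + M)) = g (int n)" for n by (rule per) (simp add: Cong.cong_def)
  moreover have "(\<Sum>n<M. g (int n)) = 0"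
  proof -
    have g0: "g 0 = 0" using odd[of 0] by simp
    have "{..<M} = insert 0 {1..<M}" using M by auto
    then have eq: "(\<Sum>n<M. g (int n)) = (\<Sum>n\<in>{1..<M}. g (int n))"
      using g0 by simp
    also have "\<dots> = (\<Sum>n\<in>{1..<M}. g (int (M - n)))"
      by (rule sum.reindex_bij_witness[of _ "\<lambda>n. M - n" "\<lambda>n. M - n"]) auto
    also have "\<dots> = (\<Sum>n\<in>{1..<M}. - g (int n))"
    proof (rule sum.cong)
      fix n assume "n \<in> {1..<M}"
      then have "g (int (M - n)) = g (- int n)" by (intro per) (auto simp: Cong.cong_def of_nat_diff)
      then show "g (int (M - n)) = - g (int n)" using odd by simp
    qed simp
    finally have "(\<Sum>n<M. g (int n)) = - (\<Sum>n\<in>{1..<M}. g (int n))" by (simp add: sum_negf)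
    then show ?thesis using eq by simp
  qed
  ultimately have "(\<forall>n. kronecker D (int (n + M)) = kronecker D (int n)) \<and> (\<Sum>n<M. kronecker D (int n)) = 0"
    unfolding g by blast
  then show ?thesis using M by blast
qed

section \<open>Entire continuation of Dirichlet series with periodic coefficients\<close>

definition periodic_mean_zero :: "nat \<Rightarrow> (nat \<Rightarrow> complex) \<Rightarrow> bool" where
  "periodic_mean_zero M c \<longleftrightarrow> (\<forall>n. c (n + M) = c n) \<and> (\<Sum>n<M. c n) = 0"

lemma periodic_sum_shift:
  fixes c :: "nat \<Rightarrow> 'a::ab_group_add"
  assumes "\<And>n. c (n + M) = c n"
  shows "(\<Sum>n<M. c (n + k)) = (\<Sum>n<M. c n)"
proof (induction k)
  case (Suc k)
  have "(\<Sum>n<Suc M. c (n + k)) = c k + (\<Sum>n<M. c (n + Suc k))"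
    by (subst sum.lessThan_Suc_shift) simp
  moreover have "(\<Sum>n<Suc M. c (n + k)) = (\<Sum>n<M. c (n + k)) + c k"
    using assms[of k] by (simp add: add.commute)
  ultimately show ?case using Suc by (simp add: algebra_simps)
qed simp

lemma periodic_bounded:
  fixes c :: "nat \<Rightarrow> 'a::real_normed_vector"
  assumes "\<And>n. c (n + M) = c n" "M > 0"
  shows "\<exists>K\<ge>0. \<forall>n. norm (c n) \<le> K"
proof (intro exI conjI allI)
  fix n
  have "c (k + M * i) = c k" for k i
    using assms(1)[of "k + M * (i - 1)" for i] by (induction i) (simp_all add: add.assoc[symmetric] add.commute[of M] assms(1))
  from this[of "n mod M" "n div M"] have "c n = c (n mod M)" by simp
  moreover have "norm (c (n mod M)) \<le> (\<Sum>k<M. norm (c k))"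
    using assms(2) by (intro member_le_sum) auto
  ultimately show "norm (c n) \<le> (\<Sum>k<M. norm (c k))" by (simp only:)
qed (simp add: sum_nonneg)

text \<open>Mean zero makes the partial sums periodic again; subtracting their own mean m restores
  mean zero, so that summation by parts can be repeated indefinitely.\<close>

lemma periodic_mean_zero_primitive:
  assumes "periodic_mean_zero M c" "M > 0"
  obtains C where "periodic_mean_zero M C" "\<And>n. c n = C (Suc n) - C n"
proof -
  define m where "m = (\<Sum>n<M. \<Sum>k<n. c k) / of_nat M"
  define C where "C n = (\<Sum>k<n. c k) - m" for n
  have "(\<Sum>k<n + M. c k) = (\<Sum>k<n. c k)" for n
  proof -
    have "(\<Sum>k<n + M. c k) = (\<Sum>k<n. c k) + (\<Sum>k<M. c (k + n))"
      by (induction M) (simp_all add: algebra_simps)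
    also have "(\<Sum>k<M. c (k + n)) = 0"
      using periodic_sum_shift[of c M n] assms(1) by (simp add: periodic_mean_zero_def)
    finally show ?thesis by simp
  qed
  then have "periodic_mean_zero M C"
    using assms(2) unfolding periodic_mean_zero_def C_def by (simp add: sum_subtractf m_def)
  moreover have "c n = C (Suc n) - C n" for n by (simp add: C_def)
  ultimately show ?thesis using that by blast
qed

lemma periodic_mean_zero_Suc:
  assumes "periodic_mean_zero M c"
  shows "periodic_mean_zero M (\<lambda>n. c (Suc n))"
  using assms periodic_sum_shift[of c M 1] unfolding periodic_mean_zero_def
  by (simp flip: add_Suc)

text \<open>This is (-1)^k times the k-th forward difference of x^(-s): entire in s, and k powers of
  x smaller than x^(-s).\<close>

fun diff_powr :: "nat \<Rightarrow> complex \<Rightarrow> real \<Rightarrow> complex" where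
  "diff_powr 0 s x = of_real x powr (-s)"
| "diff_powr (Suc k) s x = diff_powr k s x - diff_powr k s (x + 1)"

lemma diff_powr_holomorphic: "x > 0 \<Longrightarrow> (\<lambda>s. diff_powr k s x) holomorphic_on A"
  by (induction k arbitrary: x) (auto intro!: holomorphic_intros)

lemma diff_powr_has_vector_derivative:
  assumes "x > 0"
  shows "(diff_powr k s has_vector_derivative (- s * diff_powr k (s + 1) x)) (at x within A)"
  using assms
proof (induction k arbitrary: x A)
  case 0
  have "((\<lambda>z. z powr (-s)) has_field_derivative (- s * of_real x powr (- s - 1))) (at (of_real x))"
    using 0 by (intro has_field_derivative_powr) (auto simp: complex_nonpos_Reals_iff)
  then have "((\<lambda>x. (of_real x) powr (-s)) has_vector_derivative (- s * of_real x powr (- s - 1))) (at x within A)"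
    by (rule has_vector_derivative_real_field)
  moreover have "- s - 1 = - (s + 1)" by simp
  moreover have "diff_powr 0 s = (\<lambda>x. (of_real x) powr (-s))" by auto
  ultimately show ?case by (simp only: diff_powr.simps)
next
  case (Suc k)
  have shift: "((\<lambda>x. diff_powr k s (x + 1)) has_vector_derivative
      (- s * diff_powr k (s + 1) (x + 1))) (at x within A)"
  proof -
    have "(diff_powr k s has_vector_derivative (- s * diff_powr k (s + 1) (x + 1)))
        (at (x + 1) within ((\<lambda>x. x + 1) ` A))"
      by (rule Suc.IH) (use Suc.prems in auto)
    moreover have "((\<lambda>x. x + 1) has_vector_derivative 1) (at x within A)"
      by (auto intro!: derivative_eq_intros)
    ultimately show ?thesis
      using vector_diff_chain_within[of "\<lambda>x. x + 1" 1 x A "diff_powr k s"] by (simp add: o_def)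
  qed
  have "diff_powr (Suc k) s = (\<lambda>x. diff_powr k s x - diff_powr k s (x + 1))" by auto
  then show ?case
    using has_vector_derivative_diff[OF Suc.IH[OF Suc.prems] shift] by (simp add: algebra_simps)
qed

text \<open>The derivative in x of the k-th difference at s is -s times the k-th difference at s +
  1. So one more difference over a unit interval costs a factor |s| and gains a power of x;
  iterating with |s + 1| \<le> |s| + 1 produces the Pochhammer symbol. The condition on Re s makes
  the bound decreasing in x, so that the left end of the interval decides.\<close>

lemma norm_diff_powr_le:
  assumes "x > 0" "Re s + real k \<ge> 0"
  shows "norm (diff_powr k s x) \<le> pochhammer (norm s) k * x powr (- Re s - real k)"
  using assms
proof (induction k arbitrary: s x)
  case 0
  then show ?case by (simp add: norm_powr_real_powr)
next
  case (Suc k)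
  define B where "B = norm s * (pochhammer (norm s + 1) k * x powr (- Re s - real (Suc k)))"
  have bound: "norm (- s * diff_powr k (s + 1) y) \<le> B" if "y \<in> {x..x + 1}" for y
  proof -
    have "norm (diff_powr k (s + 1) y) \<le> pochhammer (norm (s + 1)) k * y powr (- Re (s + 1) - real k)"
      using that Suc.prems by (intro Suc.IH) auto
    also have "\<dots> \<le> pochhammer (norm s + 1) k * x powr (- Re s - real (Suc k))"
    proof (intro mult_mono)
      show "pochhammer (norm (s + 1)) k \<le> pochhammer (norm s + 1) k"
        unfolding pochhammer_prod using norm_triangle_ineq[of s 1] by (intro prod_mono) auto
      have "y powr (- Re s - real (Suc k)) \<le> x powr (- Re s - real (Suc k))"
        using that Suc.prems by (intro powr_mono2') auto
      moreover have "- Re (s + 1) - real k = - Re s - real (Suc k)" by simp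
      ultimately show "y powr (- Re (s + 1) - real k) \<le> x powr (- Re s - real (Suc k))"
        by (simp only:)
    qed (auto intro!: pochhammer_nonneg add_nonneg_pos)
    finally show ?thesis by (simp add: norm_mult B_def mult_left_mono)
  qed
  have "norm (diff_powr k s (x + 1) - diff_powr k s x) \<le> B * norm (x + 1 - x)"
  proof (rule differentiable_bound[of "{x..x + 1}" _ "\<lambda>y h. h *\<^sub>R (- s * diff_powr k (s + 1) y)"])
    fix y assume y: "y \<in> {x..x + 1}"
    show "(diff_powr k s has_derivative (\<lambda>h. h *\<^sub>R (- s * diff_powr k (s + 1) y))) (at y within {x..x + 1})"
      using diff_powr_has_vector_derivative[of y k s] y Suc.prems
      unfolding has_vector_derivative_def by auto
    show "onorm (\<lambda>h. h *\<^sub>R (- s * diff_powr k (s + 1) y)) \<le> B"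
    proof (rule onorm_le)
      fix h :: real
      show "norm (h *\<^sub>R (- s * diff_powr k (s + 1) y)) \<le> B * norm h"
        using mult_left_mono[OF bound[OF y], of "\<bar>h\<bar>"] by (simp add: mult.commute)
    qed
  qed auto
  then have "norm (diff_powr (Suc k) s x) \<le> B" by (simp add: norm_minus_commute)
  then show ?case by (simp add: B_def pochhammer_rec mult.assoc)
qed

lemma diff_powr_tendsto_0:
  assumes "Re s + real k > 0"
  shows "(\<lambda>n. diff_powr k s (real n + 1)) \<longlonglongrightarrow> 0"
proof (rule Lim_null_comparison)
  show "\<forall>\<^sub>F n in sequentially. norm (diff_powr k s (real n + 1)) \<le>
      pochhammer (norm s) k * (real n + 1) powr (- Re s - real k)"
    using assms by (intro always_eventually allI norm_diff_powr_le) auto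
  have "(\<lambda>n. (real n + 1) powr (- Re s - real k)) \<longlonglongrightarrow> 0"
    using assms by real_asymp
  then show "(\<lambda>n. pochhammer (norm s) k * (real n + 1) powr (- Re s - real k)) \<longlonglongrightarrow> 0"
    by (rule tendsto_mult_right_zero)
qed

lemma diff_powr_series_base:
  assumes "periodic_mean_zero M c" "M > 0"
  shows "\<exists>F. F holomorphic_on {s. Re s > 1 - real j} \<and>
    (\<forall>s. Re s > 1 - real j \<longrightarrow> (\<lambda>n. c n * diff_powr j s (real n + 1)) sums F s)"
proof -
  obtain K where K: "K \<ge> 0" "\<And>n. norm (c n) \<le> K"
    using periodic_bounded[of c M] assms unfolding periodic_mean_zero_def by blast
  define A where "A = {s :: complex. Re s > 1 - real j}"
  define F where "F s = suminf (\<lambda>n. c n * diff_powr j s (real n + 1))" for s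
  have ex: "\<exists>d>0. cball z d \<subseteq> A \<and>
      uniform_limit (cball z d) (\<lambda>N s. \<Sum>n<N. c n * diff_powr j s (real n + 1)) F sequentially"
    if "z \<in> A" for z
  proof -
    \<comment> \<open>Half the distance from z to the line Re s = 1 - j: on the ball the exponents
      are at most -1 - d, and W is summable.\<close>
    define d where "d = (Re z - (1 - real j)) / 2"
    have d: "d > 0" using that by (simp add: d_def A_def)
    have Re: "Re s \<ge> Re z - d" if "s \<in> cball z d" for s
      using that complex_Re_le_cmod[of "z - s"] by (simp add: dist_norm)
    have sub: "cball z d \<subseteq> A"
    proof
      fix s assume "s \<in> cball z d"
      from Re[OF this] d show "s \<in> A" unfolding A_def d_def by (simp add: field_simps)
    qed
    define W where "W n = K * (pochhammer (norm z + d) j * (real n + 1) powr (- (Re z - d) - real j))" for n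
    have "uniform_limit (cball z d) (\<lambda>N s. \<Sum>n<N. c n * diff_powr j s (real n + 1)) F sequentially"
      unfolding F_def
    proof (rule Weierstrass_m_test)
      fix n s assume s: "s \<in> cball z d"
      have "Re s + real j \<ge> 0" using s sub by (auto simp: A_def)
      then have "norm (diff_powr j s (real n + 1)) \<le> pochhammer (norm s) j * (real n + 1) powr (- Re s - real j)"
        by (intro norm_diff_powr_le) auto
      also have "\<dots> \<le> pochhammer (norm z + d) j * (real n + 1) powr (- (Re z - d) - real j)"
      proof (intro mult_mono)
        have "norm s \<le> norm z + d"
          using s norm_triangle_ineq4[of z "z - s"] by (simp add: dist_norm)
        then show "pochhammer (norm s) j \<le> pochhammer (norm z + d) j"
          unfolding pochhammer_prod by (intro prod_mono) auto
        show "(real n + 1) powr (- Re s - real j) \<le> (real n + 1) powr (- (Re z - d) - real j)"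
          using Re[OF s] by (intro powr_mono) auto
        show "0 \<le> pochhammer (norm z + d) j"
          unfolding pochhammer_prod using d by (intro prod_nonneg) auto
      qed auto
      finally show "norm (c n * diff_powr j s (real n + 1)) \<le> W n"
        unfolding norm_mult W_def using K by (intro mult_mono) auto
    next
      have "1 < Re z - d + real j" using d unfolding d_def by (simp add: field_simps)
      then have "summable (\<lambda>n. real n powr (- (Re z - d) - real j))"
        by (subst summable_real_powr_iff) auto
      then have "summable (\<lambda>n. (real n + 1) powr (- (Re z - d) - real j))"
        using summable_Suc_iff[of "\<lambda>n. real n powr (- (Re z - d) - real j)"] by (simp add: add.commute)
      then show "summable W" unfolding W_def by (intro summable_mult)
    qed
    then show ?thesis using d sub by blast
  qed
  have "F holomorphic_on A"
  proof (rule holomorphic_uniform_sequence[OF _ _ ex])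
    show "open A" unfolding A_def by (simp add: open_halfspace_Re_gt)
    show "(\<lambda>s. \<Sum>n<N. c n * diff_powr j s (real n + 1)) holomorphic_on A" for N
      by (intro holomorphic_intros diff_powr_holomorphic) auto
  qed
  moreover have "(\<lambda>n. c n * diff_powr j s (real n + 1)) sums F s" if s: "s \<in> A" for s
  proof -
    obtain d where d: "d > 0"
      "uniform_limit (cball s d) (\<lambda>N s. \<Sum>n<N. c n * diff_powr j s (real n + 1)) F sequentially"
      using ex[OF s] by blast
    from tendsto_uniform_limitI[OF d(2), of s] d(1) show ?thesis by (simp add: sums_def)
  qed
  ultimately show ?thesis unfolding A_def by blast
qed

text \<open>Summation by parts trades the coefficients for a primitive and the function for its difference,
  which decays one power faster.\<close>

lemma diff_powr_series_continuation:
  assumes "periodic_mean_zero M c" "M > 0"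
  shows "\<exists>F. F holomorphic_on {s. Re s > 1 - real j - real k} \<and>
    (\<forall>s. Re s > - real j \<and> Re s > 1 - real j - real k \<longrightarrow>
      (\<lambda>n. c n * diff_powr j s (real n + 1)) sums F s)"
  using assms(1)
proof (induction k arbitrary: c j)
  case 0
  from diff_powr_series_base[OF 0 assms(2), of j] show ?case by auto
next
  case (Suc k)
  from periodic_mean_zero_primitive[OF Suc.prems assms(2)] obtain C where
    C: "periodic_mean_zero M C" "\<And>n. c n = C (Suc n) - C n" by blast
  from Suc.IH[OF periodic_mean_zero_Suc[OF C(1)], of "Suc j"] obtain F where
    F: "F holomorphic_on {s. Re s > 1 - real (Suc j) - real k}" and
    S: "\<And>s. Re s > - real (Suc j) \<Longrightarrow> Re s > 1 - real (Suc j) - real k \<Longrightarrow>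
      (\<lambda>n. C (Suc n) * diff_powr (Suc j) s (real n + 1)) sums F s" by blast
  have shift: "1 - real (Suc j) - real k = 1 - real j - real (Suc k)" by simp
  obtain K where K: "\<And>n. norm (C n) \<le> K"
    using periodic_bounded[of C M] C(1) assms(2) unfolding periodic_mean_zero_def by blast
  define G where "G s = - C 0 * diff_powr j s 1 + F s" for s
  have "G holomorphic_on {s. Re s > 1 - real j - real (Suc k)}"
    unfolding G_def using F unfolding shift by (intro holomorphic_intros diff_powr_holomorphic) auto
  moreover have "(\<lambda>n. c n * diff_powr j s (real n + 1)) sums G s"
    if s: "Re s > - real j" "Re s > 1 - real j - real (Suc k)" for s
  proof -
    have parts: "(\<Sum>n<N. c n * diff_powr j s (real n + 1)) =
        C N * diff_powr j s (real N + 1) - C 0 * diff_powr j s 1 +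
        (\<Sum>n<N. C (Suc n) * diff_powr (Suc j) s (real n + 1))" for N
      by (induction N) (simp_all add: C(2) algebra_simps)
    \<comment> \<open>The boundary term of the summation by parts vanishes for Re s > -j. This is
      why convergence of the series is claimed only there, while the continuation F reaches further
      to the left.\<close>
    have "(\<lambda>N. C N * diff_powr j s (real N + 1)) \<longlonglongrightarrow> 0"
    proof (rule Lim_null_comparison)
      show "\<forall>\<^sub>F N in sequentially. norm (C N * diff_powr j s (real N + 1)) \<le> K * norm (diff_powr j s (real N + 1))"
        using K by (intro always_eventually allI) (simp add: norm_mult mult_right_mono)
      have "(\<lambda>N. norm (diff_powr j s (real N + 1))) \<longlonglongrightarrow> 0"
        using diff_powr_tendsto_0[of s j] s by (intro tendsto_norm_zero) auto
      then show "(\<lambda>N. K * norm (diff_powr j s (real N + 1))) \<longlonglongrightarrow> 0"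
        by (rule tendsto_mult_right_zero)
    qed
    moreover have "(\<lambda>n. C (Suc n) * diff_powr (Suc j) s (real n + 1)) sums F s"
      using s by (intro S) auto
    ultimately have "(\<lambda>N. C N * diff_powr j s (real N + 1) - C 0 * diff_powr j s 1 +
        (\<Sum>n<N. C (Suc n) * diff_powr (Suc j) s (real n + 1))) \<longlonglongrightarrow> 0 - C 0 * diff_powr j s 1 + F s"
      unfolding sums_def by (intro tendsto_intros)
    then show ?thesis unfolding sums_def parts G_def by simp
  qed
  ultimately show ?case by blast
qed

text \<open>For each k there is a continuation to Re s > -k. All of them equal the series for Re s >
  0, so they agree wherever two are defined, and H evaluates at s one whose half-plane contains s.
  Convergence down to Re s > 0 is kept in the statement because the zero is reached through partial
  sums of the series.\<close>

theorem periodic_Dirichlet_series_entire: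
  assumes "periodic_mean_zero M c" "M > 0"
  shows "\<exists>F. F holomorphic_on UNIV \<and>
    (\<forall>s. Re s > 0 \<longrightarrow> (\<lambda>n. c n * of_nat (Suc n) powr (-s)) sums F s)"
proof -
  have "\<exists>F. \<forall>k. F k holomorphic_on {s. Re s > - real k} \<and>
    (\<forall>s. Re s > 0 \<longrightarrow> (\<lambda>n. c n * diff_powr 0 s (real n + 1)) sums F k s)"
  proof (rule choice, rule allI)
    fix k
    show "\<exists>F. F holomorphic_on {s. Re s > - real k} \<and>
      (\<forall>s. Re s > 0 \<longrightarrow> (\<lambda>n. c n * diff_powr 0 s (real n + 1)) sums F s)"
      using diff_powr_series_continuation[OF assms, of 0 "Suc k"] by fastforce
  qed
  then obtain F where F: "\<And>k. F k holomorphic_on {s. Re s > - real k}"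
    and S: "\<And>k s. Re s > 0 \<Longrightarrow> (\<lambda>n. c n * diff_powr 0 s (real n + 1)) sums F k s" by blast
  have same: "F k s = F l s" if "Re s > - real k" "k \<le> l" for k l s
  proof (rule analytic_continuation_open[where s = "{s. Re s > 0}" and s' = "{s. Re s > - real k}" and f = "F k" and g = "F l"])
    show "F l holomorphic_on {s. Re s > - real k}"
      by (rule holomorphic_on_subset[OF F[of l]]) (use that in auto)
    show "connected {s. - real k < Re s}"
      by (intro convex_connected convex_halfspace_Re_gt)
    show "{s. 0 < Re s} \<noteq> {}" by (auto intro: exI[of _ 1])
    fix z assume "z \<in> {s. 0 < Re s}"
    then show "F k z = F l z" using S[of z k] S[of z l] by (auto intro: sums_unique2)
  qed (use that F in \<open>auto simp: open_halfspace_Re_gt\<close>)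
  define H where "H s = F (nat \<lceil>1 - Re s\<rceil>) s" for s
  have H: "H s = F k s" if "Re s > - real k" for s k
  proof -
    have "Re s > - real (nat \<lceil>1 - Re s\<rceil>)" by linarith
    then show ?thesis
      using same[of "nat \<lceil>1 - Re s\<rceil>" s k] same[of k s "nat \<lceil>1 - Re s\<rceil>"] that
      unfolding H_def by (cases "k \<le> nat \<lceil>1 - Re s\<rceil>") auto
  qed
  have "H holomorphic_on UNIV"
  proof -
    have "H holomorphic_on (\<Union>k. {s. Re s > - real k})"
    proof (rule holomorphic_on_UN_open)
      show "H holomorphic_on {s. Re s > - real k}" for k
        by (rule holomorphic_transform[OF F[of k]]) (simp add: H)
    qed (auto simp: open_halfspace_Re_gt)
    moreover have "(\<Union>k. {s. Re s > - real k}) = UNIV"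
    proof -
      have "\<exists>k. Re s > - real k" for s :: complex
        using reals_Archimedean2[of "- Re s"] by (auto simp: minus_less_iff)
      then show ?thesis by auto
    qed
    ultimately show ?thesis by simp
  qed
  moreover have "(\<lambda>n. c n * of_nat (Suc n) powr (-s)) sums H s" if "Re s > 0" for s
    using S[OF that, of 0] H[of 0 s] that by (simp add: add.commute)
  ultimately show ?thesis by blast
qed

section \<open>The divisor sums of a character and the hyperbola method\<close>

definition divisor_sum :: "(nat \<Rightarrow> 'a) \<Rightarrow> nat \<Rightarrow> 'a::comm_semiring_1" where
  "divisor_sum f N = (\<Sum>e | e dvd N. f e)"

lemma sum_divisor_pairs:
  fixes f :: "nat \<Rightarrow> nat \<Rightarrow> 'a::comm_monoid_add"
  shows "(\<Sum>N=1..K. \<Sum>e | e dvd N. f e (N div e)) = (\<Sum>(e, m)\<in>{(e, m). 1 \<le> e \<and> 1 \<le> m \<and> e * m \<le> K}. f e m)"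
proof -
  have "(\<Sum>N=1..K. \<Sum>e | e dvd N. f e (N div e)) =
      (\<Sum>(N, e)\<in>(SIGMA N:{1..K}. {e. e dvd N}). f e (N div e))"
    by (rule sum.Sigma) auto
  also have "\<dots> = (\<Sum>(e, m)\<in>{(e, m). 1 \<le> e \<and> 1 \<le> m \<and> e * m \<le> K}. f e m)"
    by (rule sum.reindex_bij_witness[of _ "\<lambda>(e, m). (e * m, e)" "\<lambda>(N, e). (e, N div e)"])
      (auto elim!: dvdE)
  finally show ?thesis .
qed

text \<open>The pairs with e m \<le> n^2 are split at e = n; those with e > n have m \<le> n. The
  cut-off is a square so that the splitting point is an integer. Complete multiplicativity of w
  separates the variables.\<close>

lemma hyperbola_method:
  fixes chi w :: "nat \<Rightarrow> real"
  assumes w: "\<And>e m. e \<ge> 1 \<Longrightarrow> m \<ge> 1 \<Longrightarrow> w (e * m) = w e * w m"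
  shows "(\<Sum>N=1..n\<^sup>2. divisor_sum chi N * w N) =
    (\<Sum>e=1..n. chi e * w e * (\<Sum>m=1..n\<^sup>2 div e. w m)) +
    (\<Sum>m=1..n. w m * ((\<Sum>e=1..n\<^sup>2 div m. chi e * w e) - (\<Sum>e=1..n. chi e * w e)))"
proof -
  let ?f = "\<lambda>e m. chi e * w e * w m"
  let ?P = "{(e, m). 1 \<le> e \<and> 1 \<le> m \<and> e * m \<le> n\<^sup>2}"
  have fin: "finite ?P"
  proof (rule finite_subset)
    show "?P \<subseteq> {1..n\<^sup>2} \<times> {1..n\<^sup>2}"
    proof clarify
      fix e m :: nat assume a: "1 \<le> e" "1 \<le> m" "e * m \<le> n\<^sup>2"
      have "e \<le> e * m" "m \<le> e * m" using a by simp_all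
      from this[THEN order_trans, OF a(3)] a(1,2) show "e \<in> {1..n\<^sup>2} \<and> m \<in> {1..n\<^sup>2}" by simp
    qed
  qed auto
  have "(\<Sum>N=1..n\<^sup>2. divisor_sum chi N * w N) = (\<Sum>N=1..n\<^sup>2. \<Sum>e | e dvd N. ?f e (N div e))"
    unfolding divisor_sum_def sum_distrib_right
  proof (intro sum.cong refl)
    fix N e assume N: "N \<in> {1..n\<^sup>2}" and "e \<in> {e. e dvd N}"
    then obtain m where m: "N = e * m" by (auto elim: dvdE)
    then have "e \<ge> 1" "m \<ge> 1" using N by (auto simp: Suc_le_eq)
    then show "chi e * w N = ?f e (N div e)" using m w[of e m] by simp
  qed
  also have "\<dots> = (\<Sum>(e, m)\<in>?P. ?f e m)" by (rule sum_divisor_pairs)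
  also have "\<dots> = (\<Sum>(e, m)\<in>?P \<inter> {(e, m). e \<le> n}. ?f e m) + (\<Sum>(e, m)\<in>?P - {(e, m). e \<le> n}. ?f e m)"
    by (rule sum.Int_Diff[OF fin])
  also have "(\<Sum>(e, m)\<in>?P \<inter> {(e, m). e \<le> n}. ?f e m) = (\<Sum>e=1..n. chi e * w e * (\<Sum>m=1..n\<^sup>2 div e. w m))"
  proof -
    have "?P \<inter> {(e, m). e \<le> n} = (SIGMA e:{1..n}. {1..n\<^sup>2 div e})"
      by (auto simp: less_eq_div_iff_mult_less_eq mult.commute)
    then show ?thesis by (simp add: sum.Sigma[symmetric] sum_distrib_left)
  qed
  also have "(\<Sum>(e, m)\<in>?P - {(e, m). e \<le> n}. ?f e m) =
      (\<Sum>m=1..n. w m * ((\<Sum>e=1..n\<^sup>2 div m. chi e * w e) - (\<Sum>e=1..n. chi e * w e)))"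
  proof -
    have "(\<Sum>(e, m)\<in>?P - {(e, m). e \<le> n}. ?f e m) = (\<Sum>(m, e)\<in>(SIGMA m:{1..n}. {n<..n\<^sup>2 div m}). ?f e m)"
    proof (rule sum.reindex_bij_witness[of _ "\<lambda>(m, e). (e, m)" "\<lambda>(e, m). (m, e)"])
      fix x assume x: "x \<in> ?P - {(e, m). e \<le> n}"
      obtain e m where em: "x = (e, m)" by (cases x)
      have h: "1 \<le> m" "e * m \<le> n\<^sup>2" "n < e" using x em by auto
      have "m \<le> n"
      proof (rule ccontr)
        assume "\<not> m \<le> n"
        then have "Suc n * Suc n \<le> e * m" using h by (intro mult_le_mono) auto
        then show False using h(2) by (simp add: power2_eq_square)
      qed
      then show "(case x of (e, m) \<Rightarrow> (m, e)) \<in> (SIGMA m:{1..n}. {n<..n\<^sup>2 div m})"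
        using h em by (simp add: less_eq_div_iff_mult_less_eq)
    qed (auto simp: less_eq_div_iff_mult_less_eq)
    also have "\<dots> = (\<Sum>m=1..n. \<Sum>e\<in>{n<..n\<^sup>2 div m}. ?f e m)"
      by (simp add: sum.Sigma)
    also have "\<dots> = (\<Sum>m=1..n. w m * ((\<Sum>e=1..n\<^sup>2 div m. chi e * w e) - (\<Sum>e=1..n. chi e * w e)))"
    proof (rule sum.cong)
      fix m assume m: "m \<in> {1..n}"
      then have "n * m \<le> n\<^sup>2" by (simp add: power2_eq_square)
      then have "n \<le> n\<^sup>2 div m" using m by (simp add: less_eq_div_iff_mult_less_eq)
      then have "{1..n\<^sup>2 div m} = {1..n} \<union> {n<..n\<^sup>2 div m}" by auto
      then have "(\<Sum>e=1..n\<^sup>2 div m. chi e * w e) = (\<Sum>e=1..n. chi e * w e) + (\<Sum>e\<in>{n<..n\<^sup>2 div m}. chi e * w e)"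
        by (simp add: sum.union_disjoint ivl_disj_int)
      then show "(\<Sum>e\<in>{n<..n\<^sup>2 div m}. ?f e m) =
          w m * ((\<Sum>e=1..n\<^sup>2 div m. chi e * w e) - (\<Sum>e=1..n. chi e * w e))"
        by (simp add: sum_distrib_left mult_ac)
    qed simp
    finally show ?thesis .
  qed
  finally show ?thesis .
qed

section \<open>Sums of powers compared with integrals\<close>

lemma powr_increment_bounds:
  fixes b x y :: real
  assumes "0 \<le> b" "b < 1" "0 < x" "x \<le> y"
  shows "y powr (-b) * (y - x) \<le> (y powr (1 - b) - x powr (1 - b)) / (1 - b)"
    and "(y powr (1 - b) - x powr (1 - b)) / (1 - b) \<le> x powr (-b) * (y - x)"
proof -
  have "\<exists>t. x \<le> t \<and> t \<le> y \<and> (y powr (1 - b) - x powr (1 - b)) / (1 - b) = t powr (-b) * (y - x)"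
  proof (cases "x = y")
    case False
    then have "x < y" using assms by simp
    have "\<exists>t. t > x \<and> t < y \<and> y powr (1 - b) / (1 - b) - x powr (1 - b) / (1 - b) = (y - x) * t powr (-b)"
    proof (rule MVT2[OF \<open>x < y\<close>])
      fix t assume "x \<le> t" "t \<le> y"
      then show "((\<lambda>t. t powr (1 - b) / (1 - b)) has_real_derivative t powr (-b)) (at t)"
        using assms by (auto intro!: derivative_eq_intros)
    qed
    then show ?thesis by (auto simp: diff_divide_distrib mult.commute intro: less_imp_le)
  qed auto
  then obtain t where t: "x \<le> t" "t \<le> y" "(y powr (1 - b) - x powr (1 - b)) / (1 - b) = t powr (-b) * (y - x)"
    by blast
  have "t powr (-b) \<le> x powr (-b)" "y powr (-b) \<le> t powr (-b)"
    using assms t by (auto intro!: powr_mono2')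
  then show "y powr (-b) * (y - x) \<le> (y powr (1 - b) - x powr (1 - b)) / (1 - b)"
    "(y powr (1 - b) - x powr (1 - b)) / (1 - b) \<le> x powr (-b) * (y - x)"
    unfolding t(3) using assms by (auto intro!: mult_right_mono)
qed

lemma sum_powr_le:
  fixes b :: real
  assumes "0 \<le> b" "b < 1"
  shows "(\<Sum>m=1..n. real m powr (-b)) \<le> real n powr (1 - b) / (1 - b)"
proof (induction n)
  case (Suc n)
  have "real (Suc n) powr (-b) \<le> (real (Suc n) powr (1 - b) - real n powr (1 - b)) / (1 - b)"
  proof (cases "n = 0")
    case False
    then show ?thesis using powr_increment_bounds(1)[OF assms, of "real n" "real (Suc n)"] by simp
  qed (use assms in \<open>simp add: field_simps\<close>)
  then show ?case using Suc by (simp add: diff_divide_distrib)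
qed simp

text \<open>The difference a between sum and integral decreases, and becomes increasing when its
  last term is subtracted; this pins the limit z down to within k^(-b). The passage from k to a real
  y is allowed because the method is applied at y = n^2/e. Both errors lie in [0, k^(-b)] and enter
  with opposite signs, and k \<ge> y/2 costs the factor 2.\<close>

lemma sum_powr_asymptotics:
  fixes b :: real
  assumes b: "0 \<le> b" "b < 1"
  shows "\<exists>z. \<forall>k y. 1 \<le> k \<and> real k \<le> y \<and> y < real k + 1 \<longrightarrow>
    \<bar>(\<Sum>m=1..k. real m powr (-b)) - y powr (1 - b) / (1 - b) - z\<bar> \<le> 2 * y powr (-b)"
proof -
  define a where "a k = (\<Sum>m=1..Suc k. real m powr (-b)) - real (Suc k) powr (1 - b) / (1 - b)" for k
  define a' where "a' k = a k - real (Suc k) powr (-b)" for k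
  have diff: "a (Suc k) = a k + (real (Suc (Suc k)) powr (-b) -
      (real (Suc (Suc k)) powr (1 - b) - real (Suc k) powr (1 - b)) / (1 - b))" for k
    by (simp add: a_def diff_divide_distrib)
  have "a (Suc k) \<le> a k" for k
    using powr_increment_bounds(1)[OF b, of "real (Suc k)" "real (Suc (Suc k))"] diff[of k] by simp
  then have dec: "decseq a" by (simp add: decseq_Suc_iff)
  have "a' k \<le> a' (Suc k)" for k
    using powr_increment_bounds(2)[OF b, of "real (Suc k)" "real (Suc (Suc k))"] diff[of k]
    by (simp add: a'_def)
  then have inc: "incseq a'" by (simp add: incseq_Suc_iff)
  have le: "a' k \<le> a n" for k n
  proof -
    have "a' k \<le> a' (max k n)" using inc by (simp add: incseqD)
    also have "\<dots> \<le> a (max k n)" by (simp add: a'_def)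
    also have "\<dots> \<le> a n" using dec by (simp add: decseqD)
    finally show ?thesis .
  qed
  obtain z where z: "a \<longlonglongrightarrow> z" "\<And>k. z \<le> a k"
    using decseq_convergent[OF dec, of "a' 0"] le by blast
  have z': "a' k \<le> z" for k
    by (rule LIMSEQ_le_const[OF z(1)]) (use le in auto)
  show ?thesis
  proof (rule exI[of _ z], intro allI impI, elim conjE)
    fix k :: nat and y :: real assume k: "1 \<le> k" "real k \<le> y" "y < real k + 1"
    then obtain l where l: "k = Suc l" by (cases k) auto
    have k0: "real k > 0" using k by simp
    have A: "(\<Sum>m=1..k. real m powr (-b)) = a l + real k powr (1 - b) / (1 - b)"
      unfolding a_def l by simp
    define t where "t = (y powr (1 - b) - real k powr (1 - b)) / (1 - b)"
    have t: "0 \<le> t" "t \<le> real k powr (-b)"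
    proof -
      have "0 \<le> y powr (-b) * (y - real k)" using k by simp
      then show "0 \<le> t" using powr_increment_bounds(1)[OF b k0 k(2)] unfolding t_def by linarith
      have "real k powr (-b) * (y - real k) \<le> real k powr (-b) * 1" using k by (intro mult_left_mono) auto
      then show "t \<le> real k powr (-b)" using powr_increment_bounds(2)[OF b k0 k(2)] unfolding t_def by linarith
    qed
    have "(\<Sum>m=1..k. real m powr (-b)) - y powr (1 - b) / (1 - b) - z = (a l - z) - t"
      unfolding A t_def by (simp add: diff_divide_distrib)
    moreover have "0 \<le> a l - z" "a l - z \<le> real k powr (-b)"
      using z(2)[of l] z'[of l] unfolding a'_def l by auto
    ultimately have "\<bar>(\<Sum>m=1..k. real m powr (-b)) - y powr (1 - b) / (1 - b) - z\<bar> \<le> real k powr (-b)"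
      using t by linarith
    also have "\<dots> \<le> (y / 2) powr (-b)" using b k by (intro powr_mono2') auto
    also have "\<dots> = 2 powr b * y powr (-b)" using k by (simp add: powr_divide powr_minus field_simps)
    also have "\<dots> \<le> 2 powr 1 * y powr (-b)" using b by (intro mult_right_mono powr_mono) auto
    finally show "\<bar>(\<Sum>m=1..k. real m powr (-b)) - y powr (1 - b) / (1 - b) - z\<bar> \<le> 2 * y powr (-b)"
      by simp
  qed
qed

section \<open>Partial sums of the L-series and of the divisor sums of a character\<close>

locale bounded_character =
  fixes chi :: "nat \<Rightarrow> real" and B :: real
  assumes chi_le: "\<bar>chi e\<bar> \<le> 1"
    and sum_chi_le: "\<bar>\<Sum>e=1..k. chi e\<bar> \<le> B"
begin

lemma B_nonneg: "B \<ge> 0" using sum_chi_le[of 0] by simp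

definition L_partial :: "real \<Rightarrow> nat \<Rightarrow> real" where
  "L_partial b k = (\<Sum>e=1..k. chi e * real e powr (-b))"

text \<open>Abel summation starting at n: the character sums from n on are at most 2 B in absolute
  value, and the decreasing weights telescope to the first one, (n + 1)^(-b).\<close>

lemma L_partial_diff_le:
  assumes "b \<ge> 0" "n \<le> l"
  shows "\<bar>L_partial b l - L_partial b n\<bar> \<le> 2 * B * real (Suc n) powr (-b)"
proof -
  define w where "w k = real (Suc k) powr (-b)" for k
  define A where "A k = (\<Sum>e=1..k. chi e) - (\<Sum>e=1..n. chi e)" for k
  have A: "\<bar>A k\<bar> \<le> 2 * B" for k
    using sum_chi_le[of k] sum_chi_le[of n] unfolding A_def by linarith
  have dec: "w (Suc k) \<le> w k" for k unfolding w_def using assms by (intro powr_mono2') auto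
  have "\<bar>L_partial b l - L_partial b n - A l * w l\<bar> \<le> 2 * B * (w n - w l)"
    using assms(2)
  proof (induction l rule: dec_induct)
    case (step l)
    have "L_partial b (Suc l) - L_partial b n - A (Suc l) * w (Suc l) =
        (L_partial b l - L_partial b n - A l * w l) + A (Suc l) * (w l - w (Suc l))"
      by (simp add: L_partial_def A_def w_def algebra_simps)
    moreover have "\<bar>A (Suc l) * (w l - w (Suc l))\<bar> \<le> 2 * B * (w l - w (Suc l))"
      unfolding abs_mult using dec[of l] A[of "Suc l"] by (intro mult_mono) auto
    ultimately show ?case using step.IH by (simp add: algebra_simps)
  qed (simp add: A_def)
  moreover have "\<bar>A l * w l\<bar> \<le> 2 * B * w l"
    unfolding abs_mult using A[of l] by (intro mult_mono) (auto simp: w_def)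
  ultimately have "\<bar>L_partial b l - L_partial b n\<bar> \<le> 2 * B * w n"
    by (simp add: algebra_simps)
  then show ?thesis by (simp add: w_def)
qed

lemma L_partial_limit_diff_le:
  assumes "b \<ge> 0" "L_partial b \<longlonglongrightarrow> l"
  shows "\<bar>l - L_partial b n\<bar> \<le> 2 * B * real (Suc n) powr (-b)"
proof (rule LIMSEQ_le_const2)
  show "(\<lambda>k. \<bar>L_partial b k - L_partial b n\<bar>) \<longlonglongrightarrow> \<bar>l - L_partial b n\<bar>"
    by (intro tendsto_intros assms)
qed (use L_partial_diff_le[OF assms(1)] in auto)

lemma hyperbola_remainder_le:
  assumes "b \<ge> 0" and W: "(\<Sum>m=1..n. real m powr (-b)) \<le> W"
  shows "\<bar>\<Sum>m=1..n. real m powr (-b) * (L_partial b (n\<^sup>2 div m) - L_partial b n)\<bar> \<le>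
    W * (2 * B * real (Suc n) powr (-b))"
proof -
  have "\<bar>\<Sum>m=1..n. real m powr (-b) * (L_partial b (n\<^sup>2 div m) - L_partial b n)\<bar> \<le>
      (\<Sum>m=1..n. real m powr (-b) * (2 * B * real (Suc n) powr (-b)))"
  proof (rule order_trans[OF sum_abs sum_mono])
    fix m assume m: "m \<in> {1..n}"
    then have "n * m \<le> n\<^sup>2" by (simp add: power2_eq_square)
    then have "n \<le> n\<^sup>2 div m" using m by (simp add: less_eq_div_iff_mult_less_eq)
    then show "\<bar>real m powr (-b) * (L_partial b (n\<^sup>2 div m) - L_partial b n)\<bar> \<le>
        real m powr (-b) * (2 * B * real (Suc n) powr (-b))"
      unfolding abs_mult using L_partial_diff_le[OF assms(1)] by (intro mult_mono) auto
  qed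
  also have "\<dots> = (\<Sum>m=1..n. real m powr (-b)) * (2 * B * real (Suc n) powr (-b))"
    by (rule sum_distrib_right[symmetric])
  also have "\<dots> \<le> W * (2 * B * real (Suc n) powr (-b))"
    using W B_nonneg by (intro mult_right_mono) auto
  finally show ?thesis .
qed

lemma hyperbola_powr:
  "(\<Sum>N=1..n\<^sup>2. divisor_sum chi N * real N powr (-b)) =
    (\<Sum>e=1..n. chi e * real e powr (-b) * (\<Sum>m=1..n\<^sup>2 div e. real m powr (-b))) +
    (\<Sum>m=1..n. real m powr (-b) * (L_partial b (n\<^sup>2 div m) - L_partial b n))"
  unfolding L_partial_def by (rule hyperbola_method) (simp add: powr_mult)

text \<open>Each inner sum of the hyperbola identity is replaced by its asymptotics at y = n^2/e.
  The integral produces L(1), and the constant z multiplies \<open>L_partial b n\<close>, a term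
  kept apart because it disappears at a zero. Three errors are of order n^(1 - 2 b): n remainders of
  size n^(-2 b), the part with e > n, and the replacement of \<open>L_partial 1 n\<close> by its
  limit. Taking b = 0 gives the average of the divisor sums.\<close>

theorem divisor_sum_asymptotics:
  assumes b: "0 \<le> b" "b < 1" and L1: "L_partial 1 \<longlonglongrightarrow> L1"
  shows "\<exists>z K. \<forall>n\<ge>1. \<bar>(\<Sum>N=1..n\<^sup>2. divisor_sum chi N * real N powr (-b)) -
    L1 * real n powr (2 * (1 - b)) / (1 - b) - z * L_partial b n\<bar> \<le> K * real n powr (1 - 2 * b)"
proof -
  from sum_powr_asymptotics[OF b] obtain z where z: "\<And>k y. 1 \<le> k \<Longrightarrow> real k \<le> y \<Longrightarrow> y < real k + 1 \<Longrightarrow>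
    \<bar>(\<Sum>m=1..k. real m powr (-b)) - y powr (1 - b) / (1 - b) - z\<bar> \<le> 2 * y powr (-b)" by blast
  define K where "K = 2 + 4 * B / (1 - b)"
  show ?thesis
  proof (intro exI allI impI)
    fix n :: nat assume n: "n \<ge> 1"
    define y where "y e = real n ^ 2 / real e" for e
    define r where "r e = (\<Sum>m=1..n\<^sup>2 div e. real m powr (-b)) - y e powr (1 - b) / (1 - b) - z" for e
    have r: "\<bar>r e\<bar> \<le> 2 * y e powr (-b)" if "e \<in> {1..n}" for e
      unfolding r_def
    proof (rule z)
      have "e * 1 \<le> n * n" using that by (intro mult_le_mono) auto
      then show "1 \<le> n\<^sup>2 div e" using that by (simp add: less_eq_div_iff_mult_less_eq power2_eq_square)
      have e0: "0 < real e" using that by simp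
      have "(n\<^sup>2 div e) * e \<le> n\<^sup>2" by simp
      then have "real (n\<^sup>2 div e) * real e \<le> real n ^ 2" by (simp flip: of_nat_mult of_nat_power)
      then show "real (n\<^sup>2 div e) \<le> y e" using e0 by (simp add: y_def field_simps)
      have "n\<^sup>2 < (n\<^sup>2 div e + 1) * e" using that dividend_less_div_times[of e "n\<^sup>2"] by (simp add: algebra_simps)
      then have "real n ^ 2 < (real (n\<^sup>2 div e) + 1) * real e"
        by (simp only: of_nat_less_iff of_nat_mult of_nat_power of_nat_add of_nat_1
              flip: of_nat_less_iff[where 'a = real])
      then show "y e < real (n\<^sup>2 div e) + 1" using e0 by (simp add: y_def field_simps)
    qed
    have ye: "real e powr (-b) * y e powr (1 - b) = real n powr (2 * (1 - b)) * real e powr (-1)"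
      "real e powr (-b) * y e powr (-b) = real n powr (- 2 * b)" if "e \<in> {1..n}" for e
    proof -
      have "y e powr c = real n powr (2 * c) * real e powr (- c)" for c
      proof -
        have "y e powr c = (real n ^ 2) powr c / real e powr c" by (simp add: y_def powr_divide)
        moreover have "real n ^ 2 = real n powr 2" using n by simp
        ultimately show ?thesis by (simp only: powr_powr powr_minus divide_inverse)
      qed
      then have "real e powr (-b) * y e powr c = real n powr (2 * c) * real e powr (- b - c)" for c
        by (simp only: powr_add diff_conv_add_uminus mult_ac)
      from this[of "1 - b"] this[of "- b"]
      show "real e powr (-b) * y e powr (1 - b) = real n powr (2 * (1 - b)) * real e powr (-1)"
        "real e powr (-b) * y e powr (-b) = real n powr (- 2 * b)"
        using that by simp_all
    qed
    have "(\<Sum>e=1..n. chi e * real e powr (-b) * (\<Sum>m=1..n\<^sup>2 div e. real m powr (-b))) =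
        (\<Sum>e=1..n. real n powr (2 * (1 - b)) / (1 - b) * (chi e * real e powr (-1)) + z * (chi e * real e powr (-b))
          + chi e * real e powr (-b) * r e)"
    proof (rule sum.cong)
      fix e assume e: "e \<in> {1..n}"
      have "chi e * real e powr (-b) * (\<Sum>m=1..n\<^sup>2 div e. real m powr (-b)) =
          chi e * real e powr (-b) * (y e powr (1 - b) / (1 - b) + z + r e)"
        by (simp add: r_def)
      also have "\<dots> = chi e / (1 - b) * (real e powr (-b) * y e powr (1 - b)) + z * (chi e * real e powr (-b))
          + chi e * real e powr (-b) * r e"
        by (simp add: field_simps)
      finally show "chi e * real e powr (-b) * (\<Sum>m=1..n\<^sup>2 div e. real m powr (-b)) =
          real n powr (2 * (1 - b)) / (1 - b) * (chi e * real e powr (-1)) + z * (chi e * real e powr (-b))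
          + chi e * real e powr (-b) * r e"
        unfolding ye(1)[OF e] by (simp add: mult_ac)
    qed simp
    then have main: "(\<Sum>e=1..n. chi e * real e powr (-b) * (\<Sum>m=1..n\<^sup>2 div e. real m powr (-b))) =
        real n powr (2 * (1 - b)) / (1 - b) * L_partial 1 n + z * L_partial b n
          + (\<Sum>e=1..n. chi e * real e powr (-b) * r e)"
      by (simp add: sum.distrib L_partial_def sum_distrib_left)
    have np: "real n powr p * real n powr q = real n powr (p + q)" for p q
      by (simp add: powr_add)
    have "\<bar>\<Sum>e=1..n. chi e * real e powr (-b) * r e\<bar> \<le> (\<Sum>e=1..n. 2 * real n powr (-2 * b))"
    proof (rule order_trans[OF sum_abs sum_mono])
      fix e assume e: "e \<in> {1..n}"
      have "\<bar>chi e * real e powr (-b) * r e\<bar> \<le> 1 * real e powr (-b) * (2 * y e powr (-b))"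
        unfolding abs_mult using chi_le r[OF e] by (intro mult_mono) auto
      also have "\<dots> = 2 * (real e powr (-b) * y e powr (-b))" by simp
      finally show "\<bar>chi e * real e powr (-b) * r e\<bar> \<le> 2 * real n powr (-2 * b)"
        unfolding ye(2)[OF e] .
    qed
    also have "\<dots> = 2 * (real n powr 1 * real n powr (-2 * b))" using n by simp
    finally have e1: "\<bar>\<Sum>e=1..n. chi e * real e powr (-b) * r e\<bar> \<le> 2 * real n powr (1 - 2 * b)"
      unfolding np by simp
    have dec: "real (Suc n) powr (-c) \<le> real n powr (-c)" if "c \<ge> 0" for c
      using n that by (intro powr_mono2') auto
    have "\<bar>\<Sum>m=1..n. real m powr (-b) * (L_partial b (n\<^sup>2 div m) - L_partial b n)\<bar> \<le>
        real n powr (1 - b) / (1 - b) * (2 * B * real (Suc n) powr (-b))"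
      by (rule hyperbola_remainder_le[OF b(1) sum_powr_le[OF b]])
    also have "\<dots> \<le> real n powr (1 - b) / (1 - b) * (2 * B * real n powr (-b))"
      using b B_nonneg dec[of b] by (intro mult_left_mono) auto
    also have "\<dots> = 2 * B / (1 - b) * (real n powr (1 - b) * real n powr (-b))" by simp
    finally have e2: "\<bar>\<Sum>m=1..n. real m powr (-b) * (L_partial b (n\<^sup>2 div m) - L_partial b n)\<bar> \<le>
        2 * B / (1 - b) * real n powr (1 - 2 * b)"
      unfolding np by simp
    have "\<bar>L1 - L_partial 1 n\<bar> \<le> 2 * B * real (Suc n) powr (-1)"
      by (rule L_partial_limit_diff_le[OF zero_le_one L1])
    also have "\<dots> \<le> 2 * B * real n powr (-1)"
      using B_nonneg dec[of 1] by (intro mult_left_mono) auto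
    finally have L1n: "\<bar>L1 - L_partial 1 n\<bar> \<le> 2 * B * real n powr (-1)" .
    have c0: "0 \<le> real n powr (2 * (1 - b)) / (1 - b)" using b by simp
    have "\<bar>real n powr (2 * (1 - b)) / (1 - b) * (L1 - L_partial 1 n)\<bar> \<le>
        real n powr (2 * (1 - b)) / (1 - b) * (2 * B * real n powr (-1))"
      unfolding abs_mult abs_of_nonneg[OF c0] using L1n c0 by (rule mult_left_mono)
    also have "\<dots> = 2 * B / (1 - b) * (real n powr (2 * (1 - b)) * real n powr (-1))" by simp
    finally have e3: "\<bar>real n powr (2 * (1 - b)) / (1 - b) * (L1 - L_partial 1 n)\<bar> \<le>
        2 * B / (1 - b) * real n powr (1 - 2 * b)"
      unfolding np by simp
    have eq: "(\<Sum>N=1..n\<^sup>2. divisor_sum chi N * real N powr (-b)) - L1 * real n powr (2 * (1 - b)) / (1 - b) - z * L_partial b n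
      = (\<Sum>e=1..n. chi e * real e powr (-b) * r e)
        + (\<Sum>m=1..n. real m powr (-b) * (L_partial b (n\<^sup>2 div m) - L_partial b n))
        - real n powr (2 * (1 - b)) / (1 - b) * (L1 - L_partial 1 n)"
    proof -
      have "p / q * l + z * s + e1 + e2 - L * p / q - z * s = e1 + e2 - p / q * (L - l)"
        for p q l s e1 e2 L :: real
        by (simp add: right_diff_distrib)
      then show ?thesis unfolding hyperbola_powr main .
    qed
    have "\<bar>(\<Sum>N=1..n\<^sup>2. divisor_sum chi N * real N powr (-b)) -
        L1 * real n powr (2 * (1 - b)) / (1 - b) - z * L_partial b n\<bar> \<le>
        2 * real n powr (1 - 2 * b) + 2 * B / (1 - b) * real n powr (1 - 2 * b) + 2 * B / (1 - b) * real n powr (1 - 2 * b)"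
    proof -
      have "x = u + v - w \<Longrightarrow> \<bar>u\<bar> \<le> a \<Longrightarrow> \<bar>v\<bar> \<le> c \<Longrightarrow> \<bar>w\<bar> \<le> d \<Longrightarrow> \<bar>x\<bar> \<le> a + c + d"
        for x u v w a c d :: real by linarith
      from this[OF eq e1 e2 e3] show ?thesis .
    qed
    also have "\<dots> = K * real n powr (1 - 2 * b)"
    proof -
      have "K = 2 + 2 * B / (1 - b) + 2 * B / (1 - b)"
        by (simp add: K_def add_divide_distrib[symmetric])
      then show ?thesis by (simp only: distrib_right)
    qed
    finally show "\<bar>(\<Sum>N=1..n\<^sup>2. divisor_sum chi N * real N powr (-b)) -
      L1 * real n powr (2 * (1 - b)) / (1 - b) - z * L_partial b n\<bar> \<le> K * real n powr (1 - 2 * b)" .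
  qed
qed

corollary divisor_sum_asymptotics_at_zero:
  assumes b: "1 / 2 < b" "b < 1" and L1: "L_partial 1 \<longlonglongrightarrow> L1" and zero: "L_partial b \<longlonglongrightarrow> 0"
  shows "(\<lambda>n. (\<Sum>N=1..n\<^sup>2. divisor_sum chi N * real N powr (-b)) - L1 * real n powr (2 * (1 - b)) / (1 - b)) \<longlonglongrightarrow> 0"
proof -
  from divisor_sum_asymptotics[OF _ b(2) L1] b obtain z K where K: "\<And>n. n \<ge> 1 \<Longrightarrow>
    \<bar>(\<Sum>N=1..n\<^sup>2. divisor_sum chi N * real N powr (-b)) -
    L1 * real n powr (2 * (1 - b)) / (1 - b) - z * L_partial b n\<bar> \<le> K * real n powr (1 - 2 * b)" by auto
  show ?thesis
  proof (rule Lim_null_comparison)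
    show "\<forall>\<^sub>F n in sequentially. norm ((\<Sum>N=1..n\<^sup>2. divisor_sum chi N * real N powr (-b)) -
        L1 * real n powr (2 * (1 - b)) / (1 - b)) \<le> K * real n powr (1 - 2 * b) + \<bar>z * L_partial b n\<bar>"
      using eventually_ge_at_top[of 1]
    proof eventually_elim
      case (elim n)
      show ?case using K[OF elim] unfolding real_norm_def by linarith
    qed
    have "(\<lambda>n. real n powr (1 - 2 * b)) \<longlonglongrightarrow> 0" using b by real_asymp
    then show "(\<lambda>n. K * real n powr (1 - 2 * b) + \<bar>z * L_partial b n\<bar>) \<longlonglongrightarrow> 0"
      by (intro tendsto_add_zero tendsto_mult_right_zero tendsto_rabs_zero zero)
  qed
qed

corollary divisor_sum_average:
  assumes L1: "L_partial 1 \<longlonglongrightarrow> L1"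
  shows "(\<lambda>n. (\<Sum>N=1..n\<^sup>2. divisor_sum chi N) / real n ^ 2) \<longlonglongrightarrow> L1"
proof -
  from divisor_sum_asymptotics[OF _ _ L1, of 0] obtain z K where K: "\<And>n. n \<ge> 1 \<Longrightarrow>
    \<bar>(\<Sum>N=1..n\<^sup>2. divisor_sum chi N * real N powr (-0)) -
    L1 * real n powr (2 * (1 - 0)) / (1 - 0) - z * L_partial 0 n\<bar> \<le> K * real n powr (1 - 2 * 0)" by auto
  have "(\<lambda>n. (\<Sum>N=1..n\<^sup>2. divisor_sum chi N) / real n ^ 2 - L1) \<longlonglongrightarrow> 0"
  proof (rule Lim_null_comparison)
    show "\<forall>\<^sub>F n in sequentially. norm ((\<Sum>N=1..n\<^sup>2. divisor_sum chi N) / real n ^ 2 - L1) \<le>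
        (K * real n + \<bar>z\<bar> * B) / real n ^ 2"
      using eventually_ge_at_top[of 1]
    proof eventually_elim
      case (elim n)
      have "(\<Sum>N=1..n\<^sup>2. divisor_sum chi N * real N powr (-0)) = (\<Sum>N=1..n\<^sup>2. divisor_sum chi N)"
        by (intro sum.cong) auto
      moreover have "real n powr (2 * (1 - 0)) = real n ^ 2" using elim by simp
      moreover have "\<bar>z * L_partial 0 n\<bar> \<le> \<bar>z\<bar> * B"
      proof -
        have "L_partial 0 n = (\<Sum>e=1..n. chi e)" unfolding L_partial_def by (intro sum.cong) auto
        then show ?thesis using sum_chi_le[of n] by (simp add: abs_mult mult_left_mono)
      qed
      ultimately have "\<bar>(\<Sum>N=1..n\<^sup>2. divisor_sum chi N) - L1 * real n ^ 2\<bar> \<le> K * real n + \<bar>z\<bar> * B"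
        using K[OF elim] elim by simp
      moreover have "(\<Sum>N=1..n\<^sup>2. divisor_sum chi N) / real n ^ 2 - L1 =
          ((\<Sum>N=1..n\<^sup>2. divisor_sum chi N) - L1 * real n ^ 2) / real n ^ 2"
        using elim by (simp add: field_simps)
      ultimately show ?case by (simp add: divide_right_mono)
    qed
    show "(\<lambda>n. (K * real n + \<bar>z\<bar> * B) / real n ^ 2) \<longlonglongrightarrow> 0" by real_asymp
  qed
  then show ?thesis by (rule LIM_zero_cancel)
qed

text \<open>Positivity: the sum of the nonnegative terms is at least the term N = 1, which is 1,
  whereas the hyperbola identity bounds it by Z |\<open>L_partial b n\<close>| plus quantities
  tending to 0.\<close>

lemma L_partial_not_tendsto_zero:
  assumes b: "b > 1" and nonneg: "\<And>N. N \<ge> 1 \<Longrightarrow> divisor_sum chi N \<ge> 0" and chi1: "chi 1 = 1"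
  shows "\<not> L_partial b \<longlonglongrightarrow> 0"
proof
  assume zero: "L_partial b \<longlonglongrightarrow> 0"
  define H where "H k = (\<Sum>m=1..k. real m powr (-b))" for k
  define Z where "Z = suminf (\<lambda>m. real (Suc m) powr (-b))"
  have sm: "summable (\<lambda>m. real (Suc m) powr (-b))"
    using summable_real_powr_iff[of "-b"] summable_Suc_iff[of "\<lambda>m. real m powr (-b)"] b by simp
  have H_eq: "H k = (\<Sum>m<k. real (Suc m) powr (-b))" for k
    unfolding H_def by (induction k) simp_all
  have H_lim: "H \<longlonglongrightarrow> Z" unfolding H_eq Z_def by (rule summable_LIMSEQ[OF sm])
  have H_mono: "H k \<le> H l" if "k \<le> l" for k l unfolding H_def using that by (intro sum_mono2) auto
  have H_le: "H k \<le> Z" for k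
    unfolding H_eq Z_def by (rule sum_le_suminf[OF sm]) auto
  have H0: "H k \<ge> 0" for k unfolding H_def by (intro sum_nonneg) auto
  have Z0: "Z \<ge> 0" using H0[of 0] H_le[of 0] by linarith
  have bound: "1 \<le> \<bar>Z * L_partial b n\<bar> + Z * (Z - H n) + Z * (2 * B * real (Suc n) powr (-b))" if n: "n \<ge> 1" for n
  proof -
    have "1 \<le> (\<Sum>N\<in>{1}. divisor_sum chi N * real N powr (-b))" by (simp add: divisor_sum_def chi1[unfolded One_nat_def])
    also have "\<dots> \<le> (\<Sum>N=1..n\<^sup>2. divisor_sum chi N * real N powr (-b))"
      using n nonneg by (intro sum_mono2) auto
    also have "\<dots> = (\<Sum>e=1..n. chi e * real e powr (-b) * H (n\<^sup>2 div e)) +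
        (\<Sum>m=1..n. real m powr (-b) * (L_partial b (n\<^sup>2 div m) - L_partial b n))"
      unfolding H_def by (rule hyperbola_powr)
    also have "(\<Sum>e=1..n. chi e * real e powr (-b) * H (n\<^sup>2 div e)) =
        Z * L_partial b n - (\<Sum>e=1..n. chi e * real e powr (-b) * (Z - H (n\<^sup>2 div e)))"
      by (simp add: L_partial_def sum_distrib_left sum_subtractf algebra_simps)
    finally have "1 \<le> Z * L_partial b n - (\<Sum>e=1..n. chi e * real e powr (-b) * (Z - H (n\<^sup>2 div e))) +
        (\<Sum>m=1..n. real m powr (-b) * (L_partial b (n\<^sup>2 div m) - L_partial b n))" .
    moreover have "\<bar>\<Sum>e=1..n. chi e * real e powr (-b) * (Z - H (n\<^sup>2 div e))\<bar> \<le> Z * (Z - H n)"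
    proof -
      have "\<bar>\<Sum>e=1..n. chi e * real e powr (-b) * (Z - H (n\<^sup>2 div e))\<bar> \<le> (\<Sum>e=1..n. real e powr (-b) * (Z - H n))"
      proof (rule order_trans[OF sum_abs sum_mono])
        fix e assume e: "e \<in> {1..n}"
        then have "n * e \<le> n\<^sup>2" by (simp add: power2_eq_square)
        then have "n \<le> n\<^sup>2 div e" using e by (simp add: less_eq_div_iff_mult_less_eq)
        then have "\<bar>Z - H (n\<^sup>2 div e)\<bar> \<le> Z - H n" 
          using H_mono[of n "n\<^sup>2 div e"] H_le[of "n\<^sup>2 div e"] by linarith
        moreover have "\<bar>chi e * real e powr (-b)\<bar> \<le> 1 * real e powr (-b)"
          unfolding abs_mult using chi_le by (intro mult_mono) auto
        ultimately show "\<bar>chi e * real e powr (-b) * (Z - H (n\<^sup>2 div e))\<bar> \<le> real e powr (-b) * (Z - H n)"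
          unfolding abs_mult[of "chi e * real e powr (-b)"] by (intro mult_mono) auto
      qed
      also have "\<dots> = H n * (Z - H n)" unfolding H_def by (rule sum_distrib_right[symmetric])
      also have "\<dots> \<le> Z * (Z - H n)" using H_le[of n] by (intro mult_right_mono) auto
      finally show ?thesis .
    qed
    moreover have "\<bar>\<Sum>m=1..n. real m powr (-b) * (L_partial b (n\<^sup>2 div m) - L_partial b n)\<bar> \<le>
        Z * (2 * B * real (Suc n) powr (-b))"
      using b H_le[of n] unfolding H_def by (intro hyperbola_remainder_le) auto
    ultimately show ?thesis by linarith
  qed
  have "(\<lambda>n. real (Suc n) powr (-b)) \<longlonglongrightarrow> 0" using b by real_asymp
  then have "(\<lambda>n. \<bar>Z * L_partial b n\<bar> + Z * (Z - H n) + Z * (2 * B * real (Suc n) powr (-b))) \<longlonglongrightarrow>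
      \<bar>Z * 0\<bar> + Z * (Z - Z) + Z * (2 * B * 0)"
    by (intro tendsto_intros zero H_lim)
  moreover have "\<forall>n\<ge>1. 1 \<le> \<bar>Z * L_partial b n\<bar> + Z * (Z - H n) + Z * (2 * B * real (Suc n) powr (-b))"
    using bound by blast
  ultimately have "1 \<le> \<bar>Z * 0\<bar> + Z * (Z - Z) + Z * (2 * B * (0::real))"
    by (intro LIMSEQ_le_const) auto
  then show False by simp
qed

end

section \<open>Roots of the principal form modulo integers\<close>

lemma prod_divisors_coprime:
  fixes m n :: nat
  assumes "coprime m n" "k dvd m * n"
  obtains a b where "k = a * b" "a dvd m" "b dvd n" "coprime a b" "coprime a n" "coprime b m"
proof -
  from division_decomp[OF assms(2)] obtain a b where ab: "k = a * b" "a dvd m" "b dvd n" by blast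
  moreover have "coprime a n" "coprime b m" "coprime a b"
    using assms(1) ab(2,3) by (meson coprime_divisors coprime_commute dvd_refl)+
  ultimately show ?thesis using that by blast
qed

lemma coprime_mult_unique:
  fixes m n :: nat
  assumes "coprime m n" "a dvd m" "a' dvd m" "b dvd n" "b' dvd n" "a * b = a' * b'"
  shows "a = a' \<and> b = b'"
proof -
  have c: "coprime a b'" "coprime a' b" "coprime b a'" "coprime b' a"
    using assms by (meson coprime_divisors coprime_commute)+
  have "a dvd a' * b'" "a' dvd a * b" "b dvd a' * b'" "b' dvd a * b"
    using assms(6) by (metis dvd_triv_left dvd_triv_right)+
  then have "a dvd a'" "a' dvd a" "b dvd b'" "b' dvd b"
    using c by (auto simp: coprime_dvd_mult_left_iff coprime_dvd_mult_right_iff)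
  then show ?thesis by (simp add: dvd_antisym)
qed

text \<open>Both sums below run over a set of divisors that is a product for coprime arguments: all divisors,
  and the integers whose square divides.\<close>

lemma sum_coprime_product:
  fixes f :: "nat \<Rightarrow> 'a::comm_semiring_1"
  assumes cop: "coprime m n" and fin: "finite (A m)" "finite (A n)"
    and sub: "\<And>k. k \<in> A (m * n) \<Longrightarrow> k dvd m * n"
      "\<And>k. k \<in> A m \<Longrightarrow> k dvd m" "\<And>k. k \<in> A n \<Longrightarrow> k dvd n"
    and mem: "\<And>a b. a dvd m \<Longrightarrow> b dvd n \<Longrightarrow> a * b \<in> A (m * n) \<longleftrightarrow> a \<in> A m \<and> b \<in> A n"
    and f: "\<And>a b. a \<in> A m \<Longrightarrow> b \<in> A n \<Longrightarrow> f (a * b) = g a * h b"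
  shows "(\<Sum>k\<in>A (m * n). f k) = (\<Sum>a\<in>A m. g a) * (\<Sum>b\<in>A n. h b)"
proof -
  have img: "A (m * n) = (\<lambda>(a, b). a * b) ` (A m \<times> A n)"
  proof (intro Set.set_eqI iffI)
    fix k assume k: "k \<in> A (m * n)"
    from prod_divisors_coprime[OF cop sub(1)[OF k]] obtain a b where
      ab: "k = a * b" "a dvd m" "b dvd n" by metis
    then have "a \<in> A m" "b \<in> A n" using k mem by auto
    then show "k \<in> (\<lambda>(a, b). a * b) ` (A m \<times> A n)" using ab by auto
  qed (use mem sub in auto)
  have inj: "inj_on (\<lambda>(a, b). a * b) (A m \<times> A n)"
  proof (rule inj_onI, clarify)
    fix a b a' b' assume "a \<in> A m" "b \<in> A n" "a' \<in> A m" "b' \<in> A n" "a * b = a' * b'"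
    then show "a = a' \<and> b = b'" using coprime_mult_unique[OF cop, of a a' b b'] sub(2,3) by blast
  qed
  have "(\<Sum>k\<in>A (m * n). f k) = (\<Sum>(a, b)\<in>A m \<times> A n. g a * h b)"
    unfolding img sum.reindex[OF inj] by (intro sum.cong) (auto simp: f)
  then show ?thesis by (simp add: sum_product sum.cartesian_product)
qed

text \<open>The bound on d leaves out the discriminants -3 and -4, whose rings of integers have
  units besides 1 and -1; every ideal is to correspond to exactly two vectors of a form.\<close>

locale imag_quadratic =
  fixes d :: int
  assumes fund: "fundamental_discriminant (- d)" and d_gt: "d > 4"
begin

text \<open>The trace of the generator \<omega> of the ring of integers; \<open>nm\<close> is its
  norm, an exact quotient by \<open>disc\<close>.\<close>

definition tr :: int where "tr = (if even d then 0 else 1)"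

definition nm :: int where "nm = (tr + d) div 4"

text \<open>\<open>qf b\<close> is the norm of \<open>b + \<omega>\<close>, where \<open>\<omega> = (tr + \<surd>-d)/2\<close> generates the ring of integers.\<close>

definition qf :: "int \<Rightarrow> int" where "qf b = b * b + tr * b + nm"

lemma disc: "4 * nm = tr + d"
proof -
  from fund consider "(- d) mod 4 = 1" | m where "- d = 4 * m"
    unfolding fundamental_discriminant_def by blast
  then show ?thesis
  proof cases
    case 1
    then have "d mod 4 = 3" by presburger
    moreover from this have "odd d" by presburger
    ultimately show ?thesis unfolding nm_def tr_def by presburger
  next
    case 2
    then have "even d" by presburger
    moreover have "d = 4 * (- m)" using 2 by simp
    ultimately show ?thesis unfolding nm_def tr_def by simp
  qed
qed

lemma tr_cases: "tr = 0 \<or> tr = 1" by (simp add: tr_def)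

lemma tr_square: "tr * tr = tr" using tr_cases by auto

lemma four_qf: "4 * qf b = (2 * b + tr) * (2 * b + tr) + d"
  using disc tr_square by (simp add: qf_def algebra_simps)

lemma even_disc_nm:
  assumes "even d"
  shows "nm mod 4 = 1 \<or> nm mod 4 = 2"
proof -
  have "\<not> (- d) mod 4 = 1" using assms by presburger
  then obtain m where m: "- d = 4 * m" "m mod 4 = 2 \<or> m mod 4 = 3"
    using fund unfolding fundamental_discriminant_def by blast
  have "nm = - m" using disc m(1) assms by (simp add: tr_def)
  then show ?thesis using m(2) by presburger
qed

lemma odd_prime_square_not_dvd:
  fixes p :: int
  assumes "prime p" "p \<noteq> 2"
  shows "\<not> p\<^sup>2 dvd d"
proof
  assume "p\<^sup>2 dvd d"
  then have pd: "p\<^sup>2 dvd - d" by simp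
  have not_unit: "\<not> is_unit p" using assms(1) not_prime_unit by blast
  from fund consider "squarefree (- d)" | m where "- d = 4 * m" "squarefree m"
    unfolding fundamental_discriminant_def by blast
  then show False
  proof cases
    case 1
    then show ?thesis using pd not_unit unfolding squarefree_def by blast
  next
    case 2
    have "coprime p 2" by (intro primes_coprime[OF assms(1) _ assms(2)]) simp
    then have "coprime (p\<^sup>2) ((2::int)\<^sup>2)" by (simp only: coprime_power_left_iff coprime_power_right_iff simp_thms)
    then have "p\<^sup>2 dvd m" using pd 2(1) by (simp add: coprime_dvd_mult_right_iff)
    then show ?thesis using 2(2) not_unit unfolding squarefree_def by blast
  qed
qed

definition chi :: "nat \<Rightarrow> int" where "chi e = kronecker (- d) (int e)"

lemma chi_mult: "m \<noteq> 0 \<Longrightarrow> n \<noteq> 0 \<Longrightarrow> chi (m * n) = chi m * chi n"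
  unfolding chi_def by (rule kronecker_mult)

lemma chi_one: "chi 1 = 1" unfolding chi_def using kronecker_one by simp

lemma chi_power: "p \<noteq> 0 \<Longrightarrow> chi (p ^ j) = chi p ^ j"
  by (induction j) (simp_all add: chi_mult chi_one[unfolded One_nat_def])

lemma chi_prime_range:
  assumes "prime p"
  shows "chi p \<in> {-1, 0, 1}"
  unfolding chi_def kronecker_of_prime[OF assms] by (simp add: kronecker_prime_def Legendre_def)

lemma chi_range: "chi e \<in> {-1, 0, 1}"
proof (cases "e = 0")
  case True
  then show ?thesis using d_gt by (simp add: chi_def kronecker_def)
next
  case False
  then show ?thesis
  proof (induction e rule: prime_divisors_induct)
    case (factor p x)
    show ?case
    proof (cases "x = 0")
      case False
      then have "chi (p * x) = chi p * chi x" using factor by (intro chi_mult) auto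
      then show ?thesis using False factor chi_prime_range[of p] by auto
    qed (use factor in auto)
  qed (auto simp: chi_one[unfolded One_nat_def])
qed

definition root_set :: "nat \<Rightarrow> int set" where
  "root_set a = {b. 0 \<le> b \<and> b < int a \<and> int a dvd qf b}"

definition root_count :: "nat \<Rightarrow> nat" where "root_count a = card (root_set a)"

lemma finite_root_set: "finite (root_set a)"
  by (rule finite_subset[of _ "{0..<int a}"]) (auto simp: root_set_def)

lemma qf_diff: "qf x - qf y = (x - y) * (x + y + tr)"
  by (simp add: qf_def algebra_simps)

lemma qf_dvd_cong:
  assumes "[x = y] (mod m)"
  shows "m dvd qf x \<longleftrightarrow> m dvd qf y"
proof -
  have "m dvd qf x - qf y" using assms unfolding qf_diff by (simp add: cong_iff_dvd_diff)
  then show ?thesis using dvd_diff_commute by (metis dvd_add_right_iff diff_add_cancel)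
qed

lemma root_set_mod:
  assumes "a > 0" "int a dvd qf x"
  shows "x mod int a \<in> root_set a"
  using assms qf_dvd_cong[of "x mod int a" x "int a"] by (auto simp: root_set_def Cong.cong_def)

lemma root_set_eqI:
  assumes "x \<in> root_set a" "y \<in> root_set a" "int a dvd x - y"
  shows "x = y"
proof -
  have "x mod int a = y mod int a" using assms(3) by (simp add: mod_eq_dvd_iff)
  then show ?thesis using assms(1,2) by (simp add: root_set_def)
qed

lemma root_count_mult:
  assumes cop: "coprime a b" and pos: "a > 0" "b > 0"
  shows "root_count (a * b) = root_count a * root_count b"
proof -
  have copi: "coprime (int a) (int b)" using cop by simp
  have "bij_betw (\<lambda>x. (x mod int a, x mod int b)) (root_set (a * b)) (root_set a \<times> root_set b)"
  proof (rule bij_betw_imageI)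
    show "inj_on (\<lambda>x. (x mod int a, x mod int b)) (root_set (a * b))"
    proof (rule inj_onI)
      fix x y assume xy: "x \<in> root_set (a * b)" "y \<in> root_set (a * b)"
        and e: "(x mod int a, x mod int b) = (y mod int a, y mod int b)"
      then have "int a dvd x - y" "int b dvd x - y" by (auto simp: mod_eq_dvd_iff)
      then have "int (a * b) dvd x - y" using copi by (simp add: divides_mult)
      then show "x = y" by (rule root_set_eqI[OF xy])
    qed
    show "(\<lambda>x. (x mod int a, x mod int b)) ` root_set (a * b) = root_set a \<times> root_set b"
    proof (intro equalityI subsetI)
      fix z assume "z \<in> (\<lambda>x. (x mod int a, x mod int b)) ` root_set (a * b)"
      then obtain x where x: "z = (x mod int a, x mod int b)" "int (a * b) dvd qf x"
        by (auto simp: root_set_def)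
      then have "int a dvd qf x" "int b dvd qf x" by (auto elim: dvd_mult_left dvd_mult_right)
      then show "z \<in> root_set a \<times> root_set b" using x pos by (simp add: root_set_mod)
    next
      fix z assume "z \<in> root_set a \<times> root_set b"
      then obtain u v where z: "z = (u, v)" and u: "u \<in> root_set a" and v: "v \<in> root_set b" by auto
      from binary_chinese_remainder_int[OF copi, of u v] obtain x where
        x: "[x = u] (mod int a)" "[x = v] (mod int b)" by blast
      have "int a dvd qf x" "int b dvd qf x"
        using qf_dvd_cong[OF x(1)] qf_dvd_cong[OF x(2)] u v by (auto simp: root_set_def)
      then have "int (a * b) dvd qf x" using copi by (simp add: divides_mult)
      then have m: "x mod int (a * b) \<in> root_set (a * b)" using pos by (intro root_set_mod) auto
      have "x mod int (a * b) mod int a = u" "x mod int (a * b) mod int b = v"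
        using x u v by (auto simp: mod_mod_cancel Cong.cong_def root_set_def)
      then show "z \<in> (\<lambda>x. (x mod int a, x mod int b)) ` root_set (a * b)"
        unfolding z using m by (intro image_eqI[of _ _ "x mod int (a * b)"]) auto
    qed
  qed
  then have "card (root_set (a * b)) = card (root_set a \<times> root_set b)" by (rule bij_betw_same_card)
  then show ?thesis by (simp add: root_count_def card_cartesian_product)
qed

lemma root_count_1: "root_count 1 = 1"
proof -
  have "root_set 1 = {0}" by (auto simp: root_set_def)
  then show ?thesis by (simp add: root_count_def)
qed

section \<open>Roots modulo primes and prime powers in terms of the character\<close>

lemma card_square_roots:
  fixes p :: nat
  assumes p: "prime p" "2 < p"
  shows "int (card {y. 0 \<le> y \<and> y < int p \<and> int p dvd y * y - c}) = 1 + Legendre c p"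
proof -
  let ?S = "{y. 0 \<le> y \<and> y < int p \<and> int p dvd y * y - c}"
  have pp: "prime (int p)" using p by simp
  have congc: "int p dvd y * y - c \<longleftrightarrow> [y\<^sup>2 = c] (mod int p)" for y
    by (simp add: cong_iff_dvd_diff power2_eq_square)
  consider "[c = 0] (mod int p)" | "\<not> [c = 0] (mod int p)" "\<not> QuadRes p c"
    | "\<not> [c = 0] (mod int p)" "QuadRes p c" by blast
  then show ?thesis
  proof cases
    case 1
    have "y = 0" if "y \<in> ?S" for y
    proof -
      have "int p dvd (y * y - c) + c" using that 1 by (intro dvd_add) (simp_all add: cong_0_iff)
      then have "int p dvd y * y" by simp
      then have "int p dvd y" using pp by (simp add: prime_dvd_mult_iff)
      then show ?thesis using that by (auto dest: zdvd_imp_le)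
    qed
    moreover have "0 \<in> ?S" using 1 p by (simp add: cong_0_iff)
    ultimately have "?S = {0}" by blast
    then show ?thesis using 1 by (simp add: Legendre_def)
  next
    case 2
    then have "?S = {}" unfolding QuadRes_def congc by auto
    then have "card ?S = 0" by (simp only: card.empty)
    then show ?thesis using 2 by (simp add: Legendre_def)
  next
    case 3
    then obtain z where z: "int p dvd z * z - c" unfolding QuadRes_def congc by blast
    define u where "u = z mod int p"
    have "int p dvd u - z" by (simp add: u_def mod_eq_dvd_iff[symmetric])
    then have "int p dvd (u - z) * (u + z) + (z * z - c)" using z by (intro dvd_add dvd_mult2)
    then have uc: "int p dvd u * u - c" by (simp add: algebra_simps)
    have u: "0 \<le> u" "u < int p" using p by (auto simp: u_def)
    have "u \<noteq> 0" using uc 3(1) by (auto simp: cong_0_iff)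
    have "?S = {u, int p - u}"
    proof (intro equalityI subsetI)
      fix y assume y: "y \<in> ?S"
      then have "int p dvd y * y - c" by simp
      from dvd_diff[OF this uc] have "int p dvd (y * y - c) - (u * u - c)" .
      then have "int p dvd (y - u) * (y + u)" by (simp add: algebra_simps)
      then have "int p dvd y - u \<or> int p dvd y + u" using pp by (simp add: prime_dvd_mult_iff)
      then show "y \<in> {u, int p - u}"
      proof
        assume "int p dvd y - u"
        then have "y mod int p = u mod int p" by (simp add: mod_eq_dvd_iff)
        then show ?thesis using y u by simp
      next
        assume "int p dvd y + u"
        then obtain k where k: "y + u = int p * k" by (rule dvdE)
        have p0: "0 < int p" using p by simp
        have "0 < int p * k" "int p * k < int p * 2"
          using y u \<open>u \<noteq> 0\<close> unfolding k[symmetric] by simp_all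
        then have "0 < k" "k < 2" using p0 by (simp_all add: zero_less_mult_iff)
        then have "k = 1" by simp
        then show ?thesis using k by simp
      qed
    next
      fix y assume "y \<in> {u, int p - u}"
      moreover have "int p dvd (int p - u) * (int p - u) - c"
      proof -
        have "(int p - u) * (int p - u) - c = int p * (int p - 2 * u) + (u * u - c)"
          by (simp add: algebra_simps)
        then show ?thesis using uc by (metis dvd_add dvd_triv_left)
      qed
      moreover have "0 \<le> int p - u" "int p - u < int p" using u \<open>u \<noteq> 0\<close> by simp_all
      ultimately show "y \<in> ?S" using uc u by blast
    qed
    moreover have "u \<noteq> int p - u"
    proof
      assume "u = int p - u"
      then have "int p = 2 * u" by simp
      then have "even p" by presburger
      then show False using p prime_odd_nat by blast
    qed
    ultimately have "card ?S = 2" by simp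
    then show ?thesis using 3 by (simp add: Legendre_def)
  qed
qed

text \<open>If d is odd, -d = 1 - 4 nm is 1 or 5 modulo 8 according to the parity of nm, and the two
  residues modulo 2 are both roots or both not. If d is even, exactly one of them is a root.\<close>

lemma root_count_two: "int (root_count 2) = 1 + chi 2"
proof -
  have chi2: "chi 2 = (if even d then 0 else if (- d) mod 8 = 1 \<or> (- d) mod 8 = 7 then 1 else -1)"
    using kronecker_of_prime[OF two_is_prime_nat, of "- d"] by (simp add: chi_def kronecker_prime_def)
  have "x \<in> root_set 2 \<longleftrightarrow> x = 0 \<and> even nm \<or> x = 1 \<and> odd (tr + nm)" for x
    by (cases "x = 0"; cases "x = 1") (auto simp: root_set_def qf_def)
  then have R: "root_set 2 = (if even nm then {0} else {}) \<union> (if odd (tr + nm) then {1} else {})"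
    by (intro Set.set_eqI) simp
  show ?thesis
  proof (cases "even d")
    case True
    then show ?thesis unfolding root_count_def R chi2 by (simp add: tr_def)
  next
    case False
    then have "d = 4 * nm - 1" using disc by (simp add: tr_def)
    then have "- d = 1 - 4 * nm" by simp
    then have "(- d) mod 8 = (1 - 4 * nm) mod 8" by (rule arg_cong)
    moreover have "(1 - 4 * nm) mod 8 = (if even nm then 1 else 5)" by presburger
    ultimately show ?thesis using False unfolding root_count_def R chi2 by (simp add: tr_def)
  qed
qed

text \<open>For odd p completing the square, 4 qf(b) = (2 b + tr)^2 + d, and the bijection b
  \<mapsto> 2 b + tr modulo p reduce the count to square roots of -d.\<close>

lemma root_count_prime:
  assumes p: "prime p"
  shows "int (root_count p) = 1 + chi p"
proof (cases "p = 2")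
  case True
  then show ?thesis using root_count_two by simp
next
  case False
  then have p2: "2 < p" using prime_ge_2_nat[OF p] by simp
  then have "odd p" using p prime_odd_nat by blast
  then have cop: "coprime (int p) 2" "coprime (int p) 4"
    using coprime_power_right_iff[of "int p" 2 2] by (simp_all add: coprime_right_2_iff_odd)
  have pos: "p > 0" using p2 by simp
  let ?S = "{y. 0 \<le> y \<and> y < int p \<and> int p dvd y * y - (- d)}"
  have dvd: "int p dvd qf b \<longleftrightarrow> int p dvd (2 * b + tr) * (2 * b + tr) - (- d)" for b
  proof -
    have "int p dvd qf b \<longleftrightarrow> int p dvd 4 * qf b" using cop(2) by (simp add: coprime_dvd_mult_right_iff)
    then show ?thesis unfolding four_qf by simp
  qed
  have sq: "int p dvd x * x - c \<longleftrightarrow> int p dvd y * y - c" if "int p dvd x - y" for x y c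
  proof -
    have "x * x - c = (x - y) * (x + y) + (y * y - c)" by (simp add: algebra_simps)
    moreover have "int p dvd (x - y) * (x + y)" using that by simp
    ultimately show ?thesis by (simp only: dvd_add_right_iff)
  qed
  have "bij_betw (\<lambda>b. (2 * b + tr) mod int p) (root_set p) ?S"
  proof (rule bij_betw_imageI)
    show "inj_on (\<lambda>b. (2 * b + tr) mod int p) (root_set p)"
    proof (rule inj_onI)
      fix x y assume xy: "x \<in> root_set p" "y \<in> root_set p" and "(2 * x + tr) mod int p = (2 * y + tr) mod int p"
      then have "int p dvd (2 * x + tr) - (2 * y + tr)" by (simp only: mod_eq_dvd_iff)
      moreover have "(2 * x + tr) - (2 * y + tr) = 2 * (x - y)" by simp
      ultimately have "int p dvd 2 * (x - y)" by (simp only:)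
      then have "int p dvd x - y" unfolding coprime_dvd_mult_right_iff[OF cop(1)] .
      then show "x = y" by (rule root_set_eqI[OF xy])
    qed
    show "(\<lambda>b. (2 * b + tr) mod int p) ` root_set p = ?S"
    proof (intro equalityI subsetI)
      fix y assume "y \<in> (\<lambda>b. (2 * b + tr) mod int p) ` root_set p"
      then obtain b where b: "y = (2 * b + tr) mod int p" "int p dvd qf b" by (auto simp: root_set_def)
      have "int p dvd y - (2 * b + tr)" unfolding b by (simp add: mod_eq_dvd_iff[symmetric])
      from sq[OF this, of "- d"] b(2) have "int p dvd y * y - (- d)" unfolding dvd by blast
      then show "y \<in> ?S" using b pos by simp
    next
      fix y assume y: "y \<in> ?S"
      obtain b where b: "[2 * b = y - tr] (mod int p)"
      proof -
        from cong_solve_coprime_int[of 2 "int p"] cop(1) obtain i where "[2 * i = 1] (mod int p)"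
          by (auto simp: coprime_commute)
        then have "[2 * i * (y - tr) = 1 * (y - tr)] (mod int p)" by (rule cong_scalar_right)
        then show ?thesis using that[of "i * (y - tr)"] by (simp add: mult.assoc)
      qed
      then have "int p dvd 2 * b - (y - tr)" by (simp only: cong_iff_dvd_diff)
      then have c: "int p dvd (2 * b + tr) - y" by (simp add: algebra_simps)
      from sq[OF this, of "- d"] y have "int p dvd qf b" unfolding dvd by blast
      then have m: "b mod int p \<in> root_set p" using pos by (intro root_set_mod)
      have "int p dvd b mod int p - b" by (simp add: mod_eq_dvd_iff[symmetric])
      then have "int p dvd 2 * (b mod int p - b)" by (rule dvd_mult)
      moreover have "2 * (b mod int p - b) = (2 * (b mod int p) + tr) - (2 * b + tr)" by simp
      ultimately have "(2 * (b mod int p) + tr) mod int p = (2 * b + tr) mod int p"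
        by (simp only: mod_eq_dvd_iff)
      also have "\<dots> = y mod int p" using c by (simp only: mod_eq_dvd_iff)
      finally have "(2 * (b mod int p) + tr) mod int p = y" using y by simp
      then show "y \<in> (\<lambda>b. (2 * b + tr) mod int p) ` root_set p" using m by (auto intro!: image_eqI)
    qed
  qed
  then have "root_count p = card ?S" unfolding root_count_def by (rule bij_betw_same_card)
  then have "int (root_count p) = 1 + Legendre (- d) p" using card_square_roots[OF p p2, of "- d"] by simp
  then show ?thesis using False by (simp add: chi_def kronecker_of_prime[OF p] kronecker_prime_def)
qed

lemma chi_prime_eq_0:
  assumes p: "prime p" and "chi p = 0"
  shows "int p dvd d"
  using assms(2) unfolding chi_def kronecker_of_prime[OF p]
  by (cases "p = 2") (auto simp: kronecker_prime_def Legendre_def cong_0_iff split: if_splits)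

lemma chi_prime_ne_0:
  assumes p: "prime p" and "chi p \<noteq> 0"
  shows "\<not> int p dvd d"
  using assms(2) unfolding chi_def kronecker_of_prime[OF p]
  by (cases "p = 2") (auto simp: kronecker_prime_def Legendre_def cong_0_iff split: if_splits)

text \<open>Here the discriminant must be fundamental. For odd p dividing d, a root modulo p^2 makes
  p divide 2 b + tr, so p^2 would divide d. For p = 2, nm is 1 or 2 modulo 4 and b^2 + nm is never
  divisible by 4.\<close>

lemma root_count_ramified:
  assumes p: "prime p" and "chi p = 0" and j: "j \<ge> 2"
  shows "root_count (p ^ j) = 0"
proof -
  have pd: "int p dvd d" by (rule chi_prime_eq_0[OF p assms(2)])
  have pp: "prime (int p)" using p by simp
  have "\<not> int (p ^ j) dvd qf b" for b
  proof
    assume "int (p ^ j) dvd qf b"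
    moreover have "(int p)\<^sup>2 dvd int (p ^ j)" using j by (simp add: le_imp_power_dvd)
    ultimately have sq: "(int p)\<^sup>2 dvd qf b" by (rule dvd_trans[rotated])
    show False
    proof (cases "p = 2")
      case True
      then have "even d" using pd by simp
      then have t: "tr = 0" by (simp add: tr_def)
      have "4 dvd b * b + nm" using sq True by (simp add: qf_def t)
      moreover have "b * b mod 4 = 0 \<or> b * b mod 4 = 1"
      proof -
        have "b * b mod 4 = (b mod 4) * (b mod 4) mod 4" by (simp add: mod_mult_eq)
        moreover have "b mod 4 \<in> {0, 1, 2, 3}" by (simp, presburger)
        ultimately show ?thesis by (elim insertE emptyE) simp_all
      qed
      ultimately show False using even_disc_nm[OF \<open>even d\<close>] by presburger
    next
      case False
      have "int p dvd 4 * qf b" using sq by (auto simp: power2_eq_square elim: dvd_mult_left)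
      then have "int p dvd (2 * b + tr) * (2 * b + tr)" unfolding four_qf using pd by (simp add: dvd_add_left_iff)
      then have "int p dvd 2 * b + tr" using pp by (simp add: prime_dvd_mult_iff)
      then have "(int p)\<^sup>2 dvd (2 * b + tr) * (2 * b + tr)" by (simp add: power2_eq_square mult_dvd_mono)
      moreover have "(int p)\<^sup>2 dvd (2 * b + tr) * (2 * b + tr) + d" using sq unfolding four_qf[symmetric] by simp
      ultimately have "(int p)\<^sup>2 dvd d" by (simp add: dvd_add_right_iff)
      then show False using odd_prime_square_not_dvd[OF pp] False by simp
    qed
  qed
  then have "root_set (p ^ j) = {}" by (auto simp: root_set_def)
  then show ?thesis by (simp add: root_count_def)
qed

text \<open>Hensel lifting: \<open>qf'(b)\<^sup>2 = 4 qf(b) - d\<close>, so all roots modulo an unramified prime are simple.\<close>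

lemma root_count_unramified:
  assumes p: "prime p" and "chi p \<noteq> 0" and j: "j \<ge> 1"
  shows "root_count (p ^ Suc j) = root_count (p ^ j)"
proof -
  have pd: "\<not> int p dvd d" by (rule chi_prime_ne_0[OF p assms(2)])
  have pp: "prime (int p)" using p by simp
  have pos: "p ^ j > 0" "p ^ Suc j > 0" using p by (auto simp: prime_gt_0_nat)
  have pj: "int p dvd int (p ^ j)" using j by (simp add: dvd_power)
  have jS: "int (p ^ j) dvd int (p ^ Suc j)" by simp
  have simple: "\<not> int p dvd 2 * b + tr" if "int (p ^ j) dvd qf b" for b
  proof
    assume "int p dvd 2 * b + tr"
    moreover have "int p dvd 4 * qf b" using dvd_trans[OF pj that] by simp
    ultimately have "int p dvd d" unfolding four_qf by (simp add: dvd_add_right_iff)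
    then show False using pd by simp
  qed
  have "bij_betw (\<lambda>x. x mod int (p ^ j)) (root_set (p ^ Suc j)) (root_set (p ^ j))"
  proof (rule bij_betw_imageI)
    show "inj_on (\<lambda>x. x mod int (p ^ j)) (root_set (p ^ Suc j))"
    proof (rule inj_onI)
      fix x y assume xy: "x \<in> root_set (p ^ Suc j)" "y \<in> root_set (p ^ Suc j)"
        and "x mod int (p ^ j) = y mod int (p ^ j)"
      then have dv: "int (p ^ j) dvd x - y" by (simp only: mod_eq_dvd_iff)
      have "int (p ^ Suc j) dvd qf x" "int (p ^ Suc j) dvd qf y" using xy by (auto simp: root_set_def)
      then have "int (p ^ Suc j) dvd qf x - qf y" by (rule dvd_diff)
      then have d1: "int (p ^ Suc j) dvd (x - y) * (x + y + tr)" unfolding qf_diff .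
      have "int p dvd x - y" by (rule dvd_trans[OF pj dv])
      have "\<not> int p dvd x + y + tr"
      proof
        assume "int p dvd x + y + tr"
        then have "int p dvd (x + y + tr) + (x - y)" using \<open>int p dvd x - y\<close> by (rule dvd_add)
        then have "int p dvd 2 * x + tr" by (simp add: algebra_simps)
        moreover have "int (p ^ j) dvd qf x" using dvd_trans[OF jS] xy by (auto simp: root_set_def)
        ultimately show False using simple by blast
      qed
      then have "coprime (int p) (x + y + tr)" using pp by (simp add: prime_imp_coprime)
      then have "coprime (int (p ^ Suc j)) (x + y + tr)" by simp
      then have "int (p ^ Suc j) dvd x - y" using d1 by (simp add: coprime_dvd_mult_left_iff del: of_nat_power power_Suc)
      then show "x = y" by (rule root_set_eqI[OF xy])
    qed
    show "(\<lambda>x. x mod int (p ^ j)) ` root_set (p ^ Suc j) = root_set (p ^ j)"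
    proof (intro equalityI subsetI)
      fix y assume "y \<in> (\<lambda>x. x mod int (p ^ j)) ` root_set (p ^ Suc j)"
      then obtain x where x: "y = x mod int (p ^ j)" "int (p ^ Suc j) dvd qf x" by (auto simp: root_set_def)
      then show "y \<in> root_set (p ^ j)" using dvd_trans[OF jS x(2)] pos by (simp only: root_set_mod)
    next
      fix y assume y: "y \<in> root_set (p ^ j)"
      then obtain c where c: "qf y = int (p ^ j) * c" by (auto simp: root_set_def)
      have "\<not> int p dvd 2 * y + tr" using y simple by (auto simp: root_set_def)
      then have "coprime (2 * y + tr) (int p)" using pp by (simp add: prime_imp_coprime coprime_commute)
      from cong_solve_coprime_int[OF this] obtain i where i: "[(2 * y + tr) * i = 1] (mod int p)" by blast
      \<comment> \<open>The Newton correction: k solves c + qf'(y) k = 0 modulo p, with i inverse to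
        qf'(y) = 2 y + tr. The quadratic remainder carries p^(2 j), which p^(j + 1) divides as j
        \<ge> 1.\<close>
      define k where "k = - c * i"
      define x where "x = y + int (p ^ j) * k"
      have "int p dvd (2 * y + tr) * i - 1" using i by (simp only: cong_iff_dvd_diff)
      then have "int p dvd - c * ((2 * y + tr) * i - 1)" by (rule dvd_mult)
      then have a1: "int p dvd c + (2 * y + tr) * k" by (simp add: k_def algebra_simps)
      have "qf x = int (p ^ j) * (c + (2 * y + tr) * k) + int (p ^ j) * (int (p ^ j) * (k * k))"
        using c by (simp add: x_def qf_def algebra_simps)
      moreover have "int (p ^ j) * int p dvd int (p ^ j) * (c + (2 * y + tr) * k)"
        using a1 by (intro mult_dvd_mono) auto
      moreover have "int (p ^ j) * int p dvd int (p ^ j) * (int (p ^ j) * (k * k))"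
        using pj by (intro mult_dvd_mono dvd_mult2) auto
      moreover have "int (p ^ Suc j) = int (p ^ j) * int p" by simp
      ultimately have "int (p ^ Suc j) dvd qf x" by (simp only: dvd_add)
      then have "x mod int (p ^ Suc j) \<in> root_set (p ^ Suc j)" using pos by (intro root_set_mod)
      moreover have "x mod int (p ^ Suc j) mod int (p ^ j) = y"
      proof -
        have "x mod int (p ^ Suc j) mod int (p ^ j) = x mod int (p ^ j)" using jS by (rule mod_mod_cancel)
        also have "\<dots> = y mod int (p ^ j)" unfolding x_def by (rule mod_mult_self2)
        also have "\<dots> = y" using y by (simp add: root_set_def)
        finally show ?thesis .
      qed
      ultimately show "y \<in> (\<lambda>x. x mod int (p ^ j)) ` root_set (p ^ Suc j)" by (metis image_eqI)
    qed
  qed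
  then show ?thesis unfolding root_count_def by (rule bij_betw_same_card)
qed

text \<open>One formula for three cases: if p ramifies it gives 1 for j = 0, where 0^0 = 1, and 0
  afterwards; otherwise it gives 2 or 0 for every j. In this shape the recursion for
  \<open>rep\<close> at prime powers adds up to a geometric sum.\<close>

lemma root_count_prime_power:
  assumes p: "prime p"
  shows "int (root_count (p ^ Suc j)) = chi p ^ j + chi p ^ Suc j"
proof (cases "chi p = 0")
  case True
  then show ?thesis using root_count_prime[OF p] root_count_ramified[OF p True, of "Suc j"]
    by (cases "j = 0") (auto simp: Suc_le_eq)
next
  case False
  have "root_count (p ^ Suc j) = root_count p"
  proof (induction j)
    case (Suc j)
    then show ?case using root_count_unramified[OF p False, of "Suc j"] by simp
  qed simp
  then show ?thesis using root_count_prime[OF p] chi_prime_range[OF p] False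
    by (auto simp: minus_one_power_iff)
qed

text \<open>The ideals of norm \<open>N\<close> are the lattices \<open>k (Z a + Z (b + \<omega>))\<close> with \<open>k\<^sup>2 a = N\<close> and \<open>b\<close> a root of \<open>qf\<close>
  modulo \<open>a\<close>.\<close>

definition rep :: "nat \<Rightarrow> nat" where
  "rep N = (\<Sum>k | k\<^sup>2 dvd N. root_count (N div k\<^sup>2))"

lemma finite_square_divisors: "N > 0 \<Longrightarrow> finite {k :: nat. k\<^sup>2 dvd N}"
  by (rule finite_subset[of _ "{k. k dvd N}"]) (auto simp: power2_eq_square elim: dvd_mult_left)

lemma rep_mult:
  assumes cop: "coprime m n" and pos: "m > 0" "n > 0"
  shows "rep (m * n) = rep m * rep n"
  unfolding rep_def
proof (rule sum_coprime_product[where A = "\<lambda>N. {k. k\<^sup>2 dvd N}", OF cop])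
  fix a b :: nat assume ab: "a dvd m" "b dvd n"
  have "coprime a n" "coprime b m" "coprime a b"
    using cop ab by (meson coprime_divisors coprime_commute dvd_refl)+
  then have c: "coprime (a\<^sup>2) n" "coprime (b\<^sup>2) m" "coprime (a\<^sup>2) (b\<^sup>2)" by simp_all
  have "(a * b)\<^sup>2 dvd m * n \<longleftrightarrow> a\<^sup>2 dvd m * n \<and> b\<^sup>2 dvd m * n"
    using c(3) by (auto simp: power_mult_distrib divides_mult elim: dvd_mult_left dvd_mult_right)
  also have "\<dots> \<longleftrightarrow> a\<^sup>2 dvd m \<and> b\<^sup>2 dvd n"
    using c by (simp add: coprime_dvd_mult_left_iff coprime_dvd_mult_right_iff)
  finally show "a * b \<in> {k. k\<^sup>2 dvd m * n} \<longleftrightarrow> a \<in> {k. k\<^sup>2 dvd m} \<and> b \<in> {k. k\<^sup>2 dvd n}" by simp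
next
  fix a b assume "a \<in> {k. k\<^sup>2 dvd m}" "b \<in> {k. k\<^sup>2 dvd n}"
  then obtain m' n' where mn: "m = a\<^sup>2 * m'" "n = b\<^sup>2 * n'" by (auto elim!: dvdE)
  then have nz: "a > 0" "b > 0" "m' > 0" "n' > 0" using pos by (auto simp: zero_less_power2)
  have "m * n = (a * b)\<^sup>2 * (m' * n')" by (simp add: mn power_mult_distrib mult_ac)
  moreover have "(a * b)\<^sup>2 \<noteq> 0" using nz by simp
  ultimately have "m * n div (a * b)\<^sup>2 = m' * n'" by (metis nonzero_mult_div_cancel_left)
  moreover have "m div a\<^sup>2 = m'" "n div b\<^sup>2 = n'" using nz mn by simp_all
  moreover have "coprime m' n'" using cop unfolding mn by simp
  ultimately show "root_count (m * n div (a * b)\<^sup>2) = root_count (m div a\<^sup>2) * root_count (n div b\<^sup>2)"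
    using nz by (simp add: root_count_mult)
qed (use pos finite_square_divisors in \<open>auto simp: power2_eq_square elim: dvd_mult_left\<close>)

lemma divisor_sum_chi_mult:
  assumes cop: "coprime m n" and pos: "m > 0" "n > 0"
  shows "divisor_sum chi (m * n) = divisor_sum chi m * divisor_sum chi n"
  unfolding divisor_sum_def
proof (rule sum_coprime_product[where A = "\<lambda>N. {k. k dvd N}", OF cop])
  fix a b assume "a \<in> {k. k dvd m}" "b \<in> {k. k dvd n}"
  then show "chi (a * b) = chi a * chi b" using pos by (intro chi_mult) auto
next
  fix a b assume "a dvd m" "b dvd n"
  then show "a * b \<in> {k. k dvd m * n} \<longleftrightarrow> a \<in> {k. k dvd m} \<and> b \<in> {k. k dvd n}" by (simp add: mult_dvd_mono)
qed (simp_all add: pos finite_divisors_nat)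

text \<open>Splitting off k = 1 leaves p times the lattices of norm p^j among those of norm p^(j +
  2). The divisor sum satisfies the same two-step recursion: its two new terms are the root count
  modulo p^(j + 2).\<close>

lemma rep_prime_power:
  assumes p: "prime p"
  shows "int (rep (p ^ j)) = divisor_sum chi (p ^ j)"
proof -
  have p0: "p > 0" and p1: "p > 1" using p prime_gt_0_nat prime_gt_1_nat by auto
  have divs: "divisor_sum chi (p ^ j) = (\<Sum>i\<le>j. chi p ^ i)" for j
  proof -
    have "{e. e dvd p ^ j} = (\<lambda>i. p ^ i) ` {..j}" using p by (auto simp: divides_primepow_nat)
    moreover have "inj_on (\<lambda>i. p ^ i) {..j}" using p1 by (intro inj_onI) simp
    ultimately show ?thesis using p0 by (simp add: divisor_sum_def sum.reindex chi_power)
  qed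
  have rep0: "int (rep (p ^ 0)) = 1"
  proof -
    have "{k :: nat. k\<^sup>2 dvd 1} = {1}" by auto
    then show ?thesis using root_count_1 by (simp add: rep_def)
  qed
  have rep1: "int (rep (p ^ 1)) = 1 + chi p"
  proof -
    have "k = 1" if "k\<^sup>2 dvd p" for k
    proof (rule ccontr)
      assume "k \<noteq> 1"
      have "k dvd p" using that by (auto simp: power2_eq_square elim: dvd_mult_left)
      then have "k = p" using p \<open>k \<noteq> 1\<close> by (auto simp: prime_nat_iff)
      then have "p * p dvd p * 1" using that by (simp add: power2_eq_square)
      then show False using p0 p1 by (simp add: nat_mult_dvd_cancel1)
    qed
    then have "{k :: nat. k\<^sup>2 dvd p} = {1}" by auto
    then show ?thesis using root_count_prime[OF p] by (simp add: rep_def)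
  qed
  have rep2: "rep (p ^ Suc (Suc j)) = root_count (p ^ Suc (Suc j)) + rep (p ^ j)" for j
  proof -
    have eq: "{k. k\<^sup>2 dvd p ^ Suc (Suc j)} = insert 1 ((\<lambda>k. p * k) ` {k. k\<^sup>2 dvd p ^ j})"
    proof (intro equalityI subsetI)
      fix k assume "k \<in> {k. k\<^sup>2 dvd p ^ Suc (Suc j)}"
      then have k: "k\<^sup>2 dvd p ^ Suc (Suc j)" by simp
      then have "k dvd p ^ Suc (Suc j)" by (auto simp: power2_eq_square elim: dvd_mult_left)
      then obtain i where i: "k = p ^ i" using p divides_primepow_nat by blast
      show "k \<in> insert 1 ((\<lambda>k. p * k) ` {k. k\<^sup>2 dvd p ^ j})"
      proof (cases i)
        case (Suc l)
        then have "p * p * (p ^ l)\<^sup>2 dvd p * p * p ^ j"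
          using k i by (simp add: power2_eq_square mult_ac)
        then have "(p ^ l)\<^sup>2 dvd p ^ j" using p0 by (subst (asm) nat_mult_dvd_cancel1) auto
        then show ?thesis using i Suc by auto
      qed (use i in simp)
    next
      fix k assume "k \<in> insert 1 ((\<lambda>k. p * k) ` {k. k\<^sup>2 dvd p ^ j})"
      then show "k \<in> {k. k\<^sup>2 dvd p ^ Suc (Suc j)}"
        by (auto simp: power2_eq_square mult_dvd_mono mult_ac)
    qed
    have "1 \<noteq> p * k" for k using p1 by (simp add: eq_commute[of 1])
    then have "1 \<notin> (\<lambda>k. p * k) ` {k. k\<^sup>2 dvd p ^ j}" by blast
    moreover have "finite {k. k\<^sup>2 dvd p ^ j}" using p0 by (intro finite_square_divisors) simp
    moreover have "inj_on (\<lambda>k. p * k) {k. k\<^sup>2 dvd p ^ j}" using p0 by (intro inj_onI) simp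
    moreover have "p ^ Suc (Suc j) div (p * k)\<^sup>2 = p ^ j div k\<^sup>2" for k
    proof -
      have "p ^ Suc (Suc j) = p\<^sup>2 * p ^ j" by (simp add: power2_eq_square)
      then show ?thesis using p0 by (simp only: power_mult_distrib) (rule div_mult_mult1, simp)
    qed
    ultimately show ?thesis unfolding rep_def eq by (simp add: sum.reindex del: power_Suc)
  qed
  show ?thesis
  proof (induction j rule: nat_induct2)
    case 0
    show ?case using rep0 by (simp add: divs del: power_0)
  next
    case 1
    show ?case unfolding divs using rep1 by simp
  next
    case (step j)
    have "int (rep (p ^ Suc (Suc j))) = chi p ^ Suc j + chi p ^ Suc (Suc j) + divisor_sum chi (p ^ j)"
      unfolding rep2 using root_count_prime_power[OF p, of "Suc j"] step by (simp del: power_Suc)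
    then show ?case unfolding divs by (simp del: power_Suc)
  qed
qed

text \<open>The factorization of the Dedekind zeta function as \<zeta> L, on the level of
  coefficients: both sides are multiplicative and agree at prime powers.\<close>

theorem rep_eq_divisor_sum:
  assumes "N > 0"
  shows "int (rep N) = divisor_sum chi N"
  using assms
proof (induction N rule: less_induct)
  case (less N)
  show ?case
  proof (cases "N = 1")
    case True
    then show ?thesis using rep_prime_power[OF two_is_prime_nat, of 0] by simp
  next
    case False
    then obtain p where p: "prime p" "p dvd N" using prime_factor_nat by blast
    from multiplicity_decompose'[of N p] less.prems p(1) obtain M where
      M: "N = p ^ multiplicity p N * M" "\<not> p dvd M"
      by (metis neq0_conv not_prime_unit)
    have mult: "multiplicity p N > 0" using p less.prems by (simp add: prime_multiplicity_gt_zero_iff)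
    have "M > 0" using M less.prems by (cases M) auto
    moreover have "p ^ multiplicity p N > 1" using prime_gt_1_nat[OF p(1)] mult by (rule one_less_power)
    ultimately have "M < N" using M(1) by (metis mult.commute mult.right_neutral nat_mult_less_cancel1)
    have cop: "coprime (p ^ multiplicity p N) M" using M(2) p(1) by (simp add: prime_imp_coprime)
    have pos: "p ^ multiplicity p N > 0" using p(1) prime_gt_0_nat by simp
    have "int (rep N) = int (rep (p ^ multiplicity p N)) * int (rep M)"
      using rep_mult[OF cop pos \<open>M > 0\<close>] M(1) by simp
    also have "\<dots> = divisor_sum chi (p ^ multiplicity p N) * divisor_sum chi M"
      using rep_prime_power[OF p(1)] less.IH[OF \<open>M < N\<close> \<open>M > 0\<close>] by simp
    also have "\<dots> = divisor_sum chi N"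
      using divisor_sum_chi_mult[OF cop pos \<open>M > 0\<close>] M(1) by simp
    finally show ?thesis .
  qed
qed

end

section \<open>The ring of integers\<close>

text \<open>Every power of the reduced denominator v divides the fixed D, and 2^k grows beyond
  |D|.\<close>

lemma rational_power_denominator:
  fixes N :: rat and D :: int
  assumes "D \<noteq> 0" "\<And>k. of_int D * N ^ k \<in> \<int>"
  shows "N \<in> \<int>"
proof -
  obtain u v where uv: "quotient_of N = (u, v)" by (cases "quotient_of N")
  then have v: "v > 0" and cop: "coprime u v" and N: "N = of_int u / of_int v"
    using quotient_of_denom_pos quotient_of_coprime quotient_of_div by blast+
  have dv: "v ^ k dvd D" for k
  proof -
    obtain z where "of_int D * N ^ k = of_int z" using assms(2)[of k] by (auto elim: Ints_cases)
    then have "(of_int (D * u ^ k) :: rat) = of_int (z * v ^ k)"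
      using v by (simp add: N power_divide field_simps)
    then have "D * u ^ k = z * v ^ k" by (simp only: of_int_eq_iff)
    then have "v ^ k dvd D * u ^ k" by simp
    moreover have "coprime (v ^ k) (u ^ k)" using cop by (simp add: coprime_commute)
    ultimately show ?thesis by (simp add: coprime_dvd_mult_left_iff)
  qed
  have "v = 1"
  proof (rule ccontr)
    assume "v \<noteq> 1"
    then have "2 \<le> v" using v by simp
    have "int k < v ^ k" for k
    proof -
      have "int k < 2 ^ k" by (simp add: of_nat_less_two_power)
      also have "\<dots> \<le> v ^ k" using \<open>2 \<le> v\<close> by (intro power_mono) auto
      finally show ?thesis .
    qed
    moreover have "v ^ nat \<bar>D\<bar> \<le> \<bar>D\<bar>" using dv[of "nat \<bar>D\<bar>"] assms(1) dvd_imp_le_int[of D "v ^ nat \<bar>D\<bar>"] v by simp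
    ultimately show False using linorder_not_less by (metis abs_ge_zero int_nat_eq)
  qed
  then show ?thesis using N by simp
qed

lemma squarefree_mult_square_Ints:
  fixes q :: rat and m :: int
  assumes "squarefree m" "of_int m * q\<^sup>2 \<in> \<int>"
  shows "q \<in> \<int>"
proof -
  obtain u v where uv: "quotient_of q = (u, v)" by (cases "quotient_of q")
  then have v: "v > 0" and cop: "coprime u v" and q: "q = of_int u / of_int v"
    using quotient_of_denom_pos quotient_of_coprime quotient_of_div by blast+
  obtain z where "of_int m * q\<^sup>2 = of_int z" using assms(2) by (auto elim: Ints_cases)
  then have "(of_int (m * u\<^sup>2) :: rat) = of_int (z * v\<^sup>2)"
    using v by (simp add: q power_divide field_simps)
  then have "m * u\<^sup>2 = z * v\<^sup>2" by (simp only: of_int_eq_iff)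
  then have "v\<^sup>2 dvd m * u\<^sup>2" by simp
  moreover have "coprime (v\<^sup>2) (u\<^sup>2)" using cop by (simp add: coprime_commute)
  ultimately have "v\<^sup>2 dvd m" by (simp add: coprime_dvd_mult_left_iff)
  then have "is_unit v" using assms(1) unfolding squarefree_def by blast
  then have "v = 1" using v by simp
  then show ?thesis using q by simp
qed

context imag_quadratic
begin

definition sd :: real where "sd = sqrt (real_of_int d)"

lemma sd_pos: "sd > 0" and sd_square: "sd * sd = real_of_int d"
  using d_gt by (simp_all add: sd_def)

definition om :: complex where "om = Complex (real_of_int tr / 2) (sd / 2)"

definition el :: "int \<Rightarrow> int \<Rightarrow> complex" where "el p q = of_int p + of_int q * om"

lemma Re_el: "Re (el p q) = real_of_int p + real_of_int q * real_of_int tr / 2"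
  and Im_el: "Im (el p q) = real_of_int q * sd / 2"
  by (simp_all add: el_def om_def)

lemma el_eq_iff: "el p q = el p' q' \<longleftrightarrow> p = p' \<and> q = q'"
proof
  assume "el p q = el p' q'"
  then have "Re (el p q) = Re (el p' q')" "Im (el p q) = Im (el p' q')" by simp_all
  then show "p = p' \<and> q = q'" using sd_pos by (auto simp: Re_el Im_el)
qed simp

lemma om_square: "om * om = of_int tr * om - of_int nm"
proof -
  have "real_of_int (4 * nm) = real_of_int (tr + d)" using disc by (simp only:)
  then have n: "real_of_int nm = (real_of_int tr + sd * sd) / 4" by (simp add: sd_square)
  show ?thesis
    by (rule complex_eqI) (use tr_cases n in \<open>auto simp: om_def algebra_simps\<close>)
qed

lemma el_add: "el p q + el p' q' = el (p + p') (q + q')"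
  and el_minus: "- el p q = el (- p) (- q)"
  and el_of_int: "of_int p = el p 0"
  by (simp_all add: el_def algebra_simps)

lemma el_mult: "el p q * el p' q' = el (p * p' - nm * q * q') (p * q' + q * p' + tr * q * q')"
proof -
  have "el p q * el p' q' = of_int (p * p') + of_int (p * q' + q * p') * om + of_int (q * q') * (om * om)"
    by (simp add: el_def algebra_simps)
  then show ?thesis unfolding om_square by (simp add: el_def algebra_simps)
qed

lemma el_0: "el 0 0 = 0" and el_1: "el 1 0 = 1" by (simp_all add: el_def)

lemma el_eq_0_iff: "el p q = 0 \<longleftrightarrow> p = 0 \<and> q = 0"
  using el_eq_iff[of p q 0 0] by (simp add: el_0)

lemma cnj_om: "cnj om = of_int tr - om"
  by (rule complex_eqI) (simp_all add: om_def)

lemma cnj_el: "cnj (el p q) = el (p + tr * q) (- q)"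
  by (simp add: el_def cnj_om algebra_simps)

lemma norm_el: "(cmod (el p q))\<^sup>2 = real_of_int (p * p + tr * p * q + nm * q * q)"
proof -
  have "of_real ((cmod (el p q))\<^sup>2) = el p q * cnj (el p q)" by (rule complex_norm_square)
  also have "\<dots> = el (p * p + tr * p * q + nm * q * q) 0"
    unfolding cnj_el el_mult by (simp add: algebra_simps)
  finally have "complex_of_real ((cmod (el p q))\<^sup>2) = of_int (p * p + tr * p * q + nm * q * q)"
    unfolding el_of_int .
  then show ?thesis by (metis of_real_of_int_eq of_real_eq_iff)
qed

abbreviation K :: "complex set" where "K \<equiv> quadratic_field (- d)"

abbreviation R :: "complex ring" where "R \<equiv> ring_of_integers K"

lemma csqrt_disc: "csqrt (of_int (- d)) = \<i> * of_real sd"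
proof -
  have "csqrt (of_int (- d)) = \<i> * of_real (sqrt \<bar>Re (of_int (- d))\<bar>)"
    using d_gt by (intro csqrt_of_real_nonpos) auto
  then show ?thesis using d_gt by (simp add: sd_def)
qed

lemma in_K_iff: "z \<in> K \<longleftrightarrow> (\<exists>a b :: rat. z = of_rat a + of_rat b * (\<i> * of_real sd))"
  unfolding quadratic_field_def csqrt_disc by blast

lemma om_eq: "om = (of_int tr + \<i> * of_real sd) / 2"
  by (rule complex_eqI) (simp_all add: om_def)

lemma el_in_K: "el p q \<in> K"
  unfolding in_K_iff
proof (intro exI)
  show "el p q = of_rat (of_int p + of_int (q * tr) / 2) + of_rat (of_int q / 2) * (\<i> * of_real sd)"
    by (simp add: el_def om_eq of_rat_add of_rat_mult of_rat_divide field_simps)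
qed

lemma algebraic_int_of_quadratic:
  fixes z :: complex
  assumes "z * z = of_int a * z + of_int b"
  shows "algebraic_int z"
proof (rule algebraic_int.intros)
  show "Polynomial.lead_coeff [:- of_int b, - of_int a, 1 :: complex:] = 1" by simp
  show "\<forall>i. Polynomial.coeff [:- of_int b, - of_int a, 1 :: complex:] i \<in> \<int>"
    by (auto simp: coeff_pCons split: nat.split)
  show "poly [:- of_int b, - of_int a, 1 :: complex:] z = 0" using assms by (simp add: algebra_simps)
qed

lemma el_algebraic_int: "algebraic_int (el p q)"
proof (rule algebraic_int_of_quadratic)
  show "el p q * el p q = of_int (2 * p + tr * q) * el p q + of_int (- (p * p + tr * p * q + nm * q * q))"
    unfolding el_of_int el_mult el_add el_eq_iff by (simp add: algebra_simps)
qed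

text \<open>Since \<open>z\<close> is integral, its powers have a common denominator \<open>c\<close> in \<open>Z + Z\<surd>-d\<close>; hence the powers of
  its norm have the common denominator \<open>c\<^sup>2\<close>.\<close>

lemma norm_algebraic_int:
  assumes z: "z = of_rat a + of_rat b * (\<i> * of_real sd)" and alg: "algebraic_int z"
  shows "a\<^sup>2 + of_int d * b\<^sup>2 \<in> \<int>"
proof -
  define L where "L = {of_int x + of_int y * (\<i> * of_real sd) | x y :: int. True}"
  have L_int: "of_int x \<in> L" for x unfolding L_def by (rule CollectI, rule exI[of _ x], rule exI[of _ 0]) simp
  have L_add: "u + w \<in> L" if uw: "u \<in> L" "w \<in> L" for u w
  proof -
    from uw obtain x y x' y' where "u = of_int x + of_int y * (\<i> * of_real sd)" "w = of_int x' + of_int y' * (\<i> * of_real sd)"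
      unfolding L_def by blast
    then have "u + w = of_int (x + x') + of_int (y + y') * (\<i> * of_real sd)" by (simp add: algebra_simps)
    then show ?thesis unfolding L_def by blast
  qed
  have L_mult: "u * w \<in> L" if uw: "u \<in> L" "w \<in> L" for u w
  proof -
    from uw obtain x y x' y' where e: "u = of_int x + of_int y * (\<i> * of_real sd)" "w = of_int x' + of_int y' * (\<i> * of_real sd)"
      unfolding L_def by blast
    have s: "(\<i> * of_real sd) * (\<i> * of_real sd) = (- of_int d :: complex)"
    proof -
      have "(\<i> * of_real sd) * (\<i> * of_real sd) = - complex_of_real (sd * sd)"
        by (rule complex_eqI) simp_all
      then show ?thesis unfolding sd_square by simp
    qed
    have "u * w = of_int (x * x') + of_int (x * y' + y * x') * (\<i> * of_real sd) + of_int (y * y') * ((\<i> * of_real sd) * (\<i> * of_real sd))"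
      unfolding e by (simp add: algebra_simps)
    also have "\<dots> = of_int (x * x' - d * (y * y')) + of_int (x * y' + y * x') * (\<i> * of_real sd)"
      unfolding s by (simp add: algebra_simps)
    finally show ?thesis unfolding L_def by blast
  qed
  have L_sum: "sum f S \<in> L" if "\<And>i. i \<in> S \<Longrightarrow> f i \<in> L" for f and S :: "nat set"
    using that by (induction S rule: infinite_finite_induct) (use L_int[of 0] L_add in auto)
  have L_power: "u ^ k \<in> L" if "u \<in> L" for u k
    using that by (induction k) (use L_int[of 1] L_mult in auto)
  obtain a1 v1 where a1: "quotient_of a = (a1, v1)" by (cases "quotient_of a")
  obtain b1 w1 where b1: "quotient_of b = (b1, w1)" by (cases "quotient_of b")
  have vw: "v1 > 0" "w1 > 0" "a = of_int a1 / of_int v1" "b = of_int b1 / of_int w1"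
    using a1 b1 quotient_of_denom_pos quotient_of_div by blast+
  define v where "v = v1 * w1"
  have v: "v > 0" using vw by (simp add: v_def)
  have wL: "of_int v * z \<in> L"
  proof -
    have "of_int v * z = of_int (a1 * w1) + of_int (b1 * v1) * (\<i> * of_real sd)"
    proof -
      have "of_rat a = (of_int a1 / of_int v1 :: complex)" "of_rat b = (of_int b1 / of_int w1 :: complex)"
        unfolding vw by (simp_all only: of_rat_divide of_rat_of_int_eq)
      then have "of_int v1 * of_rat a = (of_int a1 :: complex)" "of_int w1 * of_rat b = (of_int b1 :: complex)"
        using vw(1,2) by simp_all
      moreover have "of_int v * z = of_int w1 * (of_int v1 * of_rat a) + of_int v1 * (of_int w1 * of_rat b) * (\<i> * of_real sd)"
        by (simp add: z v_def algebra_simps)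
      ultimately show ?thesis by simp
    qed
    then show ?thesis unfolding L_def by blast
  qed
  from alg obtain p where p: "Polynomial.lead_coeff p = 1" "\<forall>i. Polynomial.coeff p i \<in> \<int>" "poly p z = 0"
    by (auto simp: algebraic_int.simps)
  define m where "m = Polynomial.degree p"
  \<comment> \<open>The number v clears the denominators of z, so v^m clears those of all powers up
    to the degree m of the monic equation; higher powers reduce to these with integer
    coefficients.\<close>
  define c where "c = v ^ m"
  have c_pos: "c > 0" using v by (simp add: c_def)
  have small: "of_int c * z ^ k \<in> L" if "k \<le> m" for k
  proof -
    have "of_int c * z ^ k = of_int (v ^ (m - k)) * (of_int v * z) ^ k"
      using that by (simp add: c_def power_mult_distrib power_add[symmetric] mult.assoc[symmetric])
    moreover have "of_int (v ^ (m - k)) * (of_int v * z) ^ k \<in> L" by (rule L_mult[OF L_int L_power[OF wL]])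
    ultimately show ?thesis by (simp only:)
  qed
  have rec: "z ^ m = (\<Sum>i<m. - Polynomial.coeff p i * z ^ i)"
  proof -
    have "0 = (\<Sum>i\<le>m. Polynomial.coeff p i * z ^ i)" using p(3) by (simp add: poly_altdef m_def)
    also have "\<dots> = (\<Sum>i<m. Polynomial.coeff p i * z ^ i) + z ^ m"
      using p(1) by (simp add: lessThan_Suc_atMost[symmetric] m_def)
    finally show ?thesis by (simp add: sum_negf add_eq_0_iff)
  qed
  have all: "of_int c * z ^ k \<in> L" for k
  proof (induction k rule: less_induct)
    case (less k)
    show ?case
    proof (cases "k \<le> m")
      case False
      then have "z ^ k = z ^ m * z ^ (k - m)" by (simp add: power_add[symmetric])
      also have "\<dots> = (\<Sum>i<m. - Polynomial.coeff p i * z ^ (i + (k - m)))"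
        unfolding rec by (simp add: sum_distrib_right power_add mult.assoc)
      finally have "of_int c * z ^ k = (\<Sum>i<m. - Polynomial.coeff p i * (of_int c * z ^ (i + (k - m))))"
        by (simp add: sum_distrib_left mult_ac)
      moreover have "- Polynomial.coeff p i * (of_int c * z ^ (i + (k - m))) \<in> L" if "i \<in> {..<m}" for i
      proof (rule L_mult)
        obtain x where "Polynomial.coeff p i = of_int x" using p(2) by (auto elim: Ints_cases)
        then have "- Polynomial.coeff p i = of_int (- x)" by simp
        then show "- Polynomial.coeff p i \<in> L" using L_int by metis
        show "of_int c * z ^ (i + (k - m)) \<in> L" using less.IH[of "i + (k - m)"] that False by simp
      qed
      from L_sum[of "{..<m}", OF this] have "(\<Sum>i<m. - Polynomial.coeff p i * (of_int c * z ^ (i + (k - m)))) \<in> L" .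
      ultimately show ?thesis by (simp only:)
    qed (rule small)
  qed
  have norm_L: "\<exists>n :: int. (cmod u)\<^sup>2 = of_int n" if "u \<in> L" for u
  proof -
    from that obtain x y where u: "u = of_int x + of_int y * (\<i> * of_real sd)" unfolding L_def by blast
    have "(cmod u)\<^sup>2 = real_of_int x ^ 2 + (real_of_int y * sd) ^ 2" unfolding cmod_power2 u by simp
    also have "\<dots> = real_of_int x ^ 2 + real_of_int y ^ 2 * (sd * sd)" by (simp add: power2_eq_square mult_ac)
    also have "\<dots> = of_int (x\<^sup>2 + y\<^sup>2 * d)" unfolding sd_square by simp
    finally show ?thesis by blast
  qed
  have norm_z: "(cmod z)\<^sup>2 = of_rat (a\<^sup>2 + of_int d * b\<^sup>2)"
  proof -
    have or: "of_rat r = complex_of_real (of_rat r)" for r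
    proof -
      obtain u w where "quotient_of r = (u, w)" by (cases "quotient_of r")
      then have "r = of_int u / of_int w" by (rule quotient_of_div)
      then show ?thesis by (simp only: of_rat_divide of_rat_of_int_eq of_real_divide of_real_of_int_eq)
    qed
    have "Re z = of_rat a" "Im z = of_rat b * sd"
      unfolding z or by simp_all
    then have "(cmod z)\<^sup>2 = (of_rat a)\<^sup>2 + (of_rat b)\<^sup>2 * (sd * sd)"
      unfolding cmod_power2 by (simp add: power2_eq_square mult_ac)
    then show ?thesis unfolding sd_square by (simp add: of_rat_add of_rat_mult of_rat_power mult.commute)
  qed
  show ?thesis
  proof (rule rational_power_denominator[of "c\<^sup>2"])
    show "c\<^sup>2 \<noteq> 0" using c_pos by simp
    fix k
    obtain n where n: "(cmod (of_int c * z ^ k))\<^sup>2 = of_int n" using norm_L[OF all] by blast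
    have "(cmod (of_int c * z ^ k))\<^sup>2 = (real_of_int c)\<^sup>2 * ((cmod z)\<^sup>2) ^ k"
      by (simp add: norm_mult norm_power power_mult_distrib power_mult[symmetric] mult.commute)
    then have "(of_rat (of_int (c\<^sup>2) * (a\<^sup>2 + of_int d * b\<^sup>2) ^ k) :: real) = of_rat (of_int n)"
      using n norm_z by (simp add: of_rat_mult of_rat_power)
    then have "of_int (c\<^sup>2) * (a\<^sup>2 + of_int d * b\<^sup>2) ^ k = of_int n" by (simp only: of_rat_eq_iff)
    then show "of_int (c\<^sup>2) * (a\<^sup>2 + of_int d * b\<^sup>2) ^ k \<in> \<int>" by simp
  qed
qed

text \<open>Integrality of the norms of z and z + 1 yields that of the trace, 2 a = N(z + 1) - N(z)
  - 1. Squarefreeness then bounds the denominator of b: 2 b is an integer for odd d, 4 b for even d.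
  The norm equation modulo 2, or modulo 4 for even d, gives the parities that put z into Z + Z
  \<omega>.\<close>

lemma algebraic_int_in_K:
  assumes "z \<in> K" "algebraic_int z"
  shows "\<exists>p q. z = el p q"
proof -
  from assms(1) obtain a b where z: "z = of_rat a + of_rat b * (\<i> * of_real sd)" unfolding in_K_iff by blast
  have z1: "z + 1 = of_rat (a + 1) + of_rat b * (\<i> * of_real sd)" by (simp add: z of_rat_add)
  have "algebraic_int (z + 1)"
    by (rule algebraic_int_root[OF assms(2), where p = "[:-1, 1:]"]) (auto simp: coeff_pCons split: nat.split)
  from norm_algebraic_int[OF z1 this] norm_algebraic_int[OF z assms(2)]
  obtain n n' where n: "a\<^sup>2 + of_int d * b\<^sup>2 = of_int n" "(a + 1)\<^sup>2 + of_int d * b\<^sup>2 = of_int n'"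
    by (auto elim!: Ints_cases)
  define T where "T = n' - n - 1"
  have T: "2 * a = of_int T"
    unfolding T_def of_int_diff n[symmetric] by (simp add: power2_eq_square algebra_simps)
  have T2: "(of_int T)\<^sup>2 + of_int d * (2 * b)\<^sup>2 = (of_int (4 * n) :: rat)"
    unfolding T[symmetric] of_int_mult n(1)[symmetric] by (simp add: power2_eq_square algebra_simps)
  have ab: "of_rat a = (of_int T / 2 :: complex)"
  proof -
    have "a = of_int T / 2" using T by simp
    then show ?thesis by (simp only: of_rat_divide of_rat_of_int_eq of_rat_numeral_eq)
  qed
  show ?thesis
  proof (cases "even d")
    case False
    then have tr: "tr = 1" by (simp add: tr_def)
    have "\<not> (\<exists>m. - d = 4 * m)" using False by presburger
    then have sf: "squarefree (- d)" using fund unfolding fundamental_discriminant_def by blast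
    have "of_int (- d) * (2 * b)\<^sup>2 = (of_int (T\<^sup>2 - 4 * n) :: rat)" using T2 by simp
    then have "of_int (- d) * (2 * b)\<^sup>2 \<in> \<int>" by (simp only: Ints_of_int)
    then have "2 * b \<in> \<int>" by (rule squarefree_mult_square_Ints[OF sf])
    then obtain U where U: "2 * b = of_int U" by (auto elim: Ints_cases)
    have "(of_int (T\<^sup>2 + d * U\<^sup>2) :: rat) = of_int (4 * n)" using T2 unfolding U by simp
    then have e: "T\<^sup>2 + d * U\<^sup>2 = 4 * n" by (simp only: of_int_eq_iff)
    have "even (T - U)"
    proof -
      have "even (T\<^sup>2 + d * U\<^sup>2)" unfolding e by simp
      then show ?thesis using False by simp
    qed
    then obtain x where x: "T - U = 2 * x" by (rule evenE)
    have bb: "of_rat b = (of_int U / 2 :: complex)"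
    proof -
      have "b = of_int U / 2" using U by simp
      then show ?thesis by (simp only: of_rat_divide of_rat_of_int_eq of_rat_numeral_eq)
    qed
    have "T = 2 * x + U" using x by simp
    then have "z = el x U" unfolding z ab bb el_def om_eq tr by (simp add: field_simps)
    then show ?thesis by blast
  next
    case True
    then have tr: "tr = 0" by (simp add: tr_def)
    have dn: "d = 4 * nm" using disc tr by simp
    then have dq: "(of_int d :: rat) = 4 * of_int nm" by (metis of_int_mult of_int_numeral)
    have d4: "of_int d * (2 * b)\<^sup>2 = of_int nm * (4 * b)\<^sup>2" unfolding dq by (simp add: power2_eq_square)
    have "\<not> (- d) mod 4 = 1" using True by presburger
    then obtain m where m: "- d = 4 * m" "squarefree m"
      using fund unfolding fundamental_discriminant_def by blast
    have mn: "m = - nm" using m dn by simp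
    have "of_int m * (4 * b)\<^sup>2 = (of_int (T\<^sup>2 - 4 * n) :: rat)"
      using T2 unfolding d4 mn by (simp add: algebra_simps)
    then have "of_int m * (4 * b)\<^sup>2 \<in> \<int>" by (simp only: Ints_of_int)
    then have "4 * b \<in> \<int>" by (rule squarefree_mult_square_Ints[OF m(2)])
    then obtain U where U: "4 * b = of_int U" by (auto elim: Ints_cases)
    have "(of_int (T\<^sup>2 + nm * U\<^sup>2) :: rat) = of_int (4 * n)" using T2 unfolding d4 U by simp
    then have e: "T\<^sup>2 + nm * U\<^sup>2 = 4 * n" by (simp only: of_int_eq_iff)
    have sq: "x\<^sup>2 mod 4 = (if even x then 0 else 1)" for x :: int
    proof (cases "even x")
      case True
      then obtain y where "x = 2 * y" by auto
      then show ?thesis by (simp add: power2_eq_square)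
    next
      case False
      then obtain y where y: "x = 2 * y + 1" by (auto elim: oddE)
      then have "x\<^sup>2 = 1 + 4 * (y * y + y)" by (simp add: power2_eq_square algebra_simps)
      then have "x\<^sup>2 mod 4 = 1 mod 4" by (simp only: mod_mult_self2)
      then show ?thesis using False by simp
    qed
    have "(T\<^sup>2 mod 4 + (nm mod 4) * (U\<^sup>2 mod 4)) mod 4 = (4 * n) mod 4"
    proof -
      have "(T\<^sup>2 mod 4 + (nm mod 4) * (U\<^sup>2 mod 4)) mod 4 = (T\<^sup>2 + (nm mod 4) * (U\<^sup>2 mod 4)) mod 4"
        by (rule mod_add_left_eq)
      also have "\<dots> = (T\<^sup>2 + (nm mod 4) * (U\<^sup>2 mod 4) mod 4) mod 4" by (rule mod_add_right_eq[symmetric])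
      also have "\<dots> = (T\<^sup>2 + nm * U\<^sup>2 mod 4) mod 4" by (simp only: mod_mult_eq)
      also have "\<dots> = (T\<^sup>2 + nm * U\<^sup>2) mod 4" by (rule mod_add_right_eq)
      finally show ?thesis unfolding e .
    qed
    then have m4: "(T\<^sup>2 mod 4 + (nm mod 4) * (U\<^sup>2 mod 4)) mod 4 = 0" by simp
    have "even T \<and> even U"
      using even_disc_nm[OF True] m4 unfolding sq[of T] sq[of U] by (elim disjE) (auto split: if_splits)
    then obtain x y where xy: "T = 2 * x" "U = 2 * y" by (blast elim: evenE)
    have bb: "of_rat b = (of_int U / 4 :: complex)"
    proof -
      have "b = of_int U / 4" using U by simp
      then show ?thesis by (simp only: of_rat_divide of_rat_of_int_eq of_rat_numeral_eq)
    qed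
    have "z = el x y" unfolding z ab bb xy el_def om_eq tr by (simp add: field_simps)
    then show ?thesis by blast
  qed
qed

lemma carrier_R: "carrier R = {el p q | p q. True}"
  unfolding ring_of_integers_def using el_in_K el_algebraic_int algebraic_int_in_K by auto

lemma R_simps: "x \<otimes>\<^bsub>R\<^esub> y = x * y" "x \<oplus>\<^bsub>R\<^esub> y = x + y" "\<zero>\<^bsub>R\<^esub> = 0" "\<one>\<^bsub>R\<^esub> = 1"
  by (simp_all add: ring_of_integers_def)

lemma el_in_R: "el p q \<in> carrier R" unfolding carrier_R by blast

lemma R_add: "x \<in> carrier R \<Longrightarrow> y \<in> carrier R \<Longrightarrow> x + y \<in> carrier R"
  unfolding carrier_R using el_add by blast

lemma R_minus: "x \<in> carrier R \<Longrightarrow> - x \<in> carrier R"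
  unfolding carrier_R using el_minus by blast

lemma R_mult: "x \<in> carrier R \<Longrightarrow> y \<in> carrier R \<Longrightarrow> x * y \<in> carrier R"
  unfolding carrier_R using el_mult by blast

lemma domain_R: "domain R"
proof -
  have abel: "abelian_group R"
  proof (rule abelian_groupI)
    fix x assume "x \<in> carrier R"
    moreover have "- x \<oplus>\<^bsub>R\<^esub> x = \<zero>\<^bsub>R\<^esub>" by (simp add: R_simps)
    ultimately show "\<exists>y\<in>carrier R. y \<oplus>\<^bsub>R\<^esub> x = \<zero>\<^bsub>R\<^esub>" using R_minus by blast
  next
    show "\<zero>\<^bsub>R\<^esub> \<in> carrier R" using el_in_R[of 0 0] by (simp add: R_simps el_0)
  qed (simp_all add: R_simps R_add add_ac)
  have monoid: "Group.comm_monoid R"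
  proof (rule comm_monoidI)
    show "\<one>\<^bsub>R\<^esub> \<in> carrier R" using el_in_R[of 1 0] by (simp add: R_simps el_1)
  qed (simp_all add: R_simps R_mult mult_ac)
  have "cring R"
    by (rule cringI[OF abel monoid]) (simp add: R_simps distrib_right)
  then show ?thesis
    by (rule domain.intro) (unfold_locales, auto simp: R_simps)
qed

lemma ideal_R_iff:
  "ideal I R \<longleftrightarrow> I \<subseteq> carrier R \<and> 0 \<in> I \<and> (\<forall>x\<in>I. \<forall>y\<in>I. x + y \<in> I) \<and> (\<forall>x\<in>carrier R. \<forall>y\<in>I. x * y \<in> I)"
proof
  assume "ideal I R"
  note id = this and sub = additive_subgroup.a_subset[OF ideal.axioms(1)[OF this]]
    additive_subgroup.zero_closed[OF ideal.axioms(1)[OF this]]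
    additive_subgroup.a_closed[OF ideal.axioms(1)[OF this]]
  show "I \<subseteq> carrier R \<and> 0 \<in> I \<and> (\<forall>x\<in>I. \<forall>y\<in>I. x + y \<in> I) \<and> (\<forall>x\<in>carrier R. \<forall>y\<in>I. x * y \<in> I)"
    using sub ideal.I_l_closed[OF id] unfolding R_simps by (intro conjI ballI) simp_all
next
  assume a: "I \<subseteq> carrier R \<and> 0 \<in> I \<and> (\<forall>x\<in>I. \<forall>y\<in>I. x + y \<in> I) \<and> (\<forall>x\<in>carrier R. \<forall>y\<in>I. x * y \<in> I)"
  interpret domain R by (rule domain_R)
  show "ideal I R"
  proof (rule idealI)
    show "ring R" by (rule ring_axioms)
    have "\<ominus>\<^bsub>R\<^esub> x \<in> I" if x: "x \<in> I" for x
    proof -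
      have xc: "x \<in> carrier R" using a x by blast
      have "el (-1) 0 * x \<in> I" using a x el_in_R by blast
      moreover have "el (-1) 0 = -1" by (simp add: el_def)
      moreover have "\<ominus>\<^bsub>R\<^esub> x = - x"
      proof (rule minus_equality)
        show "- x \<oplus>\<^bsub>R\<^esub> x = \<zero>\<^bsub>R\<^esub>" by (simp add: R_simps)
        show "- x \<in> carrier R" using xc by (rule R_minus)
      qed (rule xc)
      ultimately show ?thesis by simp
    qed
    then show "subgroup I (add_monoid R)"
      using a by (intro add.subgroupI) (auto simp: R_simps)
    fix y x assume "y \<in> I" "x \<in> carrier R"
    then have "x * y \<in> I" using a by blast
    then show "x \<otimes>\<^bsub>R\<^esub> y \<in> I" "y \<otimes>\<^bsub>R\<^esub> x \<in> I" by (simp_all add: R_simps mult.commute)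
  qed
qed

end

section \<open>Ideals as lattices\<close>

definition lat :: "complex \<Rightarrow> complex \<Rightarrow> complex set" where
  "lat u v = {of_int x * u + of_int y * v | x y :: int. True}"

definition area :: "complex \<Rightarrow> complex \<Rightarrow> real" where
  "area u v = Im (cnj u * v)"

lemma area_combination:
  "area (of_int a * u + of_int b * v) (of_int c * u + of_int e * v) = real_of_int (a * e - b * c) * area u v"
  by (simp add: area_def algebra_simps)

text \<open>Each basis is an integer combination of the other, so the two areas are integer
  multiples of each other.\<close>

lemma area_lat_unique:
  assumes eq: "lat u v = lat u' v'" and ne: "area u v \<noteq> 0"
  shows "\<bar>area u v\<bar> = \<bar>area u' v'\<bar>"
proof -
  have gen: "u \<in> lat u v" "v \<in> lat u v" for u v
  proof -
    have "u = of_int 1 * u + of_int 0 * v" "v = of_int 0 * u + of_int 1 * v" by simp_all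
    then show "u \<in> lat u v" "v \<in> lat u v" unfolding lat_def by blast+
  qed
  have step: "\<exists>n :: int. area x y = real_of_int n * area u v" if "x \<in> lat u v" "y \<in> lat u v" for x y u v
  proof -
    from that obtain a b c e :: int where "x = of_int a * u + of_int b * v" "y = of_int c * u + of_int e * v"
      unfolding lat_def by blast
    then show ?thesis using area_combination by blast
  qed
  obtain n where n: "area u' v' = real_of_int n * area u v" using step[of u' u v v'] gen(1)[of u' v'] gen(2)[of v' u'] unfolding eq[symmetric] by blast
  obtain m where m: "area u v = real_of_int m * area u' v'" using step[of u u' v' v] gen(1)[of u v] gen(2)[of v u] unfolding eq by blast
  have "area u v = real_of_int (m * n) * area u v" using m n by simp
  then have "real_of_int (m * n) = 1" using ne by (simp only: mult_cancel_right1) simp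
  then have "m * n = 1" by (simp only: of_int_eq_1_iff)
  then have "\<bar>n\<bar> = 1" using zmult_eq_1_iff[of m n] by auto
  then have "\<bar>real_of_int n\<bar> = 1" by (metis of_int_abs of_int_1)
  then show ?thesis unfolding n abs_mult by simp
qed

lemma int_subgroup_generator:
  fixes S :: "int set"
  assumes add: "\<And>x y. x \<in> S \<Longrightarrow> y \<in> S \<Longrightarrow> x + y \<in> S" and mult: "\<And>m x. x \<in> S \<Longrightarrow> m * x \<in> S"
    and ne: "z \<in> S" "z \<noteq> 0"
  shows "\<exists>g>0. \<forall>x. x \<in> S \<longleftrightarrow> g dvd x"
proof -
  define G where "G = (LEAST n :: nat. n > 0 \<and> int n \<in> S)"
  have "sgn z * z = \<bar>z\<bar>" by (simp add: sgn_if abs_if)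
  then have "nat \<bar>z\<bar> > 0 \<and> int (nat \<bar>z\<bar>) \<in> S" using ne mult[of z "sgn z"] by simp
  then have G: "G > 0 \<and> int G \<in> S" unfolding G_def by (rule LeastI)
  have "int G dvd x" if x: "x \<in> S" for x
  proof (rule ccontr)
    assume nd: "\<not> int G dvd x"
    have "x + (- (x div int G)) * int G \<in> S" using G x by (intro add mult) auto
    then have "x mod int G \<in> S" by (simp add: minus_mult_div_eq_mod[symmetric] mult.commute)
    moreover have "x mod int G < int G" using G by simp
    moreover have "0 < x mod int G"
      using nd G pos_mod_sign[of "int G" x] unfolding dvd_eq_mod_eq_0 by linarith
    ultimately have "G \<le> nat (x mod int G)" unfolding G_def by (intro Least_le) auto
    then show False using \<open>x mod int G < int G\<close> \<open>0 < x mod int G\<close> by linarith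
  qed
  moreover have "x \<in> S" if "int G dvd x" for x
    using that G mult by (auto elim!: dvdE simp: mult.commute)
  ultimately show ?thesis using G by (intro exI[of _ "int G"]) auto
qed

context imag_quadratic
begin

text \<open>The lattice \<open>k (Z a + Z (b + \<omega>))\<close>, in the coordinates of \<open>el\<close>.\<close>

definition idl :: "int \<Rightarrow> int \<Rightarrow> int \<Rightarrow> complex set" where
  "idl k a b = {el p q | p q. k dvd q \<and> k * a dvd p - q * b}"

lemma el_in_idl: "el p q \<in> idl k a b \<longleftrightarrow> k dvd q \<and> k * a dvd p - q * b"
  unfolding idl_def by (auto simp: el_eq_iff)

lemma idl_eq_lat:
  assumes "k > 0"
  shows "idl k a b = lat (el (k * a) 0) (el (k * b) k)"
proof -
  have e: "of_int x * el (k * a) 0 + of_int y * el (k * b) k = el (x * (k * a) + y * (k * b)) (y * k)" for x y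
    unfolding el_of_int el_mult el_add el_eq_iff by simp
  show ?thesis
  proof (intro equalityI subsetI)
    fix z assume "z \<in> idl k a b"
    then obtain p q where z: "z = el p q" "k dvd q" "k * a dvd p - q * b" unfolding idl_def by blast
    from z(2,3) obtain x y where "q = k * y" "p - q * b = k * a * x" by (auto elim!: dvdE)
    then have "z = of_int x * el (k * a) 0 + of_int y * el (k * b) k"
      unfolding e z(1) el_eq_iff by (auto simp: algebra_simps)
    then show "z \<in> lat (el (k * a) 0) (el (k * b) k)" unfolding lat_def by blast
  next
    fix z assume "z \<in> lat (el (k * a) 0) (el (k * b) k)"
    then obtain x y :: int where "z = of_int x * el (k * a) 0 + of_int y * el (k * b) k" unfolding lat_def by blast
    then have z: "z = el (x * (k * a) + y * (k * b)) (y * k)" unfolding e .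
    have "x * (k * a) + y * (k * b) - y * k * b = k * a * x" by (simp add: algebra_simps)
    then show "z \<in> idl k a b" unfolding z el_in_idl by simp
  qed
qed

text \<open>The norm of an ideal is its covolume divided by \<open>sd / 2\<close>, the covolume of the ring of integers.\<close>

definition nrm :: "complex set \<Rightarrow> real" where
  "nrm I = (THE N. \<exists>u v. I = lat u v \<and> \<bar>area u v\<bar> = N * sd / 2)"

lemma nrm_lat:
  assumes "\<bar>area u v\<bar> = N * sd / 2" "N > 0"
  shows "nrm (lat u v) = N"
  unfolding nrm_def
proof (rule the_equality)
  fix M assume "\<exists>u' v'. lat u v = lat u' v' \<and> \<bar>area u' v'\<bar> = M * sd / 2"
  then obtain u' v' where uv: "lat u v = lat u' v'" "\<bar>area u' v'\<bar> = M * sd / 2" by blast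
  have "area u v \<noteq> 0" using assms sd_pos by auto
  from area_lat_unique[OF uv(1) this] have "N * sd / 2 = M * sd / 2" unfolding uv(2) assms(1) .
  then show "M = N" using sd_pos by simp
qed (use assms in blast)

lemma area_idl: "area (el (k * a) 0) (el (k * b) k) = real_of_int (k * k * a) * sd / 2"
  by (simp add: area_def Re_el Im_el)

lemma nrm_idl:
  assumes "k > 0" "a > 0"
  shows "nrm (idl k a b) = real_of_int (k * k * a)"
  unfolding idl_eq_lat[OF assms(1)]
proof (rule nrm_lat)
  have "k * k * a > 0" using assms by simp
  then show "real_of_int (k * k * a) > 0" by (simp only: of_int_0_less_iff)
  then show "\<bar>area (el (k * a) 0) (el (k * b) k)\<bar> = real_of_int (k * k * a) * sd / 2"
    unfolding area_idl using sd_pos by (simp del: of_int_mult)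
qed

lemma in_nonzero_ideals_iff: "I \<in> nonzero_ideals R \<longleftrightarrow> ideal I R \<and> I \<noteq> {0}"
  unfolding nonzero_ideals_def by (simp add: R_simps)

text \<open>The ring is Z + Z \<omega>, so it suffices to multiply by \<omega>. The identity - nm q
  - (p + tr q) b = - b (p - q b) - q qf(b) shows how the divisibility of qf(b) by a enters.\<close>

lemma idl_is_ideal:
  assumes "k > 0" "a > 0" "a dvd qf b"
  shows "idl k a b \<in> nonzero_ideals R"
proof -
  have mult_int: "el (r * p) (r * q) \<in> idl k a b" if "el p q \<in> idl k a b" for r p q
  proof -
    have "r * p - r * q * b = r * (p - q * b)" by (simp add: algebra_simps)
    then show ?thesis using that unfolding el_in_idl by simp
  qed
  have mult_om: "el (- nm * q) (p + tr * q) \<in> idl k a b" if "el p q \<in> idl k a b" for p q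
  proof -
    have kq: "k dvd q" and ka: "k * a dvd p - q * b" using that by (auto simp: el_in_idl)
    have "k dvd p - q * b" using ka by (rule dvd_mult_left)
    then have "k dvd (p - q * b) + q * (b + tr)" using kq by (intro dvd_add dvd_mult2)
    then have "k dvd p + tr * q" by (simp add: algebra_simps)
    moreover have "- nm * q - (p + tr * q) * b = (p - q * b) * (- b) - q * qf b"
      by (simp add: qf_def algebra_simps)
    moreover have "k * a dvd (p - q * b) * (- b) - q * qf b"
      by (rule dvd_diff[OF dvd_mult2[OF ka] mult_dvd_mono[OF kq assms(3)]])
    ultimately show ?thesis unfolding el_in_idl by simp
  qed
  have add: "x + y \<in> idl k a b" if xy: "x \<in> idl k a b" "y \<in> idl k a b" for x y
  proof -
    from xy obtain p q p' q' where e: "x = el p q" "y = el p' q'" unfolding idl_def by blast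
    have eq: "p + p' - (q + q') * b = (p - q * b) + (p' - q' * b)" by (simp add: algebra_simps)
    have "k dvd q" "k dvd q'" "k * a dvd p - q * b" "k * a dvd p' - q' * b"
      using xy unfolding e el_in_idl by simp_all
    then show ?thesis unfolding e el_add el_in_idl eq by (intro conjI dvd_add)
  qed
  have "ideal (idl k a b) R"
    unfolding ideal_R_iff
  proof (intro conjI ballI)
    show "idl k a b \<subseteq> carrier R" unfolding idl_def carrier_R by blast
    show "0 \<in> idl k a b" unfolding el_0[symmetric] el_in_idl by simp
    fix x y assume "x \<in> carrier R" and y: "y \<in> idl k a b"
    then obtain r s p q where e: "x = el r s" "y = el p q" unfolding idl_def carrier_R by blast
    note y' = y[unfolded e(2)]
    have "x * y = el (r * p) (r * q) + el (s * (- nm * q)) (s * (p + tr * q))"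
      unfolding e el_mult el_add el_eq_iff by (simp add: algebra_simps)
    with add[OF mult_int[OF y', of r] mult_int[OF mult_om[OF y'], of s]]
    show "x * y \<in> idl k a b" by (simp only:)
  qed (rule add)
  moreover have "el (k * a) 0 \<in> idl k a b" "el (k * a) 0 \<noteq> 0"
    using assms unfolding el_in_idl el_eq_0_iff by auto
  ultimately show ?thesis unfolding in_nonzero_ideals_iff by blast
qed

text \<open>The Hermite normal form of an ideal: c generates its rational integers and k the
  \<omega>-coordinates of its elements. Multiplication by \<omega> shows that k divides c and also
  the integer part of every element with \<omega>-coordinate k, so k can be taken out of the whole
  ideal.\<close>

lemma ideal_is_idl:
  assumes I: "I \<in> nonzero_ideals R"
  obtains k a b where "k > 0" "a > 0" "0 \<le> b" "b < a" "a dvd qf b" "I = idl k a b"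
proof -
  from I have id: "I \<subseteq> carrier R" "0 \<in> I" "\<And>x y. x \<in> I \<Longrightarrow> y \<in> I \<Longrightarrow> x + y \<in> I"
    "\<And>x y. x \<in> carrier R \<Longrightarrow> y \<in> I \<Longrightarrow> x * y \<in> I" and "I \<noteq> {0}"
    unfolding in_nonzero_ideals_iff ideal_R_iff by auto
  have mint: "el (m * p) (m * q) \<in> I" if "el p q \<in> I" for m p q
    using id(4)[OF el_in_R[of m 0] that] by (simp add: el_mult)
  have mom: "el (- nm * q) (p + tr * q) \<in> I" if "el p q \<in> I" for p q
    using id(4)[OF el_in_R[of 0 1] that] by (simp add: el_mult)
  obtain z where "z \<in> I" "z \<noteq> 0" using id(2) \<open>I \<noteq> {0}\<close> by blast
  then obtain p q where pq: "el p q \<in> I" "el p q \<noteq> 0" using id(1) unfolding carrier_R by blast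
  define N where "N = p * p + tr * p * q + nm * q * q"
  have N: "el N 0 \<in> I"
    using id(4)[OF el_in_R[of "p + tr * q" "- q"] pq(1)] unfolding el_mult N_def by (simp add: algebra_simps)
  have "N \<noteq> 0"
    using norm_el[of p q] pq(2) unfolding N_def[symmetric] by auto
  have "\<exists>c>0. \<forall>x. x \<in> {p. el p 0 \<in> I} \<longleftrightarrow> c dvd x"
  proof (rule int_subgroup_generator)
    show "N \<in> {p. el p 0 \<in> I}" using N by simp
    show "x + y \<in> {p. el p 0 \<in> I}" if "x \<in> {p. el p 0 \<in> I}" "y \<in> {p. el p 0 \<in> I}" for x y
      using id(3)[of "el x 0" "el y 0"] that by (simp add: el_add)
    show "m * x \<in> {p. el p 0 \<in> I}" if "x \<in> {p. el p 0 \<in> I}" for m x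
      using mint[of x 0 m] that by simp
  qed fact
  then obtain c where c: "c > 0" "\<And>x. el x 0 \<in> I \<longleftrightarrow> c dvd x" by auto
  have "\<exists>k>0. \<forall>x. x \<in> {q. \<exists>p. el p q \<in> I} \<longleftrightarrow> k dvd x"
  proof (rule int_subgroup_generator)
    show "N \<in> {q. \<exists>p. el p q \<in> I}" using mom[OF N] by auto
    show "x + y \<in> {q. \<exists>p. el p q \<in> I}" if "x \<in> {q. \<exists>p. el p q \<in> I}" "y \<in> {q. \<exists>p. el p q \<in> I}" for x y
    proof -
      from that obtain p p' where "el p x \<in> I" "el p' y \<in> I" by auto
      from id(3)[OF this] show ?thesis unfolding el_add by blast
    qed
    show "m * x \<in> {q. \<exists>p. el p q \<in> I}" if "x \<in> {q. \<exists>p. el p q \<in> I}" for m x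
      using mint that by blast
  qed fact
  then obtain k where k: "k > 0" "\<And>q. (\<exists>p. el p q \<in> I) \<longleftrightarrow> k dvd q" by auto
  have "el 0 c \<in> I" using mom[of c 0] c by simp
  then have "k dvd c" using k(2) by blast
  then obtain a where a: "c = k * a" by (auto elim: dvdE)
  have a0: "a > 0" using a c k by (simp add: zero_less_mult_iff)
  obtain p0 where p0: "el p0 k \<in> I" using k(2)[of k] by auto
  have "k dvd p0 + tr * k" using mom[OF p0] k(2) by blast
  then have "k dvd (p0 + tr * k) - tr * k" by (intro dvd_diff) auto
  then obtain b0 where b0: "p0 = k * b0" by (auto elim: dvdE)
  define b where "b = b0 mod a"
  have bb: "0 \<le> b" "b < a" using a0 by (auto simp: b_def)
  have elb: "el (k * b) k \<in> I"
  proof -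
    have "el (- (b0 div a) * c) 0 \<in> I" using c by simp
    from id(3)[OF p0 this] have "el (p0 + - (b0 div a) * c) k \<in> I" by (simp add: el_add)
    moreover have "p0 + - (b0 div a) * c = k * (b0 - a * (b0 div a))" unfolding b0 a by (simp add: algebra_simps)
    moreover have "b0 - a * (b0 div a) = b" unfolding b_def by (rule minus_mult_div_eq_mod)
    ultimately show ?thesis by simp
  qed
  \<comment> \<open>Multiplying k (b + \<omega>) by \<omega> - (b + tr), the negative of the
    conjugate of b + \<omega>, produces the rational integer - k qf(b) of the ideal.\<close>
  have "el (- (b + tr) * (k * b)) (- (b + tr) * k) \<in> I" by (rule mint[OF elb])
  from id(3)[OF mom[OF elb] this] have "el (- (k * qf b)) 0 \<in> I"
    unfolding el_add by (simp add: qf_def algebra_simps)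
  then have "k * a dvd k * qf b" using c(2) unfolding a by simp
  then have dv: "a dvd qf b" using k(1) by simp
  have "I = idl k a b"
  proof (intro equalityI subsetI)
    fix z assume z: "z \<in> I"
    then obtain p q where zpq: "z = el p q" using id(1) unfolding carrier_R by blast
    then have kq: "k dvd q" using k(2) z by blast
    then obtain y where y: "q = k * y" by (auto elim: dvdE)
    have "el (- y * (k * b)) (- y * k) \<in> I" by (rule mint[OF elb])
    from id(3)[OF z[unfolded zpq] this] have "el (p - q * b) 0 \<in> I" unfolding el_add y by (simp add: algebra_simps)
    then have "c dvd p - q * b" by (simp only: c(2))
    then show "z \<in> idl k a b" unfolding zpq el_in_idl using kq a by simp
  next
    fix z assume "z \<in> idl k a b"
    then obtain p q where z: "z = el p q" "k dvd q" "k * a dvd p - q * b" unfolding idl_def by blast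
    from z(2) obtain y where y: "q = k * y" by (auto elim: dvdE)
    have "el (p - q * b) 0 \<in> I" using z(3) c(2) a by simp
    from id(3)[OF this mint[OF elb, of y]] show "z \<in> I" unfolding el_add z(1) y by (simp add: algebra_simps)
  qed
  then show ?thesis using that k(1) a0 bb dv by blast
qed

lemma idl_eq_iff:
  assumes "k > 0" "a > 0" "0 \<le> b" "b < a" "k' > 0" "a' > 0" "0 \<le> b'" "b' < a'" "idl k a b = idl k' a' b'"
  shows "k = k' \<and> a = a' \<and> b = b'"
proof -
  have "el (k * b) k \<in> idl k a b" "el (k' * b') k' \<in> idl k' a' b'"
    unfolding el_in_idl by simp_all
  then have "el (k * b) k \<in> idl k' a' b'" "el (k' * b') k' \<in> idl k a b"
    unfolding assms(9) by simp_all
  then have kk: "k' dvd k" "k dvd k'" and bb: "k' * a' dvd k * b - k * b'" by (auto simp: el_in_idl)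
  then have k: "k = k'" using assms(1,5) zdvd_antisym_nonneg[of k k'] by simp
  have "el (k * a) 0 \<in> idl k' a' b'" unfolding assms(9)[symmetric] el_in_idl by simp
  moreover have "el (k' * a') 0 \<in> idl k a b" unfolding assms(9) el_in_idl by simp
  ultimately have "k' * a' dvd k * a" "k * a dvd k' * a'" by (auto simp: el_in_idl)
  then have "a' dvd a" "a dvd a'" using k assms(1) by simp_all
  then have a: "a = a'" using assms(2,6) zdvd_antisym_nonneg[of a a'] by simp
  have "k * a dvd k * (b - b')" using bb k a by (simp add: algebra_simps)
  then have "a dvd b - b'" using assms(1) by simp
  then have "b mod a = b' mod a" by (simp add: mod_eq_dvd_iff)
  then show ?thesis using k a assms(3,4,7,8) by simp
qed

text \<open>Existence and uniqueness of the normal form make (k, b) \<mapsto> k (Z a + Z (b +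
  \<omega>)) with a = N/k^2 a bijection onto the ideals of norm N.\<close>

lemma card_nrm_eq:
  assumes N: "N > 0"
  shows "finite {I \<in> nonzero_ideals R. nrm I = real N}"
    and "card {I \<in> nonzero_ideals R. nrm I = real N} = rep N"
proof -
  let ?S = "SIGMA k:{k. k\<^sup>2 dvd N}. root_set (N div k\<^sup>2)"
  let ?f = "\<lambda>(k, b). idl (int k) (int (N div k\<^sup>2)) b"
  have pos: "k > 0" "N div k\<^sup>2 > 0" "real_of_int (int k * int k * int (N div k\<^sup>2)) = real N" if "k\<^sup>2 dvd N" for k
  proof -
    from that obtain m where m: "N = k\<^sup>2 * m" by (auto elim: dvdE)
    then show "k > 0" using N by (cases "k = 0") auto
    then have dm: "N div k\<^sup>2 = m" using m by simp
    then show "N div k\<^sup>2 > 0" using m N by (cases m) auto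
    show "real_of_int (int k * int k * int (N div k\<^sup>2)) = real N"
      unfolding dm unfolding m by (simp add: power2_eq_square)
  qed
  have inj: "inj_on ?f ?S"
  proof (rule inj_onI)
    fix s t assume s: "s \<in> ?S" and t: "t \<in> ?S" and e: "?f s = ?f t"
    obtain k b k' b' where kb: "s = (k, b)" "t = (k', b')" by (cases s, cases t)
    have "k\<^sup>2 dvd N" "k'\<^sup>2 dvd N" "b \<in> root_set (N div k\<^sup>2)" "b' \<in> root_set (N div k'\<^sup>2)" using s t kb by auto
    then have "int k = int k' \<and> int (N div k\<^sup>2) = int (N div k'\<^sup>2) \<and> b = b'"
      using pos e kb by (intro idl_eq_iff) (auto simp: root_set_def)
    then show "s = t" using kb by simp
  qed
  have img: "?f ` ?S = {I \<in> nonzero_ideals R. nrm I = real N}"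
  proof (intro equalityI subsetI)
    fix I assume "I \<in> ?f ` ?S"
    then obtain k b where kb: "k\<^sup>2 dvd N" "b \<in> root_set (N div k\<^sup>2)" "I = idl (int k) (int (N div k\<^sup>2)) b" by auto
    then show "I \<in> {I \<in> nonzero_ideals R. nrm I = real N}"
      using pos[OF kb(1)] idl_is_ideal[of "int k" "int (N div k\<^sup>2)" b] nrm_idl[of "int k" "int (N div k\<^sup>2)" b]
      by (simp add: root_set_def)
  next
    fix I assume I: "I \<in> {I \<in> nonzero_ideals R. nrm I = real N}"
    then obtain k a b where kab: "k > 0" "a > 0" "0 \<le> b" "b < a" "a dvd qf b" "I = idl k a b"
      using ideal_is_idl by blast
    have "real_of_int (k * k * a) = real N" using I nrm_idl[OF kab(1,2)] kab(6) by simp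
    then have e: "k * k * a = int N" by linarith
    obtain k' a' where ka: "k = int k'" "a = int a'"
      using kab(1,2) by (metis less_imp_le nonneg_int_cases)
    have "int (k'\<^sup>2 * a') = int N" using e unfolding ka by (simp add: power2_eq_square)
    then have N': "N = k'\<^sup>2 * a'" by (simp only: of_nat_eq_iff)
    then have "N div k'\<^sup>2 = a'" using kab(1) ka by simp
    moreover have "k'\<^sup>2 dvd N" unfolding N' by simp
    ultimately have S: "(k', b) \<in> ?S" "?f (k', b) = I" using kab ka by (auto simp: root_set_def)
    show "I \<in> ?f ` ?S" using imageI[OF S(1), of ?f] unfolding S(2) .
  qed
  have fin: "finite ?S" using finite_square_divisors[OF N] finite_root_set by (intro finite_SigmaI) auto
  show "finite {I \<in> nonzero_ideals R. nrm I = real N}" unfolding img[symmetric] using fin by (rule finite_imageI)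
  have "card {I \<in> nonzero_ideals R. nrm I = real N} = card ?S" unfolding img[symmetric] by (rule card_image[OF inj])
  also have "\<dots> = rep N"
    unfolding rep_def root_count_def using finite_square_divisors[OF N] finite_root_set by (intro card_SigmaI) auto
  finally show "card {I \<in> nonzero_ideals R. nrm I = real N} = rep N" .
qed

end

section \<open>Ideal classes and reduced forms\<close>

context imag_quadratic
begin

definition scale :: "complex \<Rightarrow> complex set \<Rightarrow> complex set" where
  "scale c J = (\<lambda>z. c * z) ` J"

lemma scale_scale: "scale c (scale e J) = scale (c * e) J"
  by (simp add: scale_def image_image mult.assoc)

lemma scale_lat: "scale c (lat u v) = lat (c * u) (c * v)"
proof (intro equalityI subsetI)
  fix z assume "z \<in> scale c (lat u v)"
  then obtain x y :: int where "z = c * (of_int x * u + of_int y * v)" unfolding scale_def lat_def by blast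
  then have "z = of_int x * (c * u) + of_int y * (c * v)" by (simp add: algebra_simps)
  then show "z \<in> lat (c * u) (c * v)" unfolding lat_def by blast
next
  fix z assume "z \<in> lat (c * u) (c * v)"
  then obtain x y :: int where "z = of_int x * (c * u) + of_int y * (c * v)" unfolding lat_def by blast
  then have "z = c * (of_int x * u + of_int y * v)" by (simp add: algebra_simps)
  then show "z \<in> scale c (lat u v)" unfolding scale_def lat_def by blast
qed

lemma area_scale: "area (c * u) (c * v) = (cmod c)\<^sup>2 * area u v"
proof -
  have "cnj (c * u) * (c * v) = of_real ((cmod c)\<^sup>2) * (cnj u * v)"
    unfolding complex_norm_square by (simp add: mult_ac)
  moreover have "Im (of_real r * w) = r * Im w" for r w by simp
  ultimately show ?thesis unfolding area_def by (simp only:)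
qed

lemma nrm_pos: "I \<in> nonzero_ideals R \<Longrightarrow> nrm I > 0"
proof -
  assume "I \<in> nonzero_ideals R"
  then obtain k a b where kab: "k > 0" "a > 0" "I = idl k a b" using ideal_is_idl by metis
  have "k * k * a > 0" using kab by simp
  then show ?thesis unfolding kab(3) nrm_idl[OF kab(1,2)] by (simp only: of_int_0_less_iff)
qed

lemma nrm_scale:
  assumes J: "J \<in> nonzero_ideals R" and c: "c \<noteq> 0"
  shows "nrm (scale c J) = (cmod c)\<^sup>2 * nrm J"
proof -
  obtain k a b where kab: "k > 0" "a > 0" "J = idl k a b" using J ideal_is_idl by metis
  have nJ: "nrm J = real_of_int (k * k * a)" unfolding kab(3) by (rule nrm_idl[OF kab(1,2)])
  have pos: "nrm J > 0" by (rule nrm_pos[OF J])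
  show ?thesis
    unfolding kab(3) idl_eq_lat[OF kab(1)] scale_lat
  proof (rule nrm_lat)
    show "0 < (cmod c)\<^sup>2 * nrm (lat (el (k * a) 0) (el (k * b) k))"
      using pos c unfolding kab(3) idl_eq_lat[OF kab(1)] by simp
    have "\<bar>area (c * el (k * a) 0) (c * el (k * b) k)\<bar> = (cmod c)\<^sup>2 * \<bar>nrm J * sd / 2\<bar>"
      unfolding area_scale area_idl nJ by (simp only: abs_mult abs_power2)
    also have "\<bar>nrm J * sd / 2\<bar> = nrm J * sd / 2" using pos sd_pos by simp
    finally show "\<bar>area (c * el (k * a) 0) (c * el (k * b) k)\<bar> =
        (cmod c)\<^sup>2 * nrm (lat (el (k * a) 0) (el (k * b) k)) * sd / 2"
      unfolding kab(3) idl_eq_lat[OF kab(1)] by simp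
  qed
qed

lemma l_coset_R: "a <#\<^bsub>R\<^esub> J = scale a J"
  unfolding l_coset_def scale_def by (auto simp: R_simps)

text \<open>A complex scalar c may replace the pair a, b: for any nonzero j in J, the product c j
  lies in I and hence in the ring, and j I = (c j) J.\<close>

lemma ideal_class_rel_iff:
  assumes I: "I \<in> nonzero_ideals R" and J: "J \<in> nonzero_ideals R"
  shows "(I, J) \<in> ideal_class_rel R \<longleftrightarrow> (\<exists>c. c \<noteq> 0 \<and> I = scale c J)"
proof
  assume "(I, J) \<in> ideal_class_rel R"
  then obtain a b where ab: "a \<noteq> 0" "b \<noteq> 0" "scale a I = scale b J"
    unfolding ideal_class_rel_def l_coset_R by (auto simp: R_simps)
  have "I = scale (1 / a * a) I" using ab(1) by (simp add: scale_def)
  also have "\<dots> = scale (1 / a * b) J" unfolding scale_scale[symmetric] ab(3) ..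
  finally show "\<exists>c. c \<noteq> 0 \<and> I = scale c J" using ab by (intro exI[of _ "1 / a * b"]) simp
next
  assume "\<exists>c. c \<noteq> 0 \<and> I = scale c J"
  then obtain c where c: "c \<noteq> 0" "I = scale c J" by blast
  have sub: "I \<subseteq> carrier R" "J \<subseteq> carrier R" "0 \<in> J" "J \<noteq> {0}"
    using I J unfolding in_nonzero_ideals_iff ideal_R_iff by auto
  then obtain j where j: "j \<in> J" "j \<noteq> 0" by blast
  have "c * j \<in> I" unfolding c(2) scale_def using j by blast
  then have carr: "j \<in> carrier R - {0}" "c * j \<in> carrier R - {0}" using sub j c by auto
  have "scale j I = scale (c * j) J" unfolding c(2) scale_scale by (simp only: mult.commute)
  then show "(I, J) \<in> ideal_class_rel R"
    using I J carr unfolding ideal_class_rel_def l_coset_R R_simps by blast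
qed

lemma equiv_rel: "equiv (nonzero_ideals R) (ideal_class_rel R)"
  by (rule equiv_ideal_class_rel[OF domain_R])

definition ideal_classes :: "complex set set set" where
  "ideal_classes = nonzero_ideals R // ideal_class_rel R"

lemma class_number_eq: "class_number K = card ideal_classes"
  unfolding class_number_def ideal_classes_def ..

lemma classes_subset: "C \<in> ideal_classes \<Longrightarrow> C \<subseteq> nonzero_ideals R"
  unfolding ideal_classes_def by (rule in_quotient_imp_subset[OF equiv_rel])

lemma class_mem_iff:
  assumes C: "C \<in> ideal_classes" and J: "J \<in> C"
  shows "I \<in> C \<longleftrightarrow> I \<in> nonzero_ideals R \<and> (\<exists>c. c \<noteq> 0 \<and> I = scale c J)"
proof -
  have JN: "J \<in> nonzero_ideals R" using classes_subset[OF C] J by blast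
  have "I \<in> C \<longleftrightarrow> I \<in> nonzero_ideals R \<and> (J, I) \<in> ideal_class_rel R"
    using C J classes_subset[OF C] unfolding ideal_classes_def
    using in_quotient_imp_closed[OF equiv_rel _ J] in_quotient_imp_in_rel[OF equiv_rel, of C J I] by auto
  also have "\<dots> \<longleftrightarrow> I \<in> nonzero_ideals R \<and> (I, J) \<in> ideal_class_rel R"
    using equiv_rel by (meson equivE symE)
  finally show ?thesis using ideal_class_rel_iff[OF _ JN] by blast
qed

lemma idl_shift: "idl 1 a (b + a * m) = idl 1 a b"
proof -
  have "a dvd p - q * (b + a * m) \<longleftrightarrow> a dvd p - q * b" for p q
  proof -
    have "p - q * (b + a * m) = (p - q * b) + a * (- q * m)" by (simp add: algebra_simps)
    then show ?thesis by (simp only: dvd_add_times_triv_right_iff mult.commute[of a])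
  qed
  then show ?thesis unfolding idl_def by simp
qed

text \<open>Reduction theory by minimality: in an ideal of least norm the factor k is 1, since
  dividing by k stays in the class. Changing b modulo a leaves the ideal alone and makes the middle
  coefficient 2 b + tr small. Norms of ideals are positive integers, so taking \<open>nat\<close> of
  the floor loses nothing and makes the least-number principle available.\<close>

lemma class_has_minimal_ideal:
  assumes C: "C \<in> ideal_classes"
  obtains a b where "a > 0" "a dvd qf b" "idl 1 a b \<in> C" "\<bar>2 * b + tr\<bar> \<le> a"
    "\<And>I. I \<in> C \<Longrightarrow> real_of_int a \<le> nrm I"
proof -
  have "C \<noteq> {}" using C unfolding ideal_classes_def by (rule in_quotient_imp_non_empty[OF equiv_rel])
  then obtain I0 where "I0 \<in> C" by blast
  then obtain J where J: "J \<in> C" "\<And>I. I \<in> C \<Longrightarrow> nat \<lfloor>nrm J\<rfloor> \<le> nat \<lfloor>nrm I\<rfloor>"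
    using ex_has_least_nat[of "\<lambda>I. I \<in> C" I0 "\<lambda>I. nat \<lfloor>nrm I\<rfloor>"] by blast
  have sub: "C \<subseteq> nonzero_ideals R" by (rule classes_subset[OF C])
  obtain k a b where kab: "k > 0" "a > 0" "0 \<le> b" "b < a" "a dvd qf b" "J = idl k a b"
    using ideal_is_idl[of J] sub J(1) by blast
  have nJ: "nrm J = real_of_int (k * k * a)" unfolding kab(6) by (rule nrm_idl[OF kab(1,2)])
  have min: "real_of_int (k * k * a) \<le> nrm I" if I: "I \<in> C" for I
  proof -
    obtain k' a' b' where kab': "k' > 0" "a' > 0" "I = idl k' a' b'" using ideal_is_idl[of I] sub I by blast
    have nI: "nrm I = real_of_int (k' * k' * a')" unfolding kab'(3) by (rule nrm_idl[OF kab'(1,2)])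
    have "k' * k' * a' > 0" using kab' by simp
    moreover have "nat (k * k * a) \<le> nat (k' * k' * a')" using J(2)[OF I] unfolding nJ nI floor_of_int .
    ultimately have "k * k * a \<le> k' * k' * a'" by linarith
    then show ?thesis unfolding nI by (simp only: of_int_le_iff)
  qed
  have i1: "idl 1 a b \<in> nonzero_ideals R" by (rule idl_is_ideal) (use kab in auto)
  have "J = scale (of_int k) (idl 1 a b)"
    unfolding kab(6) idl_eq_lat[OF kab(1)] idl_eq_lat[OF zero_less_one] scale_lat el_of_int el_mult by simp
  then have "idl 1 a b = scale (1 / of_int k) J" using kab(1) by (simp add: scale_scale) (simp add: scale_def)
  then have i1C: "idl 1 a b \<in> C"
    unfolding class_mem_iff[OF C J(1)] using i1 kab(1) by (intro conjI exI[of _ "1 / of_int k"]) auto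
  have "k * k * a \<le> 1 * 1 * a"
    using min[OF i1C] unfolding nrm_idl[OF zero_less_one kab(2)] of_int_le_iff .
  then have "k * k \<le> 1" using kab(2) by simp
  have k: "k = 1"
  proof (rule ccontr)
    assume "k \<noteq> 1"
    then have "2 \<le> k" using kab(1) by simp
    then have "2 * 2 \<le> k * k" by (intro mult_mono) auto
    then show False using \<open>k * k \<le> 1\<close> by simp
  qed
  \<comment> \<open>The shift by m brings 2 b + tr into the interval from -a to a - 1.\<close>
  define m where "m = - ((2 * b + tr + a) div (2 * a))"
  have "2 * (b + a * m) + tr = (2 * b + tr + a) mod (2 * a) - a"
    unfolding m_def minus_mult_div_eq_mod[symmetric] by (simp add: algebra_simps)
  moreover have "0 \<le> (2 * b + tr + a) mod (2 * a)" "(2 * b + tr + a) mod (2 * a) < 2 * a"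
    using kab(2) by (simp_all add: pos_mod_bound)
  ultimately have "\<bar>2 * (b + a * m) + tr\<bar> \<le> a" by linarith
  moreover have "a dvd qf (b + a * m)"
    using kab(5) qf_dvd_cong[of "b + a * m" b a] by (simp add: Cong.cong_def)
  ultimately show ?thesis using that[of a "b + a * m"] kab(2) i1C min k unfolding idl_shift by simp
qed

lemma norm_in_idl:
  "(cmod (el (x * a + y * b) y))\<^sup>2 = real_of_int (a * a * x * x + a * (2 * b + tr) * x * y + qf b * y * y)"
  unfolding norm_el of_int_eq_iff by (simp add: qf_def algebra_simps)

text \<open>Four times the norm is (2 p + tr q)^2 + d q^2, and d > 4 excludes a nonzero q.\<close>

lemma norm_eq_1_imp:
  assumes "cmod (el p q) = 1"
  shows "el p q = 1 \<or> el p q = -1"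
proof -
  have "real_of_int (p * p + tr * p * q + nm * q * q) = 1" unfolding norm_el[symmetric] assms by simp
  then have e: "p * p + tr * p * q + nm * q * q = 1" by linarith
  have "(2 * p + tr * q) * (2 * p + tr * q) + d * (q * q) = 4 * (p * p + tr * p * q + nm * q * q)"
  proof -
    have "4 * (p * p + tr * p * q + nm * q * q) = 4 * (p * p) + 4 * (tr * p * q) + (4 * nm) * (q * q)" by (simp add: algebra_simps)
    also have "\<dots> = 4 * (p * p) + 4 * (tr * p * q) + (tr * tr + d) * (q * q)" unfolding disc tr_square ..
    finally show ?thesis by (simp add: algebra_simps)
  qed
  then have e4: "(2 * p + tr * q) * (2 * p + tr * q) + d * (q * q) = 4" using e by simp
  have "q = 0"
  proof (rule ccontr)
    assume "q \<noteq> 0"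
    then have "1 \<le> q * q" by (metis int_one_le_iff_zero_less not_square_less_zero linorder_neqE mult_eq_0_iff)
    then have "d * 1 \<le> d * (q * q)" using d_gt by (intro mult_left_mono) auto
    moreover have "0 \<le> (2 * p + tr * q) * (2 * p + tr * q)" by simp
    ultimately show False using e4 d_gt by linarith
  qed
  then have "p * p = 1" using e by simp
  then have "p = 1 \<or> p = -1" by (simp add: square_eq_1_iff)
  then show ?thesis using \<open>q = 0\<close> by (auto simp: el_def)
qed

text \<open>Multiplication by c acts on the lattice by an integer 2 x 2 matrix, so c is a root of a
  monic quadratic polynomial with integer coefficients. As a quotient of elements of the field it is
  therefore an element of the ring, of norm 1.\<close>

lemma unit_of_idl:
  assumes a: "a > 0" and dv: "a dvd qf b" and c: "scale c (idl 1 a b) = idl 1 a b" and norm: "cmod c = 1"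
  shows "c = 1 \<or> c = -1"
proof -
  let ?J = "idl 1 a b"
  have gens: "el a 0 \<in> ?J" "el b 1 \<in> ?J" unfolding el_in_idl by simp_all
  have J: "?J = lat (el a 0) (el b 1)" using idl_eq_lat[of 1 a b] by simp
  have "c * el a 0 \<in> ?J" "c * el b 1 \<in> ?J" using gens c unfolding scale_def by blast+
  then obtain x y z w :: int where
    e1: "c * el a 0 = of_int x * el a 0 + of_int y * el b 1" and
    e2: "c * el b 1 = of_int z * el a 0 + of_int w * el b 1" unfolding J lat_def by blast
  have nz: "el a 0 \<noteq> 0" using a by (simp add: el_eq_0_iff)
  have "(c - of_int x) * el a 0 = of_int y * el b 1" "(c - of_int w) * el b 1 = of_int z * el a 0"
    using e1 e2 by (simp_all add: algebra_simps)
  then have "(c - of_int w) * ((c - of_int x) * el a 0) = of_int (y * z) * el a 0" by simp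
  then have "(c - of_int w) * (c - of_int x) = of_int (y * z)"
    using nz by (metis mult.assoc mult_right_cancel)
  then have "c * c = of_int (x + w) * c + of_int (y * z - x * w)" by (simp add: algebra_simps)
  then have alg: "algebraic_int c" by (rule algebraic_int_of_quadratic)
  have "c \<in> K"
  proof -
    have "c = (of_int x * el a 0 + of_int y * el b 1) / el a 0" using e1 nz by (metis nonzero_mult_div_cancel_right)
    also have "\<dots> = el (x * a + y * b) y / of_int a" unfolding el_of_int el_mult el_add by simp
    finally have c': "c = el (x * a + y * b) y / of_int a" .
    have "el (x * a + y * b) y \<in> K" by (rule el_in_K)
    then obtain r s where "el (x * a + y * b) y = of_rat r + of_rat s * (\<i> * of_real sd)" unfolding in_K_iff by blast
    then have "c = of_rat (r / of_int a) + of_rat (s / of_int a) * (\<i> * of_real sd)"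
      using a unfolding c' by (simp add: of_rat_divide field_simps)
    then show ?thesis unfolding in_K_iff by blast
  qed
  from algebraic_int_in_K[OF this alg] obtain p q where "c = el p q" by blast
  then show ?thesis using norm_eq_1_imp norm by blast
qed

text \<open>For g in an ideal J of norm a, the product of J with its conjugate lies in a R, so
  conj(g) J/a consists of ring elements. The computation in \<open>carr\<close> checks this in
  coordinates, using a v = qf(b).\<close>

lemma scale_in_class:
  assumes C: "C \<in> ideal_classes" and J: "idl 1 a b \<in> C" and a: "a > 0" and dv: "a dvd qf b" and xy: "(x, y) \<noteq> (0, 0)"
  shows "scale (cnj (el (x * a + y * b) y) / of_int a) (idl 1 a b) \<in> C"
    and "nrm (scale (cnj (el (x * a + y * b) y) / of_int a) (idl 1 a b)) = (cmod (el (x * a + y * b) y))\<^sup>2 / real_of_int a"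
proof -
  let ?J = "idl 1 a b"
  define g where "g = el (x * a + y * b) y"
  have g0: "g \<noteq> 0" using xy a unfolding g_def el_eq_0_iff by auto
  have JN: "?J \<in> nonzero_ideals R" using classes_subset[OF C] J by blast
  have c0: "cnj g / of_int a \<noteq> 0" using g0 a by simp
  have closed: "?J \<subseteq> carrier R" "0 \<in> ?J" "?J \<noteq> {0}" "\<And>u v. u \<in> ?J \<Longrightarrow> v \<in> ?J \<Longrightarrow> u + v \<in> ?J"
    "\<And>u v. u \<in> carrier R \<Longrightarrow> v \<in> ?J \<Longrightarrow> u * v \<in> ?J"
    using JN unfolding in_nonzero_ideals_iff ideal_R_iff by auto
  have carr: "cnj g / of_int a * z \<in> carrier R" if z: "z \<in> ?J" for z
  proof -
    obtain p q where pq: "z = el p q" "a dvd p - q * b" using z unfolding idl_def by auto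
    then obtain u where u: "p = a * u + q * b" by (metis dvdE diff_add_cancel)
    obtain v where v: "qf b = a * v" using dv by (auto elim: dvdE)
    have n: "b * b + tr * b + nm = a * v" using v by (simp add: qf_def)
    have "cnj g * z = el (a * (x * (a * u + q * b) + (b + tr) * y * u + v * y * q)) (a * (x * q - y * u))"
    proof -
      have "(x * a + y * b + tr * y) * (a * u + q * b) - nm * (- y) * q =
          a * (x * (a * u + q * b) + (b + tr) * y * u) + y * q * (b * b + tr * b + nm)"
        by (simp add: algebra_simps)
      also have "\<dots> = a * (x * (a * u + q * b) + (b + tr) * y * u + v * y * q)"
        unfolding n by (simp add: algebra_simps)
      finally have 1: "(x * a + y * b + tr * y) * (a * u + q * b) - nm * (- y) * q =
          a * (x * (a * u + q * b) + (b + tr) * y * u + v * y * q)" .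
      have 2: "(x * a + y * b + tr * y) * q + (- y) * (a * u + q * b) + tr * (- y) * q = a * (x * q - y * u)"
        by (simp add: algebra_simps)
      show ?thesis unfolding g_def pq(1) u cnj_el el_mult 1 2 ..
    qed
    also have "\<dots> = of_int a * el (x * (a * u + q * b) + (b + tr) * y * u + v * y * q) (x * q - y * u)"
      unfolding el_of_int el_mult by simp
    finally have "cnj g / of_int a * z = el (x * (a * u + q * b) + (b + tr) * y * u + v * y * q) (x * q - y * u)"
      using a by (simp add: field_simps)
    then show ?thesis using el_in_R by metis
  qed
  have "ideal (scale (cnj g / of_int a) ?J) R"
    unfolding ideal_R_iff
  proof (intro conjI ballI)
    show "scale (cnj g / of_int a) ?J \<subseteq> carrier R" unfolding scale_def using carr by blast
    show "0 \<in> scale (cnj g / of_int a) ?J" unfolding scale_def using closed(2) by (intro image_eqI[of _ _ 0]) auto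
  next
    fix u v assume "u \<in> scale (cnj g / of_int a) ?J" "v \<in> scale (cnj g / of_int a) ?J"
    then obtain u' v' where "u = cnj g / of_int a * u'" "v = cnj g / of_int a * v'" "u' \<in> ?J" "v' \<in> ?J"
      unfolding scale_def by blast
    then show "u + v \<in> scale (cnj g / of_int a) ?J"
      unfolding scale_def using closed(4) by (intro image_eqI[of _ _ "u' + v'"]) (simp_all add: distrib_left)
  next
    fix u v assume "u \<in> carrier R" "v \<in> scale (cnj g / of_int a) ?J"
    then obtain v' where "v = cnj g / of_int a * v'" "v' \<in> ?J" unfolding scale_def by blast
    then show "u * v \<in> scale (cnj g / of_int a) ?J"
      unfolding scale_def using closed(5) \<open>u \<in> carrier R\<close> by (intro image_eqI[of _ _ "u * v'"]) (simp_all add: mult_ac)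
  qed
  moreover have "scale (cnj g / of_int a) ?J \<noteq> {0}"
  proof
    assume s: "scale (cnj g / of_int a) ?J = {0}"
    obtain z where "z \<in> ?J" "z \<noteq> 0" using closed(2,3) by blast
    then have "cnj g / of_int a * z \<in> {0}" unfolding s[symmetric] scale_def by blast
    then show False using \<open>z \<noteq> 0\<close> c0 by simp
  qed
  ultimately have "scale (cnj g / of_int a) ?J \<in> nonzero_ideals R" unfolding in_nonzero_ideals_iff by blast
  then show "scale (cnj (el (x * a + y * b) y) / of_int a) ?J \<in> C"
    unfolding class_mem_iff[OF C J] g_def[symmetric] using c0 by blast
  have "nrm (scale (cnj g / of_int a) ?J) = (cmod (cnj g / of_int a))\<^sup>2 * real_of_int (1 * 1 * a)"
    unfolding nrm_scale[OF JN c0] nrm_idl[OF zero_less_one a] ..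
  also have "\<dots> = (cmod g)\<^sup>2 / real_of_int a"
    using a by (simp add: norm_divide power_divide power2_eq_square)
  finally show "nrm (scale (cnj (el (x * a + y * b) y) / of_int a) ?J) = (cmod (el (x * a + y * b) y))\<^sup>2 / real_of_int a"
    unfolding g_def .
qed

text \<open>If c J is an ideal, its elements c a = p + q \<omega> and c (b + \<omega>) = r + s
  \<omega> satisfy (c a) (b + \<omega>) = a (r + s \<omega>). The \<omega>-coordinate gives p + tr q
  = s a - q b, which puts the conjugate of c a into J with coordinates x = s, y = -q.\<close>

lemma class_mem_eq_scale:
  assumes C: "C \<in> ideal_classes" and J: "idl 1 a b \<in> C" and a: "a > 0" and I: "I \<in> C"
  obtains x y where "(x, y) \<noteq> (0, 0)" "I = scale (cnj (el (x * a + y * b) y) / of_int a) (idl 1 a b)"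
proof -
  let ?J = "idl 1 a b"
  obtain c where c: "c \<noteq> 0" "I = scale c ?J" using I unfolding class_mem_iff[OF C J] by blast
  have "I \<in> nonzero_ideals R" using classes_subset[OF C] I by blast
  then have "I \<subseteq> carrier R" unfolding in_nonzero_ideals_iff ideal_R_iff by blast
  then have carr: "c * z \<in> carrier R" if "z \<in> ?J" for z using that c unfolding scale_def by blast
  have gens: "el a 0 \<in> ?J" "el b 1 \<in> ?J" unfolding el_in_idl by simp_all
  obtain p q where pq: "c * el a 0 = el p q" using carr[OF gens(1)] unfolding carrier_R by blast
  obtain r s where rs: "c * el b 1 = el r s" using carr[OF gens(2)] unfolding carrier_R by blast
  have "el p q * el b 1 = el a 0 * el r s" unfolding pq[symmetric] rs[symmetric] by (simp add: mult_ac)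
  then have "p + q * b + tr * q = a * s" unfolding el_mult el_eq_iff by (simp add: algebra_simps)
  then have px: "p + tr * q = s * a + (- q) * b" by (simp add: algebra_simps)
  have "cnj (el (s * a + (- q) * b) (- q)) = el p q"
    unfolding px[symmetric] cnj_el[symmetric] by simp
  then have ca: "c = cnj (el (s * a + (- q) * b) (- q)) / of_int a"
    using pq a unfolding el_of_int[symmetric] by (simp add: field_simps)
  moreover have "(s, - q) \<noteq> (0, 0)"
  proof
    assume "(s, - q) = (0, 0)"
    then show False using ca c(1) by (simp add: el_0)
  qed
  ultimately show ?thesis using that c(2) by metis
qed

lemma card_fibers:
  assumes "finite T" "\<phi> ` S = T" "\<And>t. t \<in> T \<Longrightarrow> finite {s \<in> S. \<phi> s = t} \<and> card {s \<in> S. \<phi> s = t} = n"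
  shows "finite S \<and> card S = n * card T"
proof -
  have S: "S = (\<Union>t\<in>T. {s \<in> S. \<phi> s = t})" using assms(2) by auto
  have "card (\<Union>t\<in>T. {s \<in> S. \<phi> s = t}) = (\<Sum>t\<in>T. card {s \<in> S. \<phi> s = t})"
    using assms by (intro card_UN_disjoint) auto
  also have "\<dots> = n * card T" using assms(3) by simp
  finally show ?thesis using S assms by (metis (no_types, lifting) finite_UN_I)
qed

text \<open>The vectors of an ideal \<open>J\<close> of norm \<open>a\<close> correspond two-to-one to the ideals in its class: \<open>\<beta> \<in> J\<close>
  is sent to \<open>\<beta> J\<^sup>-\<^sup>1\<close> conjugated, of norm \<open>N(\<beta>)/a\<close>, which is the value of the form of \<open>J\<close>.\<close>

lemma class_form:
  assumes C: "C \<in> ideal_classes"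
  obtains a b c where "a > 0" "b\<^sup>2 - 4 * a * c = - d" "3 * a\<^sup>2 \<le> d" "a \<le> c" "\<exists>t. idl 1 a t \<in> C \<and> b = 2 * t + tr"
    "\<And>N. N > 0 \<Longrightarrow> finite {(x, y). a * x\<^sup>2 + b * x * y + c * y\<^sup>2 = int N} \<and>
      card {(x, y). a * x\<^sup>2 + b * x * y + c * y\<^sup>2 = int N} = 2 * card {I \<in> C. nrm I = real N}"
proof -
  from class_has_minimal_ideal[OF C] obtain a b where
    a: "a > 0" and dv: "a dvd qf b" and J: "idl 1 a b \<in> C" and red: "\<bar>2 * b + tr\<bar> \<le> a"
    and min: "\<And>I. I \<in> C \<Longrightarrow> real_of_int a \<le> nrm I" by metis
  let ?J = "idl 1 a b"
  define B where "B = 2 * b + tr"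
  obtain c where c: "qf b = a * c" using dv by (auto elim: dvdE)
  define \<psi> where "\<psi> = (\<lambda>(x, y). scale (cnj (el (x * a + y * b) y) / of_int a) ?J)"
  have normQ: "(cmod (el (x * a + y * b) y))\<^sup>2 / real_of_int a = real_of_int (a * x\<^sup>2 + B * x * y + c * y\<^sup>2)" for x y
  proof -
    have "a * a * x * x + a * (2 * b + tr) * x * y + qf b * y * y = a * (a * x\<^sup>2 + B * x * y + c * y\<^sup>2)"
      unfolding c B_def by (simp add: algebra_simps power2_eq_square)
    then show ?thesis unfolding norm_in_idl using a by simp
  qed
  have psi: "\<psi> (x, y) \<in> C" "nrm (\<psi> (x, y)) = real_of_int (a * x\<^sup>2 + B * x * y + c * y\<^sup>2)" if "(x, y) \<noteq> (0, 0)" for x y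
    using scale_in_class[OF C J a dv that] unfolding \<psi>_def normQ by simp_all
  have disc: "B\<^sup>2 - 4 * a * c = - d"
    using four_qf[of b] unfolding c B_def by (simp add: power2_eq_square)
  \<comment> \<open>The value c is taken at (0, 1), so it is the norm of an ideal in the class, and
    a is the least such norm.\<close>
  have ac: "a \<le> c"
  proof -
    have "real_of_int a \<le> real_of_int (a * 0\<^sup>2 + B * 0 * 1 + c * 1\<^sup>2)"
      using min[OF psi(1)[of 0 1]] psi(2)[of 0 1] by simp
    then show ?thesis by simp
  qed
  \<comment> \<open>Reducedness bounds the leading coefficient: d = 4 a c - B^2 \<ge> 3 a^2.\<close>
  have "B\<^sup>2 \<le> a\<^sup>2" using red unfolding B_def[symmetric] by (metis abs_le_square_iff abs_of_pos a)
  moreover have "a * a \<le> a * c" using a ac by (intro mult_left_mono) auto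
  ultimately have a3: "3 * a\<^sup>2 \<le> d" using disc by (simp add: power2_eq_square)
  have count: "finite {(x, y). a * x\<^sup>2 + B * x * y + c * y\<^sup>2 = int N} \<and>
      card {(x, y). a * x\<^sup>2 + B * x * y + c * y\<^sup>2 = int N} = 2 * card {I \<in> C. nrm I = real N}" if N: "N > 0" for N
  proof -
    let ?S = "{(x, y). a * x\<^sup>2 + B * x * y + c * y\<^sup>2 = int N}"
    let ?T = "{I \<in> C. nrm I = real N}"
    have S0: "(x, y) \<noteq> (0, 0)" if "(x, y) \<in> ?S" for x y using that N by auto
    have finT: "finite ?T"
      using card_nrm_eq(1)[OF N] classes_subset[OF C] by (rule_tac finite_subset) auto
    have S_iff: "(x, y) \<in> ?S \<longleftrightarrow> (x, y) \<noteq> (0, 0) \<and> nrm (\<psi> (x, y)) = real N" for x y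
    proof -
      have S_val: "(x, y) \<in> ?S \<longleftrightarrow> real_of_int (a * x\<^sup>2 + B * x * y + c * y\<^sup>2) = real N"
        using of_int_eq_iff[of "a * x\<^sup>2 + B * x * y + c * y\<^sup>2" "int N", where 'a = real] by simp
      show ?thesis
      proof (cases "(x, y) = (0, 0)")
        case True
        then show ?thesis using S0[of x y] by blast
      next
        case False
        then show ?thesis unfolding psi(2)[OF False] S_val by blast
      qed
    qed
    have img: "\<psi> ` ?S = ?T"
    proof (intro equalityI subsetI)
      fix I assume "I \<in> \<psi> ` ?S"
      then obtain x y where xy: "(x, y) \<in> ?S" "I = \<psi> (x, y)" by blast
      then show "I \<in> ?T" using S_iff psi(1) by blast
    next
      fix I assume I: "I \<in> ?T"
      then have "I \<in> C" by blast
      from class_mem_eq_scale[OF C J a this] obtain x y where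
        "(x, y) \<noteq> (0, 0)" "I = scale (cnj (el (x * a + y * b) y) / of_int a) ?J" by metis
      then have xy: "(x, y) \<noteq> (0, 0)" "I = \<psi> (x, y)" unfolding \<psi>_def by simp_all
      then have "(x, y) \<in> ?S" using I unfolding S_iff by blast
      then show "I \<in> \<psi> ` ?S" using xy(2) by blast
    qed
    \<comment> \<open>If g and g' give the same ideal, the conjugate of g'/g maps J onto itself and
      has absolute value 1, because both vectors have the value N; such a number is 1 or -1.\<close>
    have fiber: "{s \<in> ?S. \<psi> s = \<psi> (x, y)} = {(x, y), (- x, - y)}" if xy: "(x, y) \<in> ?S" for x y
    proof (intro equalityI subsetI)
      fix s assume "s \<in> {s \<in> ?S. \<psi> s = \<psi> (x, y)}"
      then obtain x' y' where s: "s = (x', y')" "(x', y') \<in> ?S" "\<psi> (x', y') = \<psi> (x, y)" by (cases s) auto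
      define g where "g = el (x * a + y * b) y"
      define g' where "g' = el (x' * a + y' * b) y'"
      have g0: "g \<noteq> 0" using S0[OF xy] a unfolding g_def el_eq_0_iff by auto
      have "(cmod g)\<^sup>2 / real_of_int a = (cmod g')\<^sup>2 / real_of_int a"
        unfolding g_def g'_def normQ using xy s(2) by simp
      then have "(cmod g)\<^sup>2 = (cmod g')\<^sup>2" using a by simp
      then have cm: "cmod g' = cmod g" by (simp add: power2_eq_iff_nonneg)
      have e: "scale (cnj g' / of_int a) ?J = scale (cnj g / of_int a) ?J"
        using s(3) unfolding \<psi>_def g_def g'_def by simp
      have "scale (cnj (g' / g)) ?J = scale (of_int a / cnj g * (cnj g' / of_int a)) ?J" using a by simp
      also have "\<dots> = scale (of_int a / cnj g * (cnj g / of_int a)) ?J" unfolding scale_scale[symmetric] e ..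
      also have "of_int a / cnj g * (cnj g / of_int a) = 1" using a g0 by simp
      also have "scale 1 ?J = ?J" by (simp add: scale_def)
      finally have "scale (cnj (g' / g)) ?J = ?J" .
      moreover have "cmod (cnj (g' / g)) = 1" using cm g0 by (simp add: norm_divide)
      ultimately have "cnj (g' / g) = 1 \<or> cnj (g' / g) = -1" by (rule unit_of_idl[OF a dv])
      then have "g' / g = 1 \<or> g' / g = -1" by (metis complex_cnj_cnj complex_cnj_one complex_cnj_minus)
      then have "g' = g \<or> g' = - g" using g0 by (auto simp: field_simps)
      then show "s \<in> {(x, y), (- x, - y)}"
      proof
        assume "g' = g"
        then have "x' * a = x * a" "y' = y" unfolding g_def g'_def el_eq_iff by auto
        then show ?thesis using a s(1) by simp
      next
        assume "g' = - g"
        then have "x' * a = (- x) * a" "y' = - y" unfolding g_def g'_def el_minus el_eq_iff by auto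
        then have "x' = - x" using mult_right_cancel[of a x' "- x"] a by (metis less_irrefl)
        then show ?thesis using s(1) \<open>y' = - y\<close> by simp
      qed
    next
      fix s assume s: "s \<in> {(x, y), (- x, - y)}"
      have "(- x, - y) \<in> ?S" using xy by simp
      moreover have "\<psi> (- x, - y) = \<psi> (x, y)"
      proof -
        have sc: "scale (- z) ?J = scale z ?J" for z
        proof -
          have neg: "- u \<in> ?J" if "u \<in> ?J" for u
          proof -
            have "?J \<in> nonzero_ideals R" using classes_subset[OF C] J by blast
            then have "\<forall>w\<in>carrier R. \<forall>v\<in>?J. w * v \<in> ?J"
              unfolding in_nonzero_ideals_iff ideal_R_iff by (elim conjE)
            then have "el (-1) 0 * u \<in> ?J" using that el_in_R by (elim ballE) auto
            then show ?thesis by (simp add: el_def)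
          qed
          have "scale (- w) ?J \<subseteq> scale w ?J" for w
          proof
            fix u assume "u \<in> scale (- w) ?J"
            then obtain v where "v \<in> ?J" "u = - w * v" unfolding scale_def by blast
            then have "- v \<in> ?J" "u = w * (- v)" using neg by simp_all
            then show "u \<in> scale w ?J" unfolding scale_def by blast
          qed
          from this[of z] this[of "- z"] show ?thesis by simp
        qed
        have el_neg: "el (- x * a + - y * b) (- y) = - el (x * a + y * b) y"
          unfolding el_minus el_eq_iff by simp
        show ?thesis
          unfolding \<psi>_def prod.case el_neg complex_cnj_minus minus_divide_left[symmetric] by (rule sc)
      qed
      ultimately show "s \<in> {s \<in> ?S. \<psi> s = \<psi> (x, y)}" using s xy by blast
    qed
    have "finite {s \<in> ?S. \<psi> s = t} \<and> card {s \<in> ?S. \<psi> s = t} = 2" if "t \<in> ?T" for t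
    proof -
      have "t \<in> \<psi> ` ?S" using that unfolding img .
      then obtain x y where xy: "(x, y) \<in> ?S" "t = \<psi> (x, y)" by blast
      have "(x, y) \<noteq> (- x, - y)" using S0[OF xy(1)] by auto
      then show ?thesis unfolding xy(2) fiber[OF xy(1)] by simp
    qed
    from card_fibers[OF finT img this] show ?thesis .
  qed
  show ?thesis using that[OF a disc a3 ac _ count] J B_def by blast
qed

text \<open>One form is chosen in each class. The classes partition the nonzero ideals, so the
  numbers of ideals of norm N in the classes add up to \<open>rep N\<close>.\<close>

theorem class_forms:
  obtains A B Cc :: "complex set set \<Rightarrow> int" where
    "finite ideal_classes"
    "\<And>C. C \<in> ideal_classes \<Longrightarrow> A C > 0 \<and> (B C)\<^sup>2 - 4 * A C * Cc C = - d \<and> 3 * (A C)\<^sup>2 \<le> d \<and> A C \<le> Cc C"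
    "\<And>C N. C \<in> ideal_classes \<Longrightarrow> N > 0 \<Longrightarrow> finite {(x, y). A C * x\<^sup>2 + B C * x * y + Cc C * y\<^sup>2 = int N}"
    "\<And>N. N > 0 \<Longrightarrow> (\<Sum>C\<in>ideal_classes. card {(x, y). A C * x\<^sup>2 + B C * x * y + Cc C * y\<^sup>2 = int N}) = 2 * rep N"
proof -
  define P where "P C F \<longleftrightarrow> (case F of (a, b, c) \<Rightarrow> a > 0 \<and> b\<^sup>2 - 4 * a * c = - d \<and> 3 * a\<^sup>2 \<le> d \<and> a \<le> c \<and>
    (\<exists>t. idl 1 a t \<in> C \<and> b = 2 * t + tr) \<and>
    (\<forall>N>0. finite {(x, y). a * x\<^sup>2 + b * x * y + c * y\<^sup>2 = int N} \<and>
      card {(x, y). a * x\<^sup>2 + b * x * y + c * y\<^sup>2 = int N} = 2 * card {I \<in> C. nrm I = real N}))" for C F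
  have "\<forall>C\<in>ideal_classes. \<exists>F. P C F"
  proof
    fix C assume C: "C \<in> ideal_classes"
    show "\<exists>F. P C F"
    proof (rule class_form[OF C])
      fix a b c :: int
      assume "a > 0" "b\<^sup>2 - 4 * a * c = - d" "3 * a\<^sup>2 \<le> d" "a \<le> c" "\<exists>t. idl 1 a t \<in> C \<and> b = 2 * t + tr"
        "\<And>N. N > 0 \<Longrightarrow> finite {(x, y). a * x\<^sup>2 + b * x * y + c * y\<^sup>2 = int N} \<and>
          card {(x, y). a * x\<^sup>2 + b * x * y + c * y\<^sup>2 = int N} = 2 * card {I \<in> C. nrm I = real N}"
      then have "P C (a, b, c)" unfolding P_def prod.case by (intro conjI allI impI) simp_all
      then show ?thesis by blast
    qed
  qed
  from bchoice[OF this] obtain F where F: "\<And>C. C \<in> ideal_classes \<Longrightarrow> P C (F C)" by blast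
  define A where "A C = fst (F C)" for C
  define B where "B C = fst (snd (F C))" for C
  define Cc where "Cc C = snd (snd (F C))" for C
  have props: "A C > 0 \<and> (B C)\<^sup>2 - 4 * A C * Cc C = - d \<and> 3 * (A C)\<^sup>2 \<le> d \<and> A C \<le> Cc C \<and>
    (\<exists>t. idl 1 (A C) t \<in> C \<and> B C = 2 * t + tr) \<and>
    (\<forall>N>0. finite {(x, y). A C * x\<^sup>2 + B C * x * y + Cc C * y\<^sup>2 = int N} \<and>
      card {(x, y). A C * x\<^sup>2 + B C * x * y + Cc C * y\<^sup>2 = int N} = 2 * card {I \<in> C. nrm I = real N})"
    if "C \<in> ideal_classes" for C
    using F[OF that] unfolding P_def A_def B_def Cc_def by (simp add: case_prod_beta)
  have disj: "C \<inter> C' = {}" if "C \<in> ideal_classes" "C' \<in> ideal_classes" "C \<noteq> C'" for C C'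
    using that quotient_disj[OF equiv_rel] unfolding ideal_classes_def by blast
  \<comment> \<open>Every class contains an ideal Z a + Z (b + \<omega>) with 0 \<le> b < a \<le> d,
    and disjoint classes cannot share one.\<close>
  have finite: "finite ideal_classes"
  proof -
    have fin: "finite {(a, b). 0 < a \<and> a \<le> d \<and> 0 \<le> b \<and> b < a}"
      by (rule finite_subset[of _ "{0..d} \<times> {0..d}"]) auto
    define Q where "Q C ab \<longleftrightarrow> ab \<in> {(a, b). 0 < a \<and> a \<le> d \<and> 0 \<le> b \<and> b < a} \<and> (case ab of (a, b) \<Rightarrow> idl 1 a b \<in> C)" for C ab
    have "\<exists>ab. Q C ab" if C: "C \<in> ideal_classes" for C
    proof -
      obtain t where t: "A C > 0" "3 * (A C)\<^sup>2 \<le> d" "idl 1 (A C) t \<in> C" using props[OF C] by blast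
      have "A C * 1 \<le> A C * A C" using t(1) by (intro mult_left_mono) auto
      then have "A C \<le> d" using t(2) t(1) unfolding power2_eq_square by linarith
      moreover have "idl 1 (A C) (t mod A C) = idl 1 (A C) t"
        using idl_shift[of "A C" "t mod A C" "t div A C"] by (simp add: mult.commute)
      ultimately show ?thesis using t unfolding Q_def by (intro exI[of _ "(A C, t mod A C)"]) simp
    qed
    then have "\<forall>C\<in>ideal_classes. \<exists>ab. Q C ab" by blast
    from bchoice[OF this] obtain f where f: "\<And>C. C \<in> ideal_classes \<Longrightarrow> Q C (f C)" by blast
    have "inj_on f ideal_classes"
    proof (rule inj_onI)
      fix C C' assume CC: "C \<in> ideal_classes" "C' \<in> ideal_classes" "f C = f C'"
      obtain a b where ab: "f C = (a, b)" by (cases "f C")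
      have "idl 1 a b \<in> C" "idl 1 a b \<in> C'" using f[OF CC(1)] f[OF CC(2)] CC(3) ab unfolding Q_def by auto
      then show "C = C'" using disj CC by blast
    qed
    moreover have "finite (f ` ideal_classes)"
    proof (rule finite_subset[OF image_subsetI fin])
      fix C assume "C \<in> ideal_classes"
      from f[OF this] show "f C \<in> {(a, b). 0 < a \<and> a \<le> d \<and> 0 \<le> b \<and> b < a}"
        unfolding Q_def by (rule conjunct1)
    qed
    ultimately show ?thesis by (rule finite_imageD[rotated])
  qed
  have count: "(\<Sum>C\<in>ideal_classes. card {(x, y). A C * x\<^sup>2 + B C * x * y + Cc C * y\<^sup>2 = int N}) = 2 * rep N" if N: "N > 0" for N
  proof -
    have "(\<Sum>C\<in>ideal_classes. card {(x, y). A C * x\<^sup>2 + B C * x * y + Cc C * y\<^sup>2 = int N}) =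
        (\<Sum>C\<in>ideal_classes. 2 * card {I \<in> C. nrm I = real N})"
      using props N by (intro sum.cong) auto
    also have "\<dots> = 2 * (\<Sum>C\<in>ideal_classes. card {I \<in> C. nrm I = real N})" by (rule sum_distrib_left[symmetric])
    also have "(\<Sum>C\<in>ideal_classes. card {I \<in> C. nrm I = real N}) = card (\<Union>C\<in>ideal_classes. {I \<in> C. nrm I = real N})"
    proof (rule card_UN_disjoint[symmetric, OF finite])
      show "\<forall>C\<in>ideal_classes. finite {I \<in> C. nrm I = real N}"
      proof
        fix C assume "C \<in> ideal_classes"
        from classes_subset[OF this] show "finite {I \<in> C. nrm I = real N}"
          by (intro finite_subset[OF _ card_nrm_eq(1)[OF N]]) auto
      qed
      show "\<forall>C\<in>ideal_classes. \<forall>C'\<in>ideal_classes. C \<noteq> C' \<longrightarrow> {I \<in> C. nrm I = real N} \<inter> {I \<in> C'. nrm I = real N} = {}"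
        using disj by blast
    qed
    also have "(\<Union>C\<in>ideal_classes. {I \<in> C. nrm I = real N}) = {I \<in> nonzero_ideals R. nrm I = real N}"
    proof -
      have "\<Union>ideal_classes = nonzero_ideals R" unfolding ideal_classes_def by (rule Union_quotient[OF equiv_rel])
      then show ?thesis by blast
    qed
    also have "card \<dots> = rep N" by (rule card_nrm_eq(2)[OF N])
    finally show ?thesis .
  qed
  show ?thesis
  proof (rule that[OF finite _ _ count])
    show "A C > 0 \<and> (B C)\<^sup>2 - 4 * A C * Cc C = - d \<and> 3 * (A C)\<^sup>2 \<le> d \<and> A C \<le> Cc C" if "C \<in> ideal_classes" for C
      using props[OF that] by blast
    show "finite {(x, y). A C * x\<^sup>2 + B C * x * y + Cc C * y\<^sup>2 = int N}" if "C \<in> ideal_classes" "N > 0" for C N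
      using props[OF that(1)] that(2) by blast
  qed
qed

end

section \<open>Counting the values of a definite binary form\<close>

lemma card_ints_between:
  fixes u v :: real
  assumes "u \<le> v"
  shows "finite {x :: int. u \<le> of_int x \<and> of_int x \<le> v}"
    and "real (card {x :: int. u \<le> of_int x \<and> of_int x \<le> v}) \<le> v - u + 1"
    and "real (card {x :: int. u \<le> of_int x \<and> of_int x \<le> v}) \<ge> v - u - 1"
proof -
  have eq: "{x :: int. u \<le> of_int x \<and> of_int x \<le> v} = {\<lceil>u\<rceil>..\<lfloor>v\<rfloor>}"
    by (auto simp: ceiling_le_iff le_floor_iff)
  show "finite {x :: int. u \<le> of_int x \<and> of_int x \<le> v}" unfolding eq by simp
  have c: "real (card {\<lceil>u\<rceil>..\<lfloor>v\<rfloor>}) = real (nat (\<lfloor>v\<rfloor> - \<lceil>u\<rceil> + 1))" by simp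
  show "real (card {x :: int. u \<le> of_int x \<and> of_int x \<le> v}) \<le> v - u + 1"
    "real (card {x :: int. u \<le> of_int x \<and> of_int x \<le> v}) \<ge> v - u - 1"
    unfolding eq c using assms by linarith+
qed

text \<open>An antiderivative of \<open>x \<mapsto> \<surd>(T\<^sup>2 - x\<^sup>2)\<close>.\<close>

definition circle_area :: "real \<Rightarrow> real \<Rightarrow> real" where
  "circle_area T x = (x * sqrt (T\<^sup>2 - x\<^sup>2) + T\<^sup>2 * arcsin (x / T)) / 2"

lemma circle_area_has_derivative:
  assumes "T > 0" "- T < x" "x < T"
  shows "(circle_area T has_real_derivative sqrt (T\<^sup>2 - x\<^sup>2)) (at x)"
proof -
  have "\<bar>x\<bar> < T" using assms by auto
  then have "\<bar>x\<bar>\<^sup>2 < T\<^sup>2" by (intro power_strict_mono) auto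
  then have pos: "T\<^sup>2 - x\<^sup>2 > 0" by simp
  define s where "s = sqrt (T\<^sup>2 - x\<^sup>2)"
  have s: "s > 0" "s * s = T\<^sup>2 - x\<^sup>2" using pos by (simp_all add: s_def)
  have xT: "- 1 < x / T" "x / T < 1" using assms by (auto simp: field_simps)
  have "sqrt (1 - (x / T)\<^sup>2) = s / T"
  proof -
    have "1 - (x / T)\<^sup>2 = (T\<^sup>2 - x\<^sup>2) / T\<^sup>2" using assms by (simp add: field_simps)
    then show ?thesis using assms by (simp add: s_def real_sqrt_divide)
  qed
  then have D2: "((\<lambda>x. arcsin (x / T)) has_real_derivative inverse (s / T) * (1 / T)) (at x)"
    using xT assms DERIV_arcsin[of "x / T"]
    by (intro DERIV_chain2[where f = arcsin and g = "\<lambda>x. x / T"]) (auto intro!: derivative_eq_intros)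
  have D1: "((\<lambda>x. sqrt (T\<^sup>2 - x\<^sup>2)) has_real_derivative (- x / s)) (at x)"
  proof -
    have "((\<lambda>x. sqrt (T\<^sup>2 - x\<^sup>2)) has_real_derivative (- (2 * x)) * (inverse (sqrt (T\<^sup>2 - x\<^sup>2)) / 2)) (at x)"
      using pos by (auto intro!: derivative_eq_intros)
    then show ?thesis by (simp add: s_def field_simps)
  qed
  have D: "((\<lambda>x. (x * sqrt (T\<^sup>2 - x\<^sup>2) + T\<^sup>2 * arcsin (x / T)) / 2) has_real_derivative
      ((1 * sqrt (T\<^sup>2 - x\<^sup>2) + (- x / s) * x) + T\<^sup>2 * (inverse (s / T) * (1 / T))) / 2) (at x)"
    by (intro DERIV_cdivide DERIV_add DERIV_cmult DERIV_mult DERIV_ident D1 D2)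
  have eq: "((1 * sqrt (T\<^sup>2 - x\<^sup>2) + (- x / s) * x) + T\<^sup>2 * (inverse (s / T) * (1 / T))) / 2 = s"
  proof -
    have "((1 * s + (- x / s) * x) + T\<^sup>2 * (inverse (s / T) * (1 / T))) / 2 = (s * s + (T\<^sup>2 - x\<^sup>2)) / (2 * s)"
      using s(1) assms by (simp add: field_simps power2_eq_square)
    also have "\<dots> = s" unfolding s(2)[symmetric] using s(1) by simp
    finally show ?thesis unfolding s_def .
  qed
  show ?thesis using D unfolding eq unfolding circle_area_def[abs_def] s_def .
qed

lemma circle_area_increment:
  assumes "0 \<le> x" "x < y" "y \<le> T"
  shows "(y - x) * sqrt (T\<^sup>2 - y\<^sup>2) \<le> circle_area T y - circle_area T x"
    and "circle_area T y - circle_area T x \<le> (y - x) * sqrt (T\<^sup>2 - x\<^sup>2)"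
proof -
  have T: "T > 0" using assms by simp
  have cont: "continuous_on {x..y} (circle_area T)"
    unfolding circle_area_def[abs_def]
    using assms T by (intro continuous_intros) (auto simp: field_simps)
  have diff: "circle_area T differentiable (at z)" if "x < z" "z < y" for z
  proof -
    have "(circle_area T has_real_derivative sqrt (T\<^sup>2 - z\<^sup>2)) (at z)"
      using that assms T by (intro circle_area_has_derivative) auto
    then show ?thesis unfolding real_differentiable_def by blast
  qed
  from MVT[OF assms(2) cont diff] obtain l z where z: "x < z" "z < y" "(circle_area T has_real_derivative l) (at z)"
    "circle_area T y - circle_area T x = (y - x) * l" by blast
  have "l = sqrt (T\<^sup>2 - z\<^sup>2)"
    by (rule DERIV_unique[OF z(3) circle_area_has_derivative[OF T]]) (use z assms in auto)
  moreover have "x\<^sup>2 \<le> z\<^sup>2" "z\<^sup>2 \<le> y\<^sup>2" using z assms by (auto intro!: power_mono)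
  ultimately show "(y - x) * sqrt (T\<^sup>2 - y\<^sup>2) \<le> circle_area T y - circle_area T x"
    "circle_area T y - circle_area T x \<le> (y - x) * sqrt (T\<^sup>2 - x\<^sup>2)"
    unfolding z(4) using assms(2) by (auto intro!: mult_left_mono)
qed

lemma circle_area_mono:
  assumes "0 \<le> x" "x \<le> y" "y \<le> T"
  shows "circle_area T x \<le> circle_area T y"
proof (cases "x = y")
  case False
  have "y\<^sup>2 \<le> T\<^sup>2" using assms by (intro power_mono) auto
  then have "0 \<le> (y - x) * sqrt (T\<^sup>2 - y\<^sup>2)" using assms by simp
  then show ?thesis using circle_area_increment(1)[of x y T] assms False by linarith
qed simp

text \<open>Right and left Riemann sums of a decreasing function over a quarter disc; the left sum
  has the additional term T at y = 0.\<close>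

lemma circle_sum_bounds:
  fixes T :: real
  assumes T: "T \<ge> 0"
  shows "(\<Sum>y=1..nat \<lfloor>T\<rfloor>. sqrt (T\<^sup>2 - (real y)\<^sup>2)) \<le> pi * T\<^sup>2 / 4"
    and "pi * T\<^sup>2 / 4 - T \<le> (\<Sum>y=1..nat \<lfloor>T\<rfloor>. sqrt (T\<^sup>2 - (real y)\<^sup>2))"
proof -
  define Y where "Y = nat \<lfloor>T\<rfloor>"
  have Y: "real Y \<le> T" "T < real Y + 1" using T unfolding Y_def by linarith+
  have F0: "circle_area T 0 = 0" by (simp add: circle_area_def)
  have FT: "circle_area T T = pi * T\<^sup>2 / 4"
    by (cases "T = 0") (simp_all add: circle_area_def)
  have up: "(\<Sum>y=1..k. sqrt (T\<^sup>2 - (real y)\<^sup>2)) \<le> circle_area T (real k)" if "k \<le> Y" for k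
    using that
  proof (induction k)
    case (Suc k)
    have "(real (Suc k) - real k) * sqrt (T\<^sup>2 - (real (Suc k))\<^sup>2) \<le> circle_area T (real (Suc k)) - circle_area T (real k)"
      using Suc.prems Y by (intro circle_area_increment) auto
    then show ?case using Suc by simp
  qed (simp add: F0)
  have "circle_area T (real Y) \<le> circle_area T T" using Y by (intro circle_area_mono) auto
  then show "(\<Sum>y=1..nat \<lfloor>T\<rfloor>. sqrt (T\<^sup>2 - (real y)\<^sup>2)) \<le> pi * T\<^sup>2 / 4"
    using up[of Y] unfolding FT Y_def by simp
  have low: "circle_area T (real k) \<le> (\<Sum>y<k. sqrt (T\<^sup>2 - (real y)\<^sup>2))" if "k \<le> Y" for k
    using that
  proof (induction k)
    case (Suc k)
    have "circle_area T (real (Suc k)) - circle_area T (real k) \<le> (real (Suc k) - real k) * sqrt (T\<^sup>2 - (real k)\<^sup>2)"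
      using Suc.prems Y by (intro circle_area_increment) auto
    then show ?case using Suc by simp
  qed (simp add: F0)
  have last: "circle_area T T - circle_area T (real Y) \<le> sqrt (T\<^sup>2 - (real Y)\<^sup>2)"
  proof (cases "real Y = T")
    case False
    have "(real Y)\<^sup>2 \<le> T\<^sup>2" using Y by (intro power_mono) auto
    then have "(T - real Y) * sqrt (T\<^sup>2 - (real Y)\<^sup>2) \<le> 1 * sqrt (T\<^sup>2 - (real Y)\<^sup>2)"
      using Y by (intro mult_right_mono) auto
    then show ?thesis using circle_area_increment(2)[of "real Y" T T] Y False by simp
  qed simp
  have "{..<Suc Y} = insert 0 {1..Y}" by auto
  then have "(\<Sum>y<Suc Y. sqrt (T\<^sup>2 - (real y)\<^sup>2)) = T + (\<Sum>y=1..Y. sqrt (T\<^sup>2 - (real y)\<^sup>2))"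
    using T by simp
  then show "pi * T\<^sup>2 / 4 - T \<le> (\<Sum>y=1..nat \<lfloor>T\<rfloor>. sqrt (T\<^sup>2 - (real y)\<^sup>2))"
    using low[of Y] last unfolding FT Y_def[symmetric] by simp
qed

locale pos_form =
  fixes a b c d :: int
  assumes a_pos: "a > 0" and d_pos: "d > 0" and discriminant: "b\<^sup>2 - 4 * a * c = - d"
begin

definition Q :: "int \<Rightarrow> int \<Rightarrow> int" where "Q x y = a * x\<^sup>2 + b * x * y + c * y\<^sup>2"

lemma four_a_Q: "4 * a * Q x y = (2 * a * x + b * y)\<^sup>2 + d * y\<^sup>2"
proof -
  have "4 * a * Q x y = (2 * a * x + b * y)\<^sup>2 + (4 * a * c - b\<^sup>2) * y\<^sup>2"
    by (simp add: Q_def power2_eq_square algebra_simps)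
  moreover have "4 * a * c - b\<^sup>2 = d" using discriminant by simp
  ultimately show ?thesis by (simp only:)
qed

text \<open>The points with y < 0 mirror these under (x, y) \<mapsto> (-x, -y). The row y = 0 is
  left out since it alone can have values below d/(4a).\<close>

definition half_count :: "nat \<Rightarrow> nat" where
  "half_count N = card {(x, y). 0 < y \<and> Q x y = int N}"

definition half_sum :: "nat \<Rightarrow> nat" where
  "half_sum M = card {(x, y). 0 < y \<and> Q x y \<le> int M}"

text \<open>All solutions of \<open>Q x y \<le> M\<close> lie in the rows \<open>\<bar>y\<bar> \<le> T M\<close>.\<close>

definition T :: "nat \<Rightarrow> real" where "T M = sqrt (4 * real_of_int a * real M / real_of_int d)"

lemma T_nonneg: "T M \<ge> 0" and T_square: "(T M)\<^sup>2 = 4 * real_of_int a * real M / real_of_int d"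
  using a_pos d_pos by (simp_all add: T_def)

text \<open>Since 4 a Q = (2 a x + b y)^2 + d y^2, the row is the set of integers in an interval of
  length w centred at - b y/(2 a).\<close>

lemma row:
  fixes y :: nat
  assumes "y \<ge> 1" "real y \<le> T M"
  defines "w \<equiv> sqrt (real_of_int d) / real_of_int a * sqrt ((T M)\<^sup>2 - (real y)\<^sup>2)"
  shows "finite {x. Q x (int y) \<le> int M}" "real (card {x. Q x (int y) \<le> int M}) \<le> w + 1"
    "real (card {x. Q x (int y) \<le> int M}) \<ge> w - 1"
proof -
  have a0: "real_of_int a > 0" and d0: "real_of_int d > 0" using a_pos d_pos by auto
  have yT: "(real y)\<^sup>2 \<le> (T M)\<^sup>2" using assms by (intro power_mono) auto
  have w0: "w \<ge> 0" unfolding w_def using a0 d0 yT by simp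
  have w2: "(a * w)\<^sup>2 = 4 * real_of_int a * real M - real_of_int d * (real y)\<^sup>2"
  proof -
    have "(a * w)\<^sup>2 = real_of_int d * ((T M)\<^sup>2 - (real y)\<^sup>2)"
      unfolding w_def using a0 d0 yT by (simp add: power_mult_distrib power_divide)
    then show ?thesis unfolding T_square using d0 by (simp add: right_diff_distrib)
  qed
  define u where "u = - (real_of_int b * real y) / (2 * real_of_int a)"
  have "Q x (int y) \<le> int M \<longleftrightarrow> u - w / 2 \<le> real_of_int x \<and> real_of_int x \<le> u + w / 2" for x
  proof -
    have "Q x (int y) \<le> int M \<longleftrightarrow> 4 * a * Q x (int y) \<le> 4 * a * int M" using a_pos by simp
    also have "\<dots> \<longleftrightarrow> real_of_int ((2 * a * x + b * int y)\<^sup>2 + d * (int y)\<^sup>2) \<le> real_of_int (4 * a * int M)"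
      unfolding four_a_Q by (simp only: of_int_le_iff)
    also have "\<dots> \<longleftrightarrow> (2 * real_of_int a * real_of_int x + real_of_int b * real y)\<^sup>2 \<le> (a * w)\<^sup>2"
      unfolding w2 by (simp add: algebra_simps)
    also have "\<dots> \<longleftrightarrow> \<bar>2 * real_of_int a * real_of_int x + real_of_int b * real y\<bar> \<le> \<bar>a * w\<bar>"
      by (rule abs_le_square_iff[symmetric])
    also have "\<bar>a * w\<bar> = a * w" using a0 w0 by simp
    also have "2 * real_of_int a * real_of_int x + real_of_int b * real y = 2 * real_of_int a * (real_of_int x - u)"
      unfolding u_def using a0 by (simp add: field_simps)
    also have "\<bar>2 * real_of_int a * (real_of_int x - u)\<bar> = real_of_int a * (2 * \<bar>real_of_int x - u\<bar>)"
      unfolding abs_mult using a0 by simp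
    also have "\<dots> \<le> real_of_int a * w \<longleftrightarrow> 2 * \<bar>real_of_int x - u\<bar> \<le> w"
      by (rule mult_le_cancel_left_pos[OF a0])
    also have "\<dots> \<longleftrightarrow> u - w / 2 \<le> real_of_int x \<and> real_of_int x \<le> u + w / 2"
      by (auto simp: abs_if)
    finally show ?thesis .
  qed
  then have eq: "{x. Q x (int y) \<le> int M} = {x. u - w / 2 \<le> real_of_int x \<and> real_of_int x \<le> u + w / 2}" by simp
  have "u - w / 2 \<le> u + w / 2" using w0 by simp
  from card_ints_between[OF this] show "finite {x. Q x (int y) \<le> int M}"
    "real (card {x. Q x (int y) \<le> int M}) \<le> w + 1" "real (card {x. Q x (int y) \<le> int M}) \<ge> w - 1"
    unfolding eq by simp_all
qed

lemma region_eq: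
  "{(x, y). 0 < y \<and> Q x y \<le> int M} = (\<lambda>(y, x). (x, int y)) ` (SIGMA y:{1..nat \<lfloor>T M\<rfloor>}. {x. Q x (int y) \<le> int M})"
proof (intro equalityI subsetI)
  fix z assume "z \<in> {(x, y). 0 < y \<and> Q x y \<le> int M}"
  then obtain x y where z: "z = (x, y)" "0 < y" "Q x y \<le> int M" by auto
  have "4 * a * Q x y \<le> 4 * a * int M" using z(3) a_pos by simp
  then have "(2 * a * x + b * y)\<^sup>2 + d * y\<^sup>2 \<le> 4 * a * int M" unfolding four_a_Q .
  moreover have "0 \<le> (2 * a * x + b * y)\<^sup>2" by simp
  ultimately have "d * y\<^sup>2 \<le> 4 * a * int M" by linarith
  then have "real_of_int (d * y\<^sup>2) \<le> real_of_int (4 * a * int M)" by (simp only: of_int_le_iff)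
  then have "(real_of_int y)\<^sup>2 \<le> (T M)\<^sup>2" unfolding T_square using d_pos by (simp add: field_simps)
  then have "real_of_int y \<le> T M" using T_nonneg by (rule power2_le_imp_le)
  then have "nat y \<in> {1..nat \<lfloor>T M\<rfloor>}" using z(2) by (simp add: le_floor_iff nat_le_iff)
  moreover have "y = int (nat y)" using z(2) by simp
  ultimately show "z \<in> (\<lambda>(y, x). (x, int y)) ` (SIGMA y:{1..nat \<lfloor>T M\<rfloor>}. {x. Q x (int y) \<le> int M})"
    using z by (intro image_eqI[of _ _ "(nat y, x)"]) auto
qed auto

lemma finite_region: "finite {(x, y). 0 < y \<and> Q x y \<le> int M}"
  and half_sum_rows: "half_sum M = (\<Sum>y=1..nat \<lfloor>T M\<rfloor>. card {x. Q x (int y) \<le> int M})"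
proof -
  have fin: "finite {x. Q x (int y) \<le> int M}" if "y \<in> {1..nat \<lfloor>T M\<rfloor>}" for y
    using that T_nonneg[of M] by (intro row(1)) (auto simp: le_nat_floor nat_le_iff le_floor_iff, linarith)
  show "finite {(x, y). 0 < y \<and> Q x y \<le> int M}"
    unfolding region_eq using fin by (intro finite_imageI finite_SigmaI) auto
  have "inj_on (\<lambda>(y, x). (x, int y)) (SIGMA y:{1..nat \<lfloor>T M\<rfloor>}. {x. Q x (int y) \<le> int M})"
    by (auto simp: inj_on_def)
  then show "half_sum M = (\<Sum>y=1..nat \<lfloor>T M\<rfloor>. card {x. Q x (int y) \<le> int M})"
    unfolding half_sum_def region_eq using fin by (simp add: card_image)
qed

lemma half_sum_Suc: "half_sum (Suc M) = half_sum M + half_count (Suc M)"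
proof -
  have "{(x, y). 0 < y \<and> Q x y \<le> int (Suc M)} =
      {(x, y). 0 < y \<and> Q x y \<le> int M} \<union> {(x, y). 0 < y \<and> Q x y = int (Suc M)}" by auto
  moreover have "finite {(x, y). 0 < y \<and> Q x y = int (Suc M)}"
    by (rule finite_subset[OF _ finite_region[of "Suc M"]]) auto
  ultimately show ?thesis
    unfolding half_sum_def half_count_def using finite_region[of M] by (simp add: card_Un_disjoint disjoint_iff)
qed

lemma half_sum_0: "half_sum 0 = 0"
  unfolding half_sum_rows by (simp add: T_def)

lemma half_sum_eq: "half_sum M = (\<Sum>N=1..M. half_count N)"
  by (induction M) (simp_all add: half_sum_0 half_sum_Suc)

lemma rows_bounds:
  fixes M :: nat
  defines "Y \<equiv> nat \<lfloor>T M\<rfloor>"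
  defines "S \<equiv> (\<Sum>y=1..Y. sqrt ((T M)\<^sup>2 - (real y)\<^sup>2))"
  shows "real (half_sum M) \<le> sqrt (real_of_int d) / real_of_int a * S + T M"
    and "sqrt (real_of_int d) / real_of_int a * S - T M \<le> real (half_sum M)"
proof -
  let ?k = "sqrt (real_of_int d) / real_of_int a"
  have Y: "real Y \<le> T M" unfolding Y_def using T_nonneg[of M] by linarith
  have yT: "y \<ge> 1 \<and> real y \<le> T M" if "y \<in> {1..Y}" for y
    using that Y by (auto intro: order_trans[of "real y" "real Y"])
  have "real (half_sum M) = (\<Sum>y=1..Y. real (card {x. Q x (int y) \<le> int M}))"
    unfolding half_sum_rows Y_def by simp
  moreover have "(\<Sum>y=1..Y. real (card {x. Q x (int y) \<le> int M})) \<le> (\<Sum>y=1..Y. ?k * sqrt ((T M)\<^sup>2 - (real y)\<^sup>2) + 1)"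
    using yT row(2) by (intro sum_mono) blast
  moreover have "(\<Sum>y=1..Y. ?k * sqrt ((T M)\<^sup>2 - (real y)\<^sup>2) - 1) \<le> (\<Sum>y=1..Y. real (card {x. Q x (int y) \<le> int M}))"
    using yT row(3) by (intro sum_mono) blast
  moreover have "(\<Sum>y=1..Y. ?k * sqrt ((T M)\<^sup>2 - (real y)\<^sup>2) + 1) = ?k * S + real Y"
    "(\<Sum>y=1..Y. ?k * sqrt ((T M)\<^sup>2 - (real y)\<^sup>2) - 1) = ?k * S - real Y"
    unfolding S_def by (simp_all add: sum.distrib sum_subtractf sum_distrib_left)
  ultimately show "real (half_sum M) \<le> ?k * S + T M" "?k * S - T M \<le> real (half_sum M)" using Y by linarith+
qed

lemma area_eq: "sqrt (real_of_int d) / real_of_int a * (pi * (T M)\<^sup>2 / 4) = pi * real M / sqrt (real_of_int d)"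
proof -
  have "real_of_int d = sqrt (real_of_int d) * sqrt (real_of_int d)" using d_pos by simp
  then show ?thesis unfolding T_square using a_pos d_pos by (simp add: field_simps)
qed

text \<open>The row lengths for y = 1, 2, ... form a right Riemann sum and stay below the area of
  the half ellipse; the only error is one point for each of the at most T M rows. The lower bound
  \<open>half_sum_ge\<close> carries the factor \<surd>d/a + 1 in its error, which is harmless as it
  serves only for M tending to infinity.\<close>

theorem half_sum_le: "real (half_sum M) \<le> pi * real M / sqrt (real_of_int d) + T M"
proof -
  have "sqrt (real_of_int d) / real_of_int a * (\<Sum>y=1..nat \<lfloor>T M\<rfloor>. sqrt ((T M)\<^sup>2 - (real y)\<^sup>2)) \<le>
      sqrt (real_of_int d) / real_of_int a * (pi * (T M)\<^sup>2 / 4)"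
    using a_pos d_pos circle_sum_bounds(1)[OF T_nonneg] by (intro mult_left_mono) auto
  then show ?thesis using rows_bounds(1)[of M] unfolding area_eq by linarith
qed

theorem half_sum_ge:
  "pi * real M / sqrt (real_of_int d) - (sqrt (real_of_int d) / real_of_int a + 1) * T M \<le> real (half_sum M)"
proof -
  have "sqrt (real_of_int d) / real_of_int a * (pi * (T M)\<^sup>2 / 4 - T M) \<le>
      sqrt (real_of_int d) / real_of_int a * (\<Sum>y=1..nat \<lfloor>T M\<rfloor>. sqrt ((T M)\<^sup>2 - (real y)\<^sup>2))"
    using a_pos d_pos circle_sum_bounds(2)[OF T_nonneg] by (intro mult_left_mono) auto
  then show ?thesis using rows_bounds(2)[of M] unfolding right_diff_distrib area_eq by (simp add: distrib_right)
qed

lemma half_sum_eq_0: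
  assumes "4 * real_of_int a * real M < real_of_int d"
  shows "half_sum M = 0"
proof -
  have "(T M)\<^sup>2 < 1\<^sup>2" unfolding T_square using assms d_pos by simp
  then have "T M < 1" by (rule power2_less_imp_less) simp
  then have "nat \<lfloor>T M\<rfloor> = 0" using T_nonneg[of M] by linarith
  then show ?thesis unfolding half_sum_rows by simp
qed

lemma card_representations:
  assumes N: "N > 0" and fin: "finite {(x, y). Q x y = int N}"
  shows "card {(x, y). Q x y = int N} = 2 * (half_count N + card {x. 0 < x \<and> a * x\<^sup>2 = int N})"
proof -
  let ?U = "{(x, y). 0 < y \<and> Q x y = int N}" and ?V = "{x. 0 < x \<and> a * x\<^sup>2 = int N}"
  let ?neg = "\<lambda>(x, y). (- x, - y) :: int \<times> int" and ?z = "\<lambda>x. (x, 0) :: int \<times> int"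
  have split: "{(x, y). Q x y = int N} = (?U \<union> ?z ` ?V) \<union> ?neg ` (?U \<union> ?z ` ?V)"
  proof (intro equalityI subsetI)
    fix s assume "s \<in> {(x, y). Q x y = int N}"
    then obtain x y where s: "s = (x, y)" "Q x y = int N" by auto
    have neg: "Q (- x) (- y) = int N" using s by (simp add: Q_def)
    consider "y > 0" | "y < 0" | "y = 0" "x > 0" | "y = 0" "x < 0" | "y = 0" "x = 0" by linarith
    then show "s \<in> (?U \<union> ?z ` ?V) \<union> ?neg ` (?U \<union> ?z ` ?V)"
    proof cases
      case 2
      then have "(- x, - y) \<in> ?U" using neg by simp
      then show ?thesis unfolding s(1) by - (rule UnI2, rule image_eqI[of _ _ "(- x, - y)"], auto)
    next
      case 4
      then have "- x \<in> ?V" using s by (simp add: Q_def)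
      then show ?thesis unfolding s(1) using 4 by - (rule UnI2, rule image_eqI[of _ _ "(- x, 0)"], auto)
    next
      case 5
      then show ?thesis using s N by (simp add: Q_def)
    qed (use s in \<open>auto simp: Q_def\<close>)
  qed (auto simp: Q_def)
  have finU: "finite (?U \<union> ?z ` ?V)" by (rule finite_subset[OF _ fin]) (auto simp: Q_def)
  have dis: "(?U \<union> ?z ` ?V) \<inter> ?neg ` (?U \<union> ?z ` ?V) = {}" by auto
  have "card {(x, y). Q x y = int N} = card (?U \<union> ?z ` ?V) + card (?neg ` (?U \<union> ?z ` ?V))"
    unfolding split by (rule card_Un_disjoint[OF finU finite_imageI[OF finU] dis])
  also have "card (?neg ` (?U \<union> ?z ` ?V)) = card (?U \<union> ?z ` ?V)"
    by (rule card_image) (auto simp: inj_on_def)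
  also have "card (?U \<union> ?z ` ?V) = card ?U + card (?z ` ?V)"
    using finU by (intro card_Un_disjoint) auto
  also have "card (?z ` ?V) = card ?V" by (rule card_image) (auto simp: inj_on_def)
  finally show ?thesis by (simp add: half_count_def)
qed

end

section \<open>Partial summation at a real zero\<close>

context pos_form
begin

text \<open>A lower bound for the values \<open>Q x y\<close> with \<open>y \<noteq> 0\<close>.\<close>

definition N0 :: real where "N0 = real_of_int d / (4 * real_of_int a)"

lemma N0_pos: "N0 > 0" using a_pos d_pos by (simp add: N0_def)

lemma T_eq: "T M = N0 powr (-1/2) * real M powr (1/2)"
proof -
  have "T M = sqrt (real M / N0)" by (simp add: T_def N0_def)
  also have "\<dots> = real M powr (1/2) / N0 powr (1/2)"
    using N0_pos by (simp add: real_sqrt_divide powr_half_sqrt)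
  also have "\<dots> = N0 powr (-1/2) * real M powr (1/2)"
  proof -
    have "N0 powr (-1/2) = inverse (N0 powr (1/2))" using powr_minus[of N0 "1/2"] by simp
    moreover have "x / y = inverse y * x" for x y :: real by (simp add: divide_inverse mult.commute)
    ultimately show ?thesis by (simp only:)
  qed
  finally show ?thesis .
qed

lemma half_sum_eq_0': "real M < N0 \<Longrightarrow> half_sum M = 0"
  using half_sum_eq_0[of M] a_pos by (simp add: N0_def field_simps)

text \<open>Partial summation starting at N0, below which nothing is counted. The counting function
  is at most p t + q \<surd>t, and H is \<beta> times the integral of (p t + q \<surd>t) t^(-\<beta>
  - 1) from N0 on, in closed form. As \<beta> > 1/2, the error integral is dominated by its lower
  end, where q N0^(1/2 - \<beta>) = N0^(-\<beta>).\<close>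

theorem weighted_half_sum_le:
  fixes \<beta> :: real
  assumes \<beta>: "1/2 < \<beta>" "\<beta> < 1" and M: "N0 \<le> real M"
  shows "(\<Sum>N=1..M. real (half_count N) * real N powr (-\<beta>)) \<le>
    pi / sqrt (real_of_int d) * (real M powr (1 - \<beta>) / (1 - \<beta>) - \<beta> * N0 powr (1 - \<beta>) / (1 - \<beta>)) +
    \<beta> / (\<beta> - 1/2) * N0 powr (-\<beta>)"
proof -
  define p where "p = pi / sqrt (real_of_int d)"
  define q where "q = N0 powr (-1/2)"
  have p0: "p \<ge> 0" using d_pos by (simp add: p_def)
  have q0: "q \<ge> 0" by (simp add: q_def)
  define H where "H t = p * \<beta> * (t powr (1 - \<beta>) - N0 powr (1 - \<beta>)) / (1 - \<beta>) +
    q * \<beta> * (N0 powr (1/2 - \<beta>) - t powr (1/2 - \<beta>)) / (\<beta> - 1/2)" for t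
  have half_le: "real (half_sum k) \<le> p * real k + q * real k powr (1/2)" for k
    using half_sum_le[of k] unfolding T_eq p_def q_def by simp
  have H_deriv: "(H has_real_derivative p * \<beta> * t powr (-\<beta>) + q * \<beta> * t powr (-1/2 - \<beta>)) (at t)" if "t > 0" for t
  proof -
    have e: "1 - \<beta> - 1 = - \<beta>" "1/2 - \<beta> - 1 = -1/2 - \<beta>" by simp_all
    have d1: "((\<lambda>t. t powr (1 - \<beta>)) has_real_derivative (1 - \<beta>) * t powr (-\<beta>)) (at t)"
      using has_real_derivative_powr[OF that, of "1 - \<beta>"] unfolding e .
    have d2: "((\<lambda>t. t powr (1/2 - \<beta>)) has_real_derivative (1/2 - \<beta>) * t powr (-1/2 - \<beta>)) (at t)"
      using has_real_derivative_powr[OF that, of "1/2 - \<beta>"] unfolding e .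
    have D: "((\<lambda>t. p * \<beta> * (t powr (1 - \<beta>) - N0 powr (1 - \<beta>)) / (1 - \<beta>) +
        q * \<beta> * (N0 powr (1/2 - \<beta>) - t powr (1/2 - \<beta>)) / (\<beta> - 1/2)) has_real_derivative
        p * \<beta> * ((1 - \<beta>) * t powr (-\<beta>) - 0) / (1 - \<beta>) + q * \<beta> * (0 - (1/2 - \<beta>) * t powr (-1/2 - \<beta>)) / (\<beta> - 1/2)) (at t)"
      by (intro DERIV_add DERIV_cdivide DERIV_cmult DERIV_diff DERIV_const d1 d2)
    have e1: "p * \<beta> * ((1 - \<beta>) * t powr (-\<beta>) - 0) / (1 - \<beta>) = p * \<beta> * t powr (-\<beta>)"
      using \<beta> by simp
    have e2: "q * \<beta> * (0 - (1/2 - \<beta>) * t powr (-1/2 - \<beta>)) / (\<beta> - 1/2) = q * \<beta> * t powr (-1/2 - \<beta>)"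
    proof -
      have "0 - (1/2 - \<beta>) * t powr (-1/2 - \<beta>) = (\<beta> - 1/2) * t powr (-1/2 - \<beta>)" by (simp add: algebra_simps)
      then show ?thesis using \<beta> by simp
    qed
    show ?thesis using D unfolding e1 e2 unfolding H_def[abs_def] .
  qed
  \<comment> \<open>The left side is s times the integral of \<beta> t^(-\<beta> - 1) over [x, y];
    comparison with H' works because the majorant increases and already exceeds the constant s at
    x.\<close>
  have step: "s * (x powr (-\<beta>) - y powr (-\<beta>)) \<le> H y - H x"
    if "0 < x" "x \<le> y" "0 \<le> s" "s \<le> p * x + q * x powr (1/2)" for s x y
  proof -
    have "H x + s * x powr (-\<beta>) \<le> H y + s * y powr (-\<beta>)"
    proof (rule DERIV_nonneg_imp_nondecreasing[OF that(2)])
      fix t assume t: "x \<le> t" "t \<le> y"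
      then have t0: "t > 0" using that by simp
      have "((\<lambda>t. H t + s * t powr (-\<beta>)) has_real_derivative
          (p * \<beta> * t powr (-\<beta>) + q * \<beta> * t powr (-1/2 - \<beta>)) + s * ((-\<beta>) * t powr (-\<beta> - 1))) (at t)"
        by (intro DERIV_add DERIV_cmult H_deriv[OF t0] has_real_derivative_powr[OF t0])
      moreover have "0 \<le> (p * \<beta> * t powr (-\<beta>) + q * \<beta> * t powr (-1/2 - \<beta>)) + s * ((-\<beta>) * t powr (-\<beta> - 1))"
      proof -
        have e: "t powr (-\<beta>) = t powr (-\<beta> - 1) * t" "t powr (-1/2 - \<beta>) = t powr (-\<beta> - 1) * t powr (1/2)"
        proof -
          have "-\<beta> = (-\<beta> - 1) + 1" "-1/2 - \<beta> = (-\<beta> - 1) + 1/2" by simp_all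
          then show "t powr (-\<beta>) = t powr (-\<beta> - 1) * t" "t powr (-1/2 - \<beta>) = t powr (-\<beta> - 1) * t powr (1/2)"
            using t0 powr_add[of t "-\<beta> - 1" 1] powr_add[of t "-\<beta> - 1" "1/2"] by (metis powr_one order_less_imp_le)+
        qed
        have "x powr (1/2) \<le> t powr (1/2)" using t that by (intro powr_mono2) auto
        then have "p * x + q * x powr (1/2) \<le> p * t + q * t powr (1/2)"
          using p0 q0 t by (intro add_mono mult_left_mono) auto
        then have "0 \<le> \<beta> * t powr (-\<beta> - 1) * (p * t + q * t powr (1/2) - s)"
          using that(4) \<beta> by (intro mult_nonneg_nonneg) auto
        then show ?thesis unfolding e by (simp add: algebra_simps)
      qed
      ultimately show "\<exists>D. ((\<lambda>t. H t + s * t powr (-\<beta>)) has_real_derivative D) (at t) \<and> 0 \<le> D" by blast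
    qed
    then show ?thesis by (simp add: algebra_simps)
  qed
  have H_nonneg: "0 \<le> H t" if "N0 \<le> t" for t
    using step[OF N0_pos that, of 0] p0 q0 N0_pos by (simp add: H_def)
  define W where "W k = (\<Sum>N=1..k. real (half_count N) * real N powr (-\<beta>))" for k
  have W0: "W k = 0" if "real k < N0" for k
  proof -
    have "half_count N = 0" if "N \<in> {1..k}" for N
      using half_sum_eq_0'[OF \<open>real k < N0\<close>] that unfolding half_sum_eq by simp
    then show ?thesis by (simp add: W_def)
  qed
  have main: "W k - real (half_sum k) * real k powr (-\<beta>) \<le> H (real k)" if "N0 \<le> real k" for k
    using that
  proof (induction k)
    case 0
    then show ?case using N0_pos by simp
  next
    case (Suc k)
    have eq: "W (Suc k) - real (half_sum (Suc k)) * real (Suc k) powr (-\<beta>) =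
        (W k - real (half_sum k) * real k powr (-\<beta>)) + real (half_sum k) * (real k powr (-\<beta>) - real (Suc k) powr (-\<beta>))"
      by (simp add: W_def half_sum_Suc algebra_simps)
    show ?case
    proof (cases "N0 \<le> real k")
      case True
      then have "0 < real k" using N0_pos by linarith
      then have "real (half_sum k) * (real k powr (-\<beta>) - real (Suc k) powr (-\<beta>)) \<le> H (real (Suc k)) - H (real k)"
        using half_le[of k] by (intro step) auto
      then show ?thesis using Suc.IH[OF True] unfolding eq by linarith
    next
      \<comment> \<open>At the first integer beyond N0 there is no previous case to rely on: the
        sums up to k are empty and H is nonnegative.\<close>
      case False
      then have "W k = 0" "half_sum k = 0" using W0 half_sum_eq_0' by auto
      then show ?thesis using H_nonneg[OF Suc.prems] unfolding eq by simp
    qed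
  qed
  have M0: "real M > 0" using M N0_pos by linarith
  have "real (half_sum M) * real M powr (-\<beta>) \<le> (p * real M + q * real M powr (1/2)) * real M powr (-\<beta>)"
    by (intro mult_right_mono half_le) auto
  also have "\<dots> = p * real M powr (1 - \<beta>) + q * real M powr (1/2 - \<beta>)"
    using M0 powr_add[of "real M" 1 "-\<beta>"] powr_add[of "real M" "1/2" "-\<beta>"] by (simp add: algebra_simps)
  finally have "W M \<le> p * real M powr (1 - \<beta>) + q * real M powr (1/2 - \<beta>) + H (real M)"
    using main[OF M] by linarith
  also have "\<dots> = p * (real M powr (1 - \<beta>) / (1 - \<beta>) - \<beta> * N0 powr (1 - \<beta>) / (1 - \<beta>)) +
      \<beta> / (\<beta> - 1/2) * (q * N0 powr (1/2 - \<beta>)) - (\<beta> / (\<beta> - 1/2) - 1) * (q * real M powr (1/2 - \<beta>))"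
  proof -
    have 1: "p * x + p * \<beta> * (x - y) / (1 - \<beta>) = p * (x / (1 - \<beta>) - \<beta> * y / (1 - \<beta>))" for x y
    proof -
      define v where "v = 1 / (1 - \<beta>)"
      have bv: "\<beta> * v = v - 1" using \<beta> by (simp add: v_def field_simps)
      have e: "p * \<beta> * (x - y) / (1 - \<beta>) = p * (\<beta> * v) * (x - y)" "x / (1 - \<beta>) = x * v"
        "\<beta> * y / (1 - \<beta>) = (\<beta> * v) * y"
        by (simp_all add: v_def)
      show ?thesis unfolding e bv by (simp add: algebra_simps)
    qed
    have 2: "q * x + q * \<beta> * (y - x) / (\<beta> - 1/2) = \<beta> / (\<beta> - 1/2) * (q * y) - (\<beta> / (\<beta> - 1/2) - 1) * (q * x)" for x y
    proof -
      define u where "u = \<beta> / (\<beta> - 1/2)"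
      have "q * \<beta> * (y - x) / (\<beta> - 1/2) = u * (q * (y - x))" by (simp add: u_def)
      then show ?thesis unfolding u_def[symmetric] by (simp add: algebra_simps)
    qed
    show ?thesis unfolding H_def using 1[of "real M powr (1 - \<beta>)" "N0 powr (1 - \<beta>)"]
      2[of "real M powr (1/2 - \<beta>)" "N0 powr (1/2 - \<beta>)"] by linarith
  qed
  also have "\<dots> \<le> p * (real M powr (1 - \<beta>) / (1 - \<beta>) - \<beta> * N0 powr (1 - \<beta>) / (1 - \<beta>)) +
      \<beta> / (\<beta> - 1/2) * (q * N0 powr (1/2 - \<beta>))"
  proof -
    have "1 \<le> \<beta> / (\<beta> - 1/2)" using \<beta> by (simp add: le_divide_eq)
    then have "0 \<le> (\<beta> / (\<beta> - 1/2) - 1) * (q * real M powr (1/2 - \<beta>))" using q0 by simp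
    then show ?thesis by linarith
  qed
  also have "q * N0 powr (1/2 - \<beta>) = N0 powr (-\<beta>)"
    unfolding q_def powr_add[symmetric] by simp
  finally show ?thesis unfolding W_def p_def .
qed

end

section \<open>Elementary estimates for sums of the divisor function\<close>

lemma harmonic_le_ln:
  assumes "k \<ge> 1"
  shows "(\<Sum>m=1..k. 1 / real m) \<le> 1 + ln (real k)"
  using assms
proof (induction k rule: dec_induct)
  case (step k)
  have "ln (real k / real (Suc k)) \<le> real k / real (Suc k) - 1"
    using step by (intro ln_le_minus_one) auto
  moreover have "ln (real k / real (Suc k)) = ln (real k) - ln (real (Suc k))"
    using step by (simp add: ln_div)
  moreover have "real k / real (Suc k) - 1 = - (1 / real (Suc k))" by (simp add: field_simps)
  ultimately have "1 / real (Suc k) \<le> ln (real (Suc k)) - ln (real k)" by linarith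
  then show ?case using step by simp
qed simp

lemma sum_divisors_swap:
  fixes f :: "nat \<Rightarrow> nat \<Rightarrow> real"
  shows "(\<Sum>N=1..Y. \<Sum>e | e dvd N. f e (N div e)) = (\<Sum>e=1..Y. \<Sum>m=1..Y div e. f e m)"
proof -
  have "{(e, m). 1 \<le> e \<and> 1 \<le> m \<and> e * m \<le> Y} = (SIGMA e:{1..Y}. {1..Y div e})" (is "?L = ?R")
  proof (intro equalityI subsetI)
    fix z assume "z \<in> ?L"
    then obtain e m where z: "z = (e, m)" "1 \<le> e" "1 \<le> m" "e * m \<le> Y" by auto
    have "e \<le> e * m" using z by simp
    then have "e \<le> Y" using z(4) by linarith
    then show "z \<in> ?R" using z by (simp add: less_eq_div_iff_mult_less_eq mult.commute)
  qed (auto simp: less_eq_div_iff_mult_less_eq mult.commute)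
  then show ?thesis unfolding sum_divisor_pairs by (simp add: sum.Sigma)
qed

lemma sum_divisor_count_le:
  assumes "Y \<ge> 1"
  shows "(\<Sum>N=1..Y. real (card {e. e dvd N})) \<le> real Y * (1 + ln (real Y))"
proof -
  have "(\<Sum>N=1..Y. real (card {e. e dvd N})) = (\<Sum>e=1..Y. real (Y div e))"
    using sum_divisors_swap[of "\<lambda>e m. 1" Y] by simp
  also have "\<dots> \<le> (\<Sum>e=1..Y. real Y * (1 / real e))"
  proof (rule sum_mono)
    fix e assume "e \<in> {1..Y}"
    show "real (Y div e) \<le> real Y * (1 / real e)" using of_nat_div_le_of_nat[of Y e, where 'a = real] by simp
  qed
  also have "\<dots> = real Y * (\<Sum>e=1..Y. 1 / real e)" by (rule sum_distrib_left[symmetric])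
  also have "\<dots> \<le> real Y * (1 + ln (real Y))" by (intro mult_left_mono harmonic_le_ln assms) auto
  finally show ?thesis .
qed

text \<open>Comparison with the integral of (L - ln x)/x, a decreasing function on [1, Y]; its
  antiderivative \<Phi> equals L^2/2 at Y. The term e = 1 is L and is kept apart.\<close>

lemma sum_ln_over_le:
  assumes "Y \<ge> 1"
  shows "(\<Sum>e=1..Y. ln (real Y / real e) / real e) \<le> ln (real Y) + (ln (real Y))\<^sup>2 / 2"
proof -
  define L where "L = ln (real Y)"
  define \<Phi> where "\<Phi> x = L * ln x - (ln x)\<^sup>2 / 2" for x
  have "(\<Sum>e=1..k. ln (real Y / real e) / real e) \<le> L + \<Phi> (real k)" if "1 \<le> k" "k \<le> Y" for k
    using that
  proof (induction k rule: dec_induct)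
    case base
    then show ?case by (simp add: \<Phi>_def L_def)
  next
    case (step k)
    have "\<exists>z. z > real k \<and> z < real (Suc k) \<and> \<Phi> (real (Suc k)) - \<Phi> (real k) = (real (Suc k) - real k) * ((L - ln z) / z)"
    proof (rule MVT2)
      fix x assume "real k \<le> x" "x \<le> real (Suc k)"
      then have "x > 0" using step by auto
      then show "(\<Phi> has_real_derivative (L - ln x) / x) (at x)"
        unfolding \<Phi>_def[abs_def] by (auto intro!: derivative_eq_intros simp: field_simps)
    qed simp
    then obtain z where z: "z > real k" "z < real (Suc k)" "\<Phi> (real (Suc k)) - \<Phi> (real k) = (L - ln z) / z" by auto
    have z0: "z > 0" using z(1) step by auto
    have "ln (real Y / real (Suc k)) / real (Suc k) = (L - ln (real (Suc k))) / real (Suc k)"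
      using step by (simp add: ln_div L_def)
    also have "\<dots> \<le> (L - ln z) / z"
    proof (rule frac_le)
      have "ln z \<le> ln (real (Suc k))" using z z0 by simp
      then show "L - ln (real (Suc k)) \<le> L - ln z" by simp
      have "ln (real (Suc k)) \<le> L" unfolding L_def using step by simp
      then show "0 \<le> L - ln z" using \<open>ln z \<le> ln (real (Suc k))\<close> by simp
    qed (use z z0 in auto)
    finally show ?case using step z(3) by simp
  qed
  from this[of Y] assms show ?thesis by (simp add: \<Phi>_def L_def power2_eq_square)
qed

text \<open>Writing \<tau>(N)/N as the sum of 1/(e m) over e m = N gives a harmonic sum inside a
  logarithmic one. The leading coefficient 1/2 is what doubles \<pi> in the final bound.\<close>

lemma sum_divisor_count_over_le:
  assumes "Y \<ge> 1"
  shows "(\<Sum>N=1..Y. real (card {e. e dvd N}) / real N) \<le> (ln (real Y))\<^sup>2 / 2 + 2 * ln (real Y) + 1"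
proof -
  have "(\<Sum>N=1..Y. real (card {e. e dvd N}) / real N) = (\<Sum>N=1..Y. \<Sum>e | e dvd N. 1 / real e * (1 / real (N div e)))"
  proof (rule sum.cong)
    fix N assume N: "N \<in> {1..Y}"
    have "(\<Sum>e | e dvd N. 1 / real e * (1 / real (N div e))) = (\<Sum>e | e dvd N. 1 / real N)"
    proof (rule sum.cong)
      fix e assume "e \<in> {e. e dvd N}"
      then have "e dvd N" by simp
      then have "real e * real (N div e) = real N" by (simp flip: of_nat_mult)
      then show "1 / real e * (1 / real (N div e)) = 1 / real N" by simp
    qed simp
    then show "real (card {e. e dvd N}) / real N = (\<Sum>e | e dvd N. 1 / real e * (1 / real (N div e)))" by simp
  qed simp
  also have "\<dots> = (\<Sum>e=1..Y. \<Sum>m=1..Y div e. 1 / real e * (1 / real m))"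
    by (rule sum_divisors_swap)
  also have "\<dots> \<le> (\<Sum>e=1..Y. 1 / real e + ln (real Y / real e) / real e)"
  proof (rule sum_mono)
    fix e assume e: "e \<in> {1..Y}"
    have k: "Y div e \<ge> 1" using e by (simp add: less_eq_div_iff_mult_less_eq)
    have "ln (real (Y div e)) \<le> ln (real Y / real e)"
      using k of_nat_div_le_of_nat[of Y e, where 'a = real] by (intro ln_mono) auto
    then have "(\<Sum>m=1..Y div e. 1 / real m) \<le> 1 + ln (real Y / real e)"
      using harmonic_le_ln[OF k] by linarith
    then have "1 / real e * (\<Sum>m=1..Y div e. 1 / real m) \<le> 1 / real e * (1 + ln (real Y / real e))"
      by (intro mult_left_mono) auto
    then show "(\<Sum>m=1..Y div e. 1 / real e * (1 / real m)) \<le> 1 / real e + ln (real Y / real e) / real e"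
      by (simp add: sum_distrib_left distrib_left)
  qed
  also have "\<dots> = (\<Sum>e=1..Y. 1 / real e) + (\<Sum>e=1..Y. ln (real Y / real e) / real e)" by (rule sum.distrib)
  finally show ?thesis using harmonic_le_ln[OF assms] sum_ln_over_le[OF assms] by linarith
qed

section \<open>The inequality at a zero for a family of reduced forms\<close>

definition zeta_real :: "real \<Rightarrow> real" where
  "zeta_real s = suminf (\<lambda>m. real (Suc m) powr (-s))"

lemma summable_zeta_real: "s > 1 \<Longrightarrow> summable (\<lambda>m. real (Suc m) powr (-s))"
  using summable_real_powr_iff[of "-s"] summable_Suc_iff[of "\<lambda>m. real m powr (-s)"] by simp

lemma sum_powr_eq_lessThan: "(\<Sum>x=1..k. f x) = (\<Sum>m<k. f (Suc m))" for f :: "nat \<Rightarrow> real"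
  by (induction k) simp_all

lemma sum_le_zeta_real:
  assumes "s > 1"
  shows "(\<Sum>x=1..k. real x powr (-s)) \<le> zeta_real s"
  unfolding sum_powr_eq_lessThan zeta_real_def
  by (rule sum_le_suminf[OF summable_zeta_real[OF assms]]) auto

text \<open>Termwise: e^y \<le> 1 + y e^y with y = 2 t ln x and ln x \<le> 4 x^(1/4) give x^(2 t)
  \<le> 1 + 8 t x^(1/2). The bound t \<le> 1/8 is used for x^(2 t) \<le> x^(1/4).\<close>

lemma zeta_real_near_two:
  assumes t: "0 \<le> t" "t \<le> 1/8"
  shows "zeta_real (2 - 2 * t) \<le> zeta_real 2 + 8 * t * zeta_real (3/2)"
proof -
  have le: "real (Suc m) powr (-(2 - 2 * t)) \<le> real (Suc m) powr (-2) + 8 * t * real (Suc m) powr (-(3/2))" for m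
  proof -
    define x where "x = real (Suc m)"
    have x: "x \<ge> 1" by (simp add: x_def)
    define y where "y = 2 * t * ln x"
    have y0: "0 \<le> y" unfolding y_def using t x by simp
    have "1 + (- y) \<le> exp (- y)" by (rule exp_ge_add_one_self)
    then have "(1 - y) * exp y \<le> exp (- y) * exp y" by (intro mult_right_mono) auto
    then have "exp y \<le> 1 + y * exp y" by (simp add: exp_minus algebra_simps)
    moreover have "exp y = x powr (2 * t)" using x by (simp add: y_def powr_def)
    ultimately have e: "x powr (2 * t) \<le> 1 + y * x powr (2 * t)" by simp
    have "ln (x powr (1/4)) \<le> x powr (1/4)" using x ln_le_minus_one[of "x powr (1/4)"] by simp
    then have "ln x \<le> 4 * x powr (1/4)" using x by (simp add: ln_powr)
    then have "y \<le> 2 * t * (4 * x powr (1/4))" unfolding y_def using t by (intro mult_left_mono) auto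
    moreover have "x powr (2 * t) \<le> x powr (1/4)" using x t by (intro powr_mono) auto
    ultimately have "y * x powr (2 * t) \<le> 2 * t * (4 * x powr (1/4)) * x powr (1/4)"
      using y0 t by (intro mult_mono) auto
    also have "\<dots> = 8 * t * x powr (1/2)" using powr_add[of x "1/4" "1/4"] by simp
    finally have "x powr (2 * t) \<le> 1 + 8 * t * x powr (1/2)" using e by linarith
    then have "x powr (2 * t) * x powr (-2) \<le> (1 + 8 * t * x powr (1/2)) * x powr (-2)"
      by (intro mult_right_mono) auto
    also have "\<dots> = x powr (-2) + 8 * t * (x powr (1/2) * x powr (-2))" by (simp add: distrib_right)
    also have "x powr (1/2) * x powr (-2) = x powr (-(3/2))" using powr_add[of x "1/2" "-2"] by simp
    also have "x powr (2 * t) * x powr (-2) = x powr (-(2 - 2 * t))" using powr_add[of x "2 * t" "-2"] by simp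
    finally show ?thesis unfolding x_def .
  qed
  have s1: "summable (\<lambda>m. real (Suc m) powr (-2))" by (rule summable_zeta_real) simp
  have s3: "summable (\<lambda>m. real (Suc m) powr (-(3/2)))" by (rule summable_zeta_real) simp
  have s2: "summable (\<lambda>m. 8 * t * real (Suc m) powr (-(3/2)))" by (rule summable_mult[OF s3])
  have "zeta_real (2 - 2 * t) \<le> suminf (\<lambda>m. real (Suc m) powr (-2) + 8 * t * real (Suc m) powr (-(3/2)))"
    unfolding zeta_real_def using t
    by (intro suminf_le le summable_add[OF s1 s2] summable_zeta_real) auto
  also have "\<dots> = zeta_real 2 + 8 * t * zeta_real (3/2)"
    unfolding zeta_real_def by (simp only: suminf_add[OF s1 s2, symmetric] suminf_mult[OF s3])
  finally show ?thesis .
qed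

text \<open>What the estimates take from the arithmetic: forms of discriminant -d with reduced
  leading coefficients, representation numbers adding up to 2 r, where 2 is the number of units, and
  r bounded by the divisor function.\<close>

locale forms_family =
  fixes Ix :: "'i set" and A B C :: "'i \<Rightarrow> int" and d :: int and r :: "nat \<Rightarrow> nat"
  assumes fin: "finite Ix" and d_pos: "d > 0"
    and form: "i \<in> Ix \<Longrightarrow> A i > 0 \<and> (B i)\<^sup>2 - 4 * A i * C i = - d \<and> 3 * (A i)\<^sup>2 \<le> d"
    and fin_rep: "i \<in> Ix \<Longrightarrow> N > 0 \<Longrightarrow> finite {(x, y). A i * x\<^sup>2 + B i * x * y + C i * y\<^sup>2 = int N}"
    and count: "N > 0 \<Longrightarrow> (\<Sum>i\<in>Ix. card {(x, y). A i * x\<^sup>2 + B i * x * y + C i * y\<^sup>2 = int N}) = 2 * r N"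
    and r_le: "N > 0 \<Longrightarrow> r N \<le> card {e. e dvd N}"
begin

lemma pf: "i \<in> Ix \<Longrightarrow> pos_form (A i) (B i) (C i) d"
  using form d_pos by unfold_locales auto

definition U :: "'i \<Rightarrow> nat \<Rightarrow> nat" where "U i = pos_form.half_count (A i) (B i) (C i)"

definition V :: "'i \<Rightarrow> nat \<Rightarrow> nat" where "V i N = card {x :: nat. 0 < x \<and> nat (A i) * x\<^sup>2 = N}"

definition h :: nat where "h = card Ix"

definition sq :: real where "sq = sqrt (real_of_int d)"

definition S :: real where "S = (\<Sum>i\<in>Ix. 1 / real_of_int (A i))"

lemma sq_pos: "sq > 0" using d_pos by (simp add: sq_def)

lemma V_int:
  assumes "i \<in> Ix"
  shows "card {x :: int. 0 < x \<and> A i * x\<^sup>2 = int N} = V i N"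
proof -
  have a: "A i = int (nat (A i))" using form[OF assms] by simp
  have "{x :: int. 0 < x \<and> A i * x\<^sup>2 = int N} = int ` {x :: nat. 0 < x \<and> nat (A i) * x\<^sup>2 = N}"
  proof (intro equalityI subsetI)
    fix x assume x: "x \<in> {x :: int. 0 < x \<and> A i * x\<^sup>2 = int N}"
    then obtain y where y: "x = int y" by (auto elim: pos_int_cases)
    have "int (nat (A i) * y\<^sup>2) = int N" using x y a by simp
    then have "nat (A i) * y\<^sup>2 = N" by (simp only: of_nat_eq_iff)
    then show "x \<in> int ` {x :: nat. 0 < x \<and> nat (A i) * x\<^sup>2 = N}" using x y by auto
  next
    fix x assume "x \<in> int ` {x :: nat. 0 < x \<and> nat (A i) * x\<^sup>2 = N}"
    then obtain y where y: "x = int y" "0 < y" "nat (A i) * y\<^sup>2 = N" by auto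
    have "A i * x\<^sup>2 = int (nat (A i) * y\<^sup>2)" using a y(1) by simp
    then show "x \<in> {x :: int. 0 < x \<and> A i * x\<^sup>2 = int N}" using y by simp
  qed
  then show ?thesis unfolding V_def by (simp add: card_image)
qed

lemma r_eq:
  assumes N: "N > 0"
  shows "r N = (\<Sum>i\<in>Ix. U i N + V i N)"
proof -
  have "2 * r N = (\<Sum>i\<in>Ix. 2 * (U i N + V i N))"
    unfolding count[OF N, symmetric]
  proof (rule sum.cong)
    fix i assume i: "i \<in> Ix"
    note Q = pos_form.Q_def[OF pf[OF i]]
    show "card {(x, y). A i * x\<^sup>2 + B i * x * y + C i * y\<^sup>2 = int N} = 2 * (U i N + V i N)"
      using pos_form.card_representations[OF pf[OF i] N] fin_rep[OF i N]
      unfolding Q V_int[OF i] U_def by simp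
  qed simp
  then have "2 * r N = 2 * (\<Sum>i\<in>Ix. U i N + V i N)" by (simp only: sum_distrib_left)
  then show ?thesis by simp
qed

lemma sum_V:
  fixes f :: "nat \<Rightarrow> real"
  assumes i: "i \<in> Ix"
  shows "(\<Sum>N=1..M. real (V i N) * f N) = (\<Sum>x | 1 \<le> x \<and> nat (A i) * x\<^sup>2 \<le> M. f (nat (A i) * x\<^sup>2))"
    and "finite {x. 1 \<le> x \<and> nat (A i) * x\<^sup>2 \<le> M}" "{x. 1 \<le> x \<and> nat (A i) * x\<^sup>2 \<le> M} \<subseteq> {1..M}"
proof -
  let ?X = "{x. 1 \<le> x \<and> nat (A i) * x\<^sup>2 \<le> M}"
  have a: "nat (A i) \<ge> 1" using form[OF i] by (simp add: Suc_le_eq)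
  have xle: "x \<le> nat (A i) * x\<^sup>2" for x
  proof -
    have "1 * x \<le> (nat (A i) * x) * x" if "x \<ge> 1" using a that by (intro mult_le_mono1) simp
    then show ?thesis by (cases "x \<ge> 1") (auto simp: power2_eq_square mult.assoc)
  qed
  show sub: "?X \<subseteq> {1..M}" using xle le_trans by fastforce
  then show finX: "finite ?X" by (rule finite_subset) simp
  have "(\<Sum>N=1..M. real (V i N) * f N) = (\<Sum>N\<in>{1..M}. \<Sum>x\<in>{x \<in> ?X. nat (A i) * x\<^sup>2 = N}. f (nat (A i) * x\<^sup>2))"
  proof (rule sum.cong)
    fix N assume "N \<in> {1..M}"
    then have eq: "{x \<in> ?X. nat (A i) * x\<^sup>2 = N} = {x. 0 < x \<and> nat (A i) * x\<^sup>2 = N}" by auto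
    have "(\<Sum>x\<in>{x. 0 < x \<and> nat (A i) * x\<^sup>2 = N}. f (nat (A i) * x\<^sup>2)) = (\<Sum>x\<in>{x. 0 < x \<and> nat (A i) * x\<^sup>2 = N}. f N)"
      by (intro sum.cong) auto
    then show "real (V i N) * f N = (\<Sum>x\<in>{x \<in> ?X. nat (A i) * x\<^sup>2 = N}. f (nat (A i) * x\<^sup>2))"
      unfolding eq V_def by simp
  qed simp
  also have "\<dots> = (\<Sum>x\<in>?X. f (nat (A i) * x\<^sup>2))"
  proof (rule sum.group[OF finX])
    show "(\<lambda>x. nat (A i) * x\<^sup>2) ` ?X \<subseteq> {1..M}" using a by (auto simp: Suc_le_eq)
  qed simp
  finally show "(\<Sum>N=1..M. real (V i N) * f N) = (\<Sum>x\<in>?X. f (nat (A i) * x\<^sup>2))" .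
qed

lemma sum_r:
  fixes f :: "nat \<Rightarrow> real"
  shows "(\<Sum>N=1..M. real (r N) * f N) = (\<Sum>i\<in>Ix. (\<Sum>N=1..M. real (U i N) * f N) + (\<Sum>N=1..M. real (V i N) * f N))"
proof -
  have "(\<Sum>N=1..M. real (r N) * f N) = (\<Sum>N=1..M. \<Sum>i\<in>Ix. real (U i N) * f N + real (V i N) * f N)"
    by (intro sum.cong) (auto simp: r_eq sum_distrib_right distrib_right)
  also have "\<dots> = (\<Sum>i\<in>Ix. \<Sum>N=1..M. real (U i N) * f N + real (V i N) * f N)" by (rule sum.swap)
  finally show ?thesis by (simp add: sum.distrib)
qed

lemma sum_V_le:
  fixes f :: "nat \<Rightarrow> real"
  assumes f: "\<And>N. N \<ge> 1 \<Longrightarrow> f N \<ge> 0"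
  shows "(\<Sum>i\<in>Ix. \<Sum>N=1..M. real (V i N) * f N) \<le> (\<Sum>N=1..M. real (card {e. e dvd N}) * f N)"
proof -
  have "(\<Sum>i\<in>Ix. \<Sum>N=1..M. real (V i N) * f N) \<le> (\<Sum>N=1..M. real (r N) * f N)"
    unfolding sum_r using f by (intro sum_mono) (auto intro!: sum_nonneg)
  also have "\<dots> \<le> (\<Sum>N=1..M. real (card {e. e dvd N}) * f N)"
    using f r_le by (intro sum_mono mult_right_mono) auto
  finally show ?thesis .
qed

lemma sum_V_powr_le:
  assumes i: "i \<in> Ix" and b: "1/2 < \<beta>"
  shows "(\<Sum>N=1..M. real (V i N) * real N powr (-\<beta>)) \<le> real_of_int (A i) powr (-\<beta>) * zeta_real (2 * \<beta>)"
proof -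
  have a: "real (nat (A i)) = real_of_int (A i)" using form[OF i] by simp
  have "(\<Sum>N=1..M. real (V i N) * real N powr (-\<beta>)) =
      (\<Sum>x | 1 \<le> x \<and> nat (A i) * x\<^sup>2 \<le> M. real (nat (A i) * x\<^sup>2) powr (-\<beta>))"
    by (rule sum_V(1)[OF i])
  also have "\<dots> = (\<Sum>x | 1 \<le> x \<and> nat (A i) * x\<^sup>2 \<le> M. real_of_int (A i) powr (-\<beta>) * real x powr (-(2 * \<beta>)))"
  proof (rule sum.cong)
    fix x assume "x \<in> {x. 1 \<le> x \<and> nat (A i) * x\<^sup>2 \<le> M}"
    then have "real x > 0" by simp
    then have "(real x ^ 2) powr (-\<beta>) = real x powr (-(2 * \<beta>))"
      by (simp add: powr_powr flip: powr_numeral)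
    then show "real (nat (A i) * x\<^sup>2) powr (-\<beta>) = real_of_int (A i) powr (-\<beta>) * real x powr (-(2 * \<beta>))"
      by (simp only: of_nat_mult of_nat_power a powr_mult)
  qed simp
  also have "\<dots> \<le> (\<Sum>x=1..M. real_of_int (A i) powr (-\<beta>) * real x powr (-(2 * \<beta>)))"
    using sum_V(3)[OF i, of M] by (intro sum_mono2) auto
  also have "\<dots> = real_of_int (A i) powr (-\<beta>) * (\<Sum>x=1..M. real x powr (-(2 * \<beta>)))"
    by (rule sum_distrib_left[symmetric])
  also have "\<dots> \<le> real_of_int (A i) powr (-\<beta>) * zeta_real (2 * \<beta>)"
    using b by (intro mult_left_mono sum_le_zeta_real) auto
  finally show ?thesis .
qed

text \<open>The points with y > 0 have density \<pi>/\<surd>d for every form. This is the inequality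
  h \<pi>/\<surd>d \<le> L(1) contained in the class number formula, and the one that settles the
  sign of the diverging terms at a zero.\<close>

lemma average_ge:
  assumes lim: "(\<lambda>n. (\<Sum>N=1..n\<^sup>2. real (r N)) / real n ^ 2) \<longlonglongrightarrow> L1"
  shows "real h * pi / sq \<le> L1"
proof -
  define k where "k i = (sqrt (real_of_int d) / real_of_int (A i) + 1) * sqrt (4 * real_of_int (A i) / real_of_int d)" for i
  define Kc where "Kc = (\<Sum>i\<in>Ix. k i)"
  have le: "real h * pi / sq - Kc / real n \<le> (\<Sum>N=1..n\<^sup>2. real (r N)) / real n ^ 2" if n: "n \<ge> 1" for n
  proof -
    have n0: "real n > 0" using n by simp
    have "real n ^ 2 * (real h * pi / sq - Kc / real n) = (\<Sum>i\<in>Ix. pi * real (n\<^sup>2) / sq - k i * real n)"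
      using n0 by (simp add: sum_subtractf Kc_def h_def sum_distrib_left power2_eq_square field_simps)
    also have "\<dots> \<le> (\<Sum>i\<in>Ix. \<Sum>N=1..n\<^sup>2. real (U i N))"
    proof (rule sum_mono)
      fix i assume i: "i \<in> Ix"
      have "pos_form.T (A i) d (n\<^sup>2) = sqrt (4 * real_of_int (A i) / real_of_int d) * real n"
        unfolding pos_form.T_def[OF pf[OF i]] using n0 by (simp add: real_sqrt_mult real_sqrt_divide)
      then have "pi * real (n\<^sup>2) / sq - k i * real n \<le> real (pos_form.half_sum (A i) (B i) (C i) (n\<^sup>2))"
        using pos_form.half_sum_ge[OF pf[OF i], of "n\<^sup>2"] unfolding sq_def k_def by (simp only: mult.assoc)
      then show "pi * real (n\<^sup>2) / sq - k i * real n \<le> (\<Sum>N=1..n\<^sup>2. real (U i N))"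
        unfolding pos_form.half_sum_eq[OF pf[OF i]] U_def by simp
    qed
    also have "\<dots> \<le> (\<Sum>N=1..n\<^sup>2. real (r N))"
      using sum_r[of "\<lambda>_. 1" "n\<^sup>2"] by (simp add: sum.distrib sum_nonneg)
    finally show ?thesis using n0 by (simp add: field_simps)
  qed
  have "(\<lambda>n. real h * pi / sq - Kc / real n) \<longlonglongrightarrow> real h * pi / sq - 0"
    by (intro tendsto_diff tendsto_const lim_const_over_n)
  then show ?thesis
    using lim by (intro LIMSEQ_le[of "\<lambda>n. real h * pi / sq - Kc / real n"]) (use le in auto)
qed

text \<open>The upper bounds for the forms add up to (h \<pi>/\<surd>d) X^(1 - \<beta>)/(1 -
  \<beta>) plus a constant. Subtracting the main term with L1, which is at least as large, leaves at
  most the constant; the left side tends to 0, so the constant is nonnegative.\<close>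

lemma zero_inequality:
  assumes b: "1/2 < \<beta>" "\<beta> < 1" and L1: "real h * pi / sq \<le> L1"
    and lim: "(\<lambda>n. (\<Sum>N=1..n\<^sup>2. real (r N) * real N powr (-\<beta>)) - L1 * real n powr (2 * (1 - \<beta>)) / (1 - \<beta>)) \<longlonglongrightarrow> 0"
  shows "(\<Sum>i\<in>Ix. pi / sq * (\<beta> * (real_of_int d / (4 * real_of_int (A i))) powr (1 - \<beta>) / (1 - \<beta>))) \<le>
    (\<Sum>i\<in>Ix. real_of_int (A i) powr (-\<beta>) * zeta_real (2 * \<beta>) +
      \<beta> / (\<beta> - 1/2) * (real_of_int d / (4 * real_of_int (A i))) powr (-\<beta>))"
proof -
  define M where "M i = real_of_int d / (4 * real_of_int (A i))" for i
  define c where "c i = real_of_int (A i) powr (-\<beta>) * zeta_real (2 * \<beta>) + \<beta> / (\<beta> - 1/2) * M i powr (-\<beta>)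
    - pi / sq * (\<beta> * M i powr (1 - \<beta>) / (1 - \<beta>))" for i
  have "0 \<le> (\<Sum>i\<in>Ix. c i)"
  proof (rule LIMSEQ_le_const2[OF lim], intro exI allI impI)
    \<comment> \<open>With n \<ge> d the cut-off n^2 lies beyond d/(4a) for all forms at
      once.\<close>
    fix n assume n: "n \<ge> nat d"
    have "nat d \<le> n\<^sup>2" using n by (metis le_trans power2_nat_le_imp_le power2_eq_square le_square)
    then have "d \<le> int (n\<^sup>2)" by (simp only: nat_le_iff)
    then have dn: "real_of_int d \<le> real (n\<^sup>2)" by linarith
    have n0: "real n > 0" using n d_pos by auto
    define x where "x = real (n\<^sup>2) powr (1 - \<beta>)"
    have x: "x = real n powr (2 * (1 - \<beta>))"
    proof -
      have "real (n\<^sup>2) = real n powr 2" using n0 by simp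
      then show ?thesis unfolding x_def by (simp only: powr_powr)
    qed
    have "(\<Sum>N=1..n\<^sup>2. real (r N) * real N powr (-\<beta>)) \<le> (\<Sum>i\<in>Ix. pi / sq * (x / (1 - \<beta>)) + c i)"
      unfolding sum_r
    proof (rule sum_mono)
      fix i assume i: "i \<in> Ix"
      have a1: "real_of_int (A i) \<ge> 1" using form[OF i] by simp
      have Mi: "pos_form.N0 (A i) d = M i" unfolding pos_form.N0_def[OF pf[OF i]] M_def ..
      have "M i \<le> real_of_int d / 1" unfolding M_def using a1 d_pos by (intro divide_left_mono) auto
      then have "pos_form.N0 (A i) d \<le> real (n\<^sup>2)" unfolding Mi using dn by simp
      from pos_form.weighted_half_sum_le[OF pf[OF i] b this]
      have "(\<Sum>N=1..n\<^sup>2. real (U i N) * real N powr (-\<beta>)) \<le>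
          pi / sq * (x / (1 - \<beta>) - \<beta> * M i powr (1 - \<beta>) / (1 - \<beta>)) + \<beta> / (\<beta> - 1/2) * M i powr (-\<beta>)"
        unfolding Mi U_def sq_def x_def .
      moreover have "(\<Sum>N=1..n\<^sup>2. real (V i N) * real N powr (-\<beta>)) \<le> real_of_int (A i) powr (-\<beta>) * zeta_real (2 * \<beta>)"
        by (rule sum_V_powr_le[OF i b(1)])
      ultimately show "(\<Sum>N=1..n\<^sup>2. real (U i N) * real N powr (-\<beta>)) + (\<Sum>N=1..n\<^sup>2. real (V i N) * real N powr (-\<beta>)) \<le>
          pi / sq * (x / (1 - \<beta>)) + c i"
        unfolding c_def right_diff_distrib by linarith
    qed
    also have "\<dots> = (real h * pi / sq) * (x / (1 - \<beta>)) + (\<Sum>i\<in>Ix. c i)"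
      by (simp add: sum.distrib h_def)
    also have "\<dots> \<le> L1 * (x / (1 - \<beta>)) + (\<Sum>i\<in>Ix. c i)"
      using L1 b by (intro add_right_mono mult_right_mono) (auto simp: x_def)
    finally show "(\<Sum>N=1..n\<^sup>2. real (r N) * real N powr (-\<beta>)) - L1 * real n powr (2 * (1 - \<beta>)) / (1 - \<beta>) \<le> (\<Sum>i\<in>Ix. c i)"
      unfolding x[symmetric] by simp
  qed
  then show ?thesis unfolding c_def M_def by (simp add: sum_subtractf)
qed

text \<open>All leading coefficients are at most \<open>m = \<surd>(d/3)\<close>, so the factor \<open>m\<^sup>t\<close> cancels from both sides.\<close>

theorem main_inequality:
  assumes t: "0 < t" "t \<le> 1/4" and L1: "real h * pi / sq \<le> L1"
    and lim: "(\<lambda>n. (\<Sum>N=1..n\<^sup>2. real (r N) * real N powr (-(1 - t))) - L1 * real n powr (2 * (1 - (1 - t))) / (1 - (1 - t))) \<longlonglongrightarrow> 0"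
  shows "real h / sq * ((1 - t) * (pi * (1 - t) - 10 * t)) \<le> t * zeta_real (2 - 2 * t) * S"
proof -
  define \<beta> where "\<beta> = 1 - t"
  have b: "1/2 < \<beta>" "\<beta> < 1" "\<beta> > 0" using t by (auto simp: \<beta>_def)
  have tb: "1 - \<beta> = t" by (simp add: \<beta>_def)
  define m where "m = sqrt (real_of_int d / 3)"
  have m0: "m > 0" using d_pos by (simp add: m_def)
  have m2: "m * m = real_of_int d / 3" using d_pos by (simp add: m_def)
  define Mi where "Mi i = real_of_int d / (4 * real_of_int (A i))" for i
  have z0: "zeta_real (2 * \<beta>) \<ge> 0" unfolding zeta_real_def by (intro suminf_nonneg summable_zeta_real) (use b in auto)
  have Ai: "real_of_int (A i) > 0" "real_of_int (A i) \<le> m" "3 / 4 * m \<le> Mi i" if i: "i \<in> Ix" for i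
  proof -
    show a0: "real_of_int (A i) > 0" using form[OF i] by simp
    have "real_of_int (3 * (A i)\<^sup>2) \<le> real_of_int d" using form[OF i] by (simp only: of_int_le_iff)
    then have "(real_of_int (A i))\<^sup>2 \<le> m\<^sup>2" using m2 by (simp add: power2_eq_square)
    then show am: "real_of_int (A i) \<le> m" using m0 by (simp add: power2_le_iff_abs_le)
    have "m * real_of_int (A i) \<le> m * m" using am m0 by simp
    then show "3 / 4 * m \<le> Mi i" unfolding Mi_def using a0 m2 by (simp add: field_simps)
  qed
  \<comment> \<open>The price of replacing d/(4a) by its lower bound 3 m/4 and then by m; it
    accounts for the factor 1 - t beside \<pi>.\<close>
  have q: "(1 - t) \<le> (3/4 :: real) powr t" "(3/4 :: real) powr t \<le> 1"
  proof -
    have "ln (4/3 :: real) \<le> 4/3 - 1" by (rule ln_le_minus_one) simp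
    then have "ln (4/3 :: real) \<le> 1" by simp
    moreover have "ln (3/4 :: real) = - ln (4/3)" using ln_inverse[of "4/3 :: real"] by simp
    ultimately have "- t \<le> t * ln (3/4 :: real)" using t by simp
    then have "exp (- t) \<le> (3/4 :: real) powr t" by (simp add: powr_def)
    then show "(1 - t) \<le> (3/4 :: real) powr t" using exp_ge_add_one_self[of "- t"] by linarith
    show "(3/4 :: real) powr t \<le> 1" using t by (intro powr_le1) auto
  qed
  have pm: "(3/4 * m) powr t = (3/4) powr t * m powr t" by (subst powr_mult) (use m0 in auto)
  have "(\<Sum>i\<in>Ix. pi / sq * (\<beta> * Mi i powr t / t)) \<le>
      (\<Sum>i\<in>Ix. real_of_int (A i) powr (-\<beta>) * zeta_real (2 * \<beta>) + \<beta> / (\<beta> - 1/2) * Mi i powr (-\<beta>))"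
    using zero_inequality[OF b(1,2) L1] lim unfolding \<beta>_def[symmetric] tb Mi_def by simp
  moreover have "(\<Sum>i\<in>Ix. pi / sq * (\<beta> * ((1 - t) * m powr t) / t)) \<le> (\<Sum>i\<in>Ix. pi / sq * (\<beta> * Mi i powr t / t))"
  proof (intro sum_mono mult_left_mono divide_right_mono)
    fix i assume i: "i \<in> Ix"
    have "(1 - t) * m powr t \<le> (3/4) powr t * m powr t" using q by (intro mult_right_mono) auto
    also have "\<dots> = (3/4 * m) powr t" by (rule pm[symmetric])
    also have "\<dots> \<le> Mi i powr t" using Ai(3)[OF i] m0 t by (intro powr_mono2) auto
    finally show "(1 - t) * m powr t \<le> Mi i powr t" .
  qed (use b t sq_pos in auto)
  moreover have "(\<Sum>i\<in>Ix. real_of_int (A i) powr (-\<beta>) * zeta_real (2 * \<beta>) + \<beta> / (\<beta> - 1/2) * Mi i powr (-\<beta>)) \<le>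
      (\<Sum>i\<in>Ix. (1 / real_of_int (A i)) * m powr t * zeta_real (2 * \<beta>) + 4 * \<beta> * (m powr t * (4 / (3 * m))))"
  proof (intro sum_mono add_mono mult_right_mono[OF _ z0])
    fix i assume i: "i \<in> Ix"
    have "real_of_int (A i) powr (-\<beta>) = real_of_int (A i) powr (-1) * real_of_int (A i) powr t"
      unfolding powr_add[symmetric] \<beta>_def by simp
    also have "\<dots> = (1 / real_of_int (A i)) * real_of_int (A i) powr t"
      using Ai(1)[OF i] by (simp add: powr_minus_divide)
    also have "\<dots> \<le> (1 / real_of_int (A i)) * m powr t"
      using Ai(1,2)[OF i] t by (intro mult_left_mono powr_mono2) auto
    finally show "real_of_int (A i) powr (-\<beta>) \<le> (1 / real_of_int (A i)) * m powr t" .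
    have "Mi i powr (-\<beta>) \<le> (3/4 * m) powr (-\<beta>)" using Ai(3)[OF i] m0 b by (intro powr_mono2') auto
    also have "\<dots> = (3/4 * m) powr t * (3/4 * m) powr (-1)" unfolding powr_add[symmetric] \<beta>_def by simp
    also have "\<dots> = (3/4) powr t * m powr t * (4 / (3 * m))" 
      unfolding pm using m0 by (simp add: powr_minus_divide)
    also have "\<dots> \<le> 1 * m powr t * (4 / (3 * m))" using q m0 by (intro mult_right_mono) auto
    finally have M: "Mi i powr (-\<beta>) \<le> m powr t * (4 / (3 * m))" by simp
    \<comment> \<open>Here t \<le> 1/4 keeps \<beta> at distance at least 1/4 from the point 1/2,
      where the error integral diverges.\<close>
    have "1 / (\<beta> - 1/2) \<le> 4" using t by (simp add: \<beta>_def divide_le_eq)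
    then have "\<beta> * (1 / (\<beta> - 1/2)) \<le> \<beta> * 4" using b by (intro mult_left_mono) auto
    then have "\<beta> / (\<beta> - 1/2) \<le> 4 * \<beta>" by simp
    then show "\<beta> / (\<beta> - 1/2) * Mi i powr (-\<beta>) \<le> 4 * \<beta> * (m powr t * (4 / (3 * m)))"
      using M b by (intro mult_mono) auto
  qed
  ultimately have "(\<Sum>i\<in>Ix. pi / sq * (\<beta> * ((1 - t) * m powr t) / t)) \<le>
      (\<Sum>i\<in>Ix. (1 / real_of_int (A i)) * m powr t * zeta_real (2 * \<beta>) + 4 * \<beta> * (m powr t * (4 / (3 * m))))" by linarith
  then have "m powr t * (real h * (pi / sq * (\<beta> * (1 - t) / t))) \<le>
      m powr t * (S * zeta_real (2 * \<beta>) + real h * (4 * \<beta> * (4 / (3 * m))))"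
    unfolding S_def h_def by (simp add: sum.distrib sum_distrib_right sum_distrib_left algebra_simps)
  moreover have "0 < m powr t" using m0 by simp
  ultimately have "real h * (pi / sq * (\<beta> * (1 - t) / t)) \<le> S * zeta_real (2 * \<beta>) + real h * (4 * \<beta> * (4 / (3 * m)))"
    by (rule mult_left_le_imp_le)
  then have "t * (real h * (pi / sq * (\<beta> * (1 - t) / t))) \<le> t * (S * zeta_real (2 * \<beta>) + real h * (4 * \<beta> * (4 / (3 * m))))"
    using t by (intro mult_left_mono) auto
  then have main: "real h * pi / sq * \<beta> * (1 - t) \<le> t * S * zeta_real (2 * \<beta>) + real h * t * \<beta> * (16 / (3 * m))"
  proof -
    assume *: "t * (real h * (pi / sq * (\<beta> * (1 - t) / t))) \<le> t * (S * zeta_real (2 * \<beta>) + real h * (4 * \<beta> * (4 / (3 * m))))"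
    have "t * (real h * (pi / sq * (\<beta> * (1 - t) / t))) = real h * pi / sq * \<beta> * (1 - t)" using t by simp
    moreover have "t * (S * zeta_real (2 * \<beta>) + real h * (4 * \<beta> * (4 / (3 * m)))) =
        t * S * zeta_real (2 * \<beta>) + real h * t * \<beta> * (16 / (3 * m))"
      by (simp add: distrib_left mult_ac)
    ultimately show ?thesis using * by simp
  qed
  \<comment> \<open>Origin of the 10: 3 m = \<surd>(3 d) and 16/\<surd>3 < 10. The 16/3 is the 4
    from 1/(\<beta> - 1/2) times the 4/3 from d/(4a) \<ge> 3 m/4.\<close>
  have "16 / (3 * m) \<le> 10 / sq"
  proof -
    have "(16 * sq)\<^sup>2 \<le> (30 * m)\<^sup>2"
      using m2 d_pos by (simp add: power_mult_distrib power2_eq_square sq_def)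
    then have "16 * sq \<le> 30 * m" by (rule power2_le_imp_le) (use m0 in simp)
    then show ?thesis using m0 sq_pos by (simp add: divide_le_eq le_divide_eq mult_ac)
  qed
  then have "real h * t * \<beta> * (16 / (3 * m)) \<le> real h * t * \<beta> * (10 / sq)"
    using t b by (intro mult_left_mono) auto
  then have "real h * pi / sq * \<beta> * (1 - t) \<le> t * S * zeta_real (2 * \<beta>) + real h * t * \<beta> * (10 / sq)"
    using main by linarith
  moreover have "real h / sq * ((1 - t) * (pi * (1 - t) - 10 * t)) =
      real h * pi / sq * \<beta> * (1 - t) - real h * t * \<beta> * (10 / sq)"
    unfolding \<beta>_def by (simp add: algebra_simps diff_divide_distrib add_divide_distrib)
  moreover have "2 * \<beta> = 2 - 2 * t" by (simp add: \<beta>_def)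
  ultimately show ?thesis by (simp add: mult_ac)
qed

text \<open>The pairs \<open>(i, x)\<close> with \<open>A\<^sub>i x\<^sup>2 = N\<close> number at most \<open>\<tau>(N)\<close>; this bounds \<open>S\<close> from above.\<close>

lemma S_le:
  assumes K: "K \<ge> 1" and h: "h \<ge> 1"
  shows "(\<Sum>x=1..K. 1 / real x ^ 2) * S \<le>
    (ln (real h * real K ^ 2))\<^sup>2 / 2 + 2 * ln (real h * real K ^ 2) + 1 + (\<Sum>x=1..K. 1 / real x ^ 2)"
proof -
  define z where "z = (\<Sum>x=1..K. 1 / real x ^ 2)"
  \<comment> \<open>Large enough to contain A x^2 for all x \<le> K as soon as A \<le> h.\<close>
  define Y where "Y = h * K\<^sup>2"
  have Y1: "Y \<ge> 1" using K h by (simp add: Y_def Suc_le_eq)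
  have z0: "z \<ge> 0" unfolding z_def by (intro sum_nonneg) auto
  have "z * S = (\<Sum>i\<in>Ix. z * (1 / real_of_int (A i)))" unfolding S_def by (rule sum_distrib_left)
  also have "\<dots> \<le> (\<Sum>i\<in>Ix. (\<Sum>N=1..Y. real (V i N) * (1 / real N)) + z / real h)"
  proof (rule sum_mono)
    fix i assume i: "i \<in> Ix"
    have a: "real (nat (A i)) = real_of_int (A i)" "real_of_int (A i) > 0" using form[OF i] by auto
    have nn: "0 \<le> (\<Sum>N=1..Y. real (V i N) * (1 / real N))" by (intro sum_nonneg) auto
    show "z * (1 / real_of_int (A i)) \<le> (\<Sum>N=1..Y. real (V i N) * (1 / real N)) + z / real h"
    proof (cases "A i \<le> int h")
      case True
      have sub: "{1..K} \<subseteq> {x. 1 \<le> x \<and> nat (A i) * x\<^sup>2 \<le> Y}"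
      proof
        fix x assume x: "x \<in> {1..K}"
        then have "nat (A i) * x\<^sup>2 \<le> h * K\<^sup>2" using True by (intro mult_le_mono power_mono) auto
        then show "x \<in> {x. 1 \<le> x \<and> nat (A i) * x\<^sup>2 \<le> Y}" using x by (simp add: Y_def)
      qed
      have "z * (1 / real_of_int (A i)) = (\<Sum>x=1..K. 1 / real (nat (A i) * x\<^sup>2))"
        unfolding z_def sum_distrib_right by (intro sum.cong) (auto simp: a mult.commute)
      also have "\<dots> \<le> (\<Sum>x | 1 \<le> x \<and> nat (A i) * x\<^sup>2 \<le> Y. 1 / real (nat (A i) * x\<^sup>2))"
        by (intro sum_mono2 sum_V(2)[OF i] sub) auto
      also have "\<dots> = (\<Sum>N=1..Y. real (V i N) * (1 / real N))" by (rule sum_V(1)[OF i, symmetric])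
      finally show ?thesis using z0 by (simp add: add_increasing2)
    next
      \<comment> \<open>A form with leading coefficient above h costs at most z/h, and there are at
        most h of them, so altogether they cost z.\<close>
      case False
      then have "real h \<le> real_of_int (A i)" by simp
      then have "z * (1 / real_of_int (A i)) \<le> z * (1 / real h)"
        using h z0 by (intro mult_left_mono divide_left_mono) auto
      then show ?thesis using nn by simp
    qed
  qed
  also have "\<dots> = (\<Sum>i\<in>Ix. \<Sum>N=1..Y. real (V i N) * (1 / real N)) + z"
    using h by (simp add: sum.distrib h_def)
  also have "(\<Sum>i\<in>Ix. \<Sum>N=1..Y. real (V i N) * (1 / real N)) \<le> (\<Sum>N=1..Y. real (card {e. e dvd N}) * (1 / real N))"
    by (rule sum_V_le) simp
  also have "\<dots> \<le> (ln (real Y))\<^sup>2 / 2 + 2 * ln (real Y) + 1"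
    using sum_divisor_count_over_le[OF Y1] by simp
  finally show ?thesis unfolding z_def Y_def by simp
qed

text \<open>Every form takes the value A \<le> \<surd>d at (1, 0), so h is at most the sum of
  \<tau>(N) over N \<le> \<surd>d, which is at most \<surd>d (1 + log \<surd>d). If h > \<surd>d,
  the inner logarithm is at most log h; otherwise the claim is clear.\<close>

lemma h_over_sq_le:
  assumes h: "h \<ge> 1"
  shows "real h / sq \<le> 1 + ln (real h)"
proof (cases "real h \<le> sq")
  case True
  then have "real h / sq \<le> 1" using sq_pos by simp
  moreover have "ln (real h) \<ge> 0" using h by simp
  ultimately show ?thesis by linarith
next
  case False
  define D where "D = nat \<lfloor>sq\<rfloor>"
  have Dsq: "real D \<le> sq" unfolding D_def using sq_pos by linarith
  have "Ix \<noteq> {}" using h by (auto simp: h_def)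
  have AD: "nat (A i) \<le> D" "nat (A i) \<ge> 1" if i: "i \<in> Ix" for i
  proof -
    have "(A i)\<^sup>2 \<le> d" using form[OF i] by (smt (verit) zero_le_power2)
    then have "real_of_int ((A i)\<^sup>2) \<le> real_of_int d" by (simp only: of_int_le_iff)
    then have "(real_of_int (A i))\<^sup>2 \<le> sq\<^sup>2" unfolding sq_def using d_pos by simp
    then have "real_of_int (A i) \<le> sq" by (rule power2_le_imp_le) (use sq_pos in simp)
    then show "nat (A i) \<le> D" unfolding D_def by (simp add: le_floor_iff nat_mono)
    show "nat (A i) \<ge> 1" using form[OF i] by (simp add: Suc_le_eq)
  qed
  have D1: "D \<ge> 1" using AD \<open>Ix \<noteq> {}\<close> by (meson all_not_in_conv le_trans)
  have "real h = (\<Sum>i\<in>Ix. 1)" by (simp add: h_def)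
  also have "\<dots> \<le> (\<Sum>i\<in>Ix. \<Sum>N=1..D. real (V i N) * 1)"
  proof (rule sum_mono)
    fix i assume i: "i \<in> Ix"
    have "(\<Sum>N=1..D. real (V i N) * 1) = (\<Sum>x | 1 \<le> x \<and> nat (A i) * x\<^sup>2 \<le> D. 1)"
      by (rule sum_V(1)[OF i, where M = D and f = "\<lambda>_. 1"])
    moreover have "(\<Sum>x\<in>{1 :: nat}. 1 :: real) \<le> (\<Sum>x | 1 \<le> x \<and> nat (A i) * x\<^sup>2 \<le> D. 1)"
      using AD[OF i] by (intro sum_mono2 sum_V(2)[OF i]) auto
    ultimately show "1 \<le> (\<Sum>N=1..D. real (V i N) * 1)" by simp
  qed
  also have "\<dots> \<le> (\<Sum>N=1..D. real (card {e. e dvd N}) * 1)" by (rule sum_V_le) simp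
  also have "\<dots> \<le> real D * (1 + ln (real D))" using sum_divisor_count_le[OF D1] by simp
  also have "\<dots> \<le> sq * (1 + ln (real h))"
    using Dsq False D1 by (intro mult_mono add_left_mono ln_mono) auto
  finally show ?thesis using sq_pos by (simp add: field_simps)
qed

end

section \<open>The bound for the largest zero\<close>

text \<open>A statement about real numbers, with q for h/\<surd>d, t for 1 - \<beta> and S for the
  sum of 1/a. If t were at most (2\<pi> - \<delta>) q/(log h)^2, the bound q \<le> 1 + log h would
  make t small, and the two inequalities for S would contradict each other for large h. The factor q
  cancels, so the threshold H does not depend on d.\<close>

lemma zero_distance_threshold:
  fixes \<delta> :: real
  assumes \<delta>: "\<delta> > 0"
  shows "\<exists>H :: nat. \<forall>h\<ge>H. \<forall>q S t. 0 < q \<longrightarrow> q \<le> 1 + ln (real h) \<longrightarrow> 0 < t \<longrightarrow> 0 \<le> S \<longrightarrow>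
    (t \<le> 1/8 \<longrightarrow> q * ((1 - t) * (pi * (1 - t) - 10 * t)) \<le> t * (zeta_real 2 + 8 * t * zeta_real (3/2)) * S) \<longrightarrow>
    (\<forall>K\<ge>1. (\<Sum>x=1..K. 1 / real x ^ 2) * S \<le>
      (ln (real h * real K ^ 2))\<^sup>2 / 2 + 2 * ln (real h * real K ^ 2) + 1 + (\<Sum>x=1..K. 1 / real x ^ 2)) \<longrightarrow>
    (2 * pi - \<delta>) * q / (ln (real h))\<^sup>2 < t"
proof (cases "\<delta> \<ge> 2 * pi")
  case True
  have "(2 * pi - \<delta>) * q / (ln (real h))\<^sup>2 < t" if "0 < q" "0 < t" for q t and h :: nat
  proof -
    have "(2 * pi - \<delta>) * q / (ln (real h))\<^sup>2 \<le> 0"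
      using True that by (intro divide_nonpos_nonneg mult_nonpos_nonneg) auto
    then show ?thesis using that by linarith
  qed
  then show ?thesis by blast
next
  case False
  define \<theta> where "\<theta> = 2 * pi - \<delta>"
  have \<theta>: "0 < \<theta>" "\<theta> < 2 * pi" using False \<delta> by (auto simp: \<theta>_def)
  define Z where "Z = zeta_real 2"
  define W where "W = zeta_real (3/2)"
  define zK where "zK K = (\<Sum>x=1..K. 1 / real x ^ 2)" for K :: nat
  have W0: "W \<ge> 0" unfolding W_def zeta_real_def by (intro suminf_nonneg summable_zeta_real) auto
  have zK_eq: "zK K = (\<Sum>m<K. real (Suc m) powr (-2))" for K
    unfolding zK_def sum_powr_eq_lessThan by (intro sum.cong) (simp_all add: powr_minus_divide)
  have lim: "zK \<longlonglongrightarrow> Z"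
    unfolding zK_eq Z_def zeta_real_def by (intro summable_LIMSEQ summable_zeta_real) simp
  have zK_le: "zK K \<le> Z" for K
    unfolding zK_eq Z_def zeta_real_def by (intro sum_le_suminf summable_zeta_real) auto
  have Z0: "Z > 0" using zK_le[of 1] by (simp add: zK_def)
  \<comment> \<open>The partial sum of \<zeta>(2) up to K only has to exceed the fraction
    \<theta>/(2\<pi>) < 1 of \<zeta>(2). K is fixed independently of h, so log K is negligible
    against log h.\<close>
  have "Z * (\<theta> / (2 * pi)) < Z * 1" using Z0 \<theta> by (intro mult_strict_left_mono) auto
  then have "\<forall>\<^sub>F K in sequentially. Z * (\<theta> / (2 * pi)) < zK K" by (intro order_tendstoD(1)[OF lim]) simp
  then have "\<forall>\<^sub>F K in sequentially. Z * (\<theta> / (2 * pi)) < zK K \<and> 1 \<le> K"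
    using eventually_ge_at_top[of 1] by (rule eventually_conj)
  from eventually_happens'[OF sequentially_bot this]
  obtain K where K: "Z * (\<theta> / (2 * pi)) < zK K" "K \<ge> 1" by blast
  define z where "z = zK K"
  have z0: "z > 0" using K(1) Z0 \<theta> unfolding z_def by (intro le_less_trans[OF _ K(1)]) auto
  have gap: "\<theta> * Z * (1 / 2) / z < pi"
    using K(1) z0 by (simp add: z_def[symmetric] field_simps)
  define c where "c = 2 * ln (real K)"
  \<comment> \<open>With u = 1/log h every bound is continuous at u = 0: \<tau> u bounds t under the
    negated claim, E u is u^2 times the bound for z S, and f u \<le> 0 is what the two inequalities
    would imply. But f 0 = \<pi> - \<theta> Z/(2 z) is positive by the choice of K.\<close>
  define \<tau> where "\<tau> u = 2 * pi * (u\<^sup>2 + u)" for u :: real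
  define E where "E u = (1 + c * u)\<^sup>2 / 2 + 2 * (u + c * u\<^sup>2) + (1 + z) * u\<^sup>2" for u
  define f where "f u = (1 - \<tau> u) * (pi * (1 - \<tau> u) - 10 * \<tau> u) - \<theta> * (Z + 8 * \<tau> u * W) * E u / z" for u
  have u_lim: "(\<lambda>h :: nat. 1 / ln (real h)) \<longlonglongrightarrow> 0" by real_asymp
  have "isCont f 0" unfolding f_def \<tau>_def E_def using z0 by (intro continuous_intros) auto
  from isCont_tendsto_compose[OF this u_lim] have "(\<lambda>h :: nat. f (1 / ln (real h))) \<longlonglongrightarrow> f 0" .
  moreover have "f 0 > 0" using gap by (simp add: f_def \<tau>_def E_def)
  ultimately have ev1: "\<forall>\<^sub>F h in sequentially. f (1 / ln (real h)) > 0" by (rule order_tendstoD(1))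
  have "isCont \<tau> 0" unfolding \<tau>_def by (intro continuous_intros)
  from isCont_tendsto_compose[OF this u_lim] have "(\<lambda>h :: nat. \<tau> (1 / ln (real h))) \<longlonglongrightarrow> 0" by (simp add: \<tau>_def)
  then have ev2: "\<forall>\<^sub>F h in sequentially. \<tau> (1 / ln (real h)) < 1/8" by (rule order_tendstoD(2)) simp
  from eventually_conj[OF ev1 eventually_conj[OF ev2 eventually_ge_at_top[of 2]]]
  obtain H :: nat where H: "\<And>h. h \<ge> H \<Longrightarrow> f (1 / ln (real h)) > 0 \<and> \<tau> (1 / ln (real h)) < 1/8 \<and> 2 \<le> h"
    unfolding eventually_sequentially by blast
  have goal: "\<theta> * q / (ln (real h))\<^sup>2 < t"
    if h: "h \<ge> H" and q: "0 < q" "q \<le> 1 + ln (real h)" and t: "0 < t" and S: "0 \<le> S"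
      and I: "t \<le> 1/8 \<Longrightarrow> q * ((1 - t) * (pi * (1 - t) - 10 * t)) \<le> t * (Z + 8 * t * W) * S"
      and B: "z * S \<le> (ln (real h * real K ^ 2))\<^sup>2 / 2 + 2 * ln (real h * real K ^ 2) + 1 + z"
    for h q t S
  proof (rule ccontr)
    assume not_less: "\<not> \<theta> * q / (ln (real h))\<^sup>2 < t"
    define u where "u = 1 / ln (real h)"
    have h2: "h \<ge> 2" and fu: "f u > 0" and \<tau>u: "\<tau> u < 1/8" using H[OF h] unfolding u_def by auto
    have lh: "ln (real h) > 0" using h2 by simp
    have u0: "u > 0" and lu: "ln (real h) * u = 1" using lh by (auto simp: u_def)
    have tq: "t \<le> \<theta> * q * u\<^sup>2"
      using not_less by (simp add: u_def power_divide)
    also have "\<dots> \<le> 2 * pi * (1 + ln (real h)) * u\<^sup>2"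
      using \<theta> q by (intro mult_right_mono mult_mono) auto
    also have "\<dots> = 2 * pi * (u\<^sup>2 + (ln (real h) * u) * u)" by (simp add: power2_eq_square algebra_simps)
    also have "\<dots> = \<tau> u" unfolding lu \<tau>_def by simp
    finally have t\<tau>: "t \<le> \<tau> u" .
    have pi3: "pi > 3" by (rule pi_gt3)
    have "3 * (1 - \<tau> u) \<le> pi * (1 - \<tau> u)" using pi3 \<tau>u by (intro mult_right_mono) auto
    moreover have "10 * \<tau> u \<le> 3 * (1 - \<tau> u)" using \<tau>u by simp
    ultimately have g0: "0 \<le> pi * (1 - \<tau> u) - 10 * \<tau> u" unfolding le_diff_eq add_0_left by (rule order_trans[rotated])
    have "pi * (1 - \<tau> u) \<le> pi * (1 - t)" using t\<tau> by (intro mult_left_mono) auto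
    then have "pi * (1 - \<tau> u) - 10 * \<tau> u \<le> pi * (1 - t) - 10 * t" using t\<tau> by (intro diff_mono) auto
    then have "(1 - \<tau> u) * (pi * (1 - \<tau> u) - 10 * \<tau> u) \<le> (1 - t) * (pi * (1 - t) - 10 * t)"
      using t\<tau> \<tau>u g0 by (intro mult_mono) auto
    then have "q * ((1 - \<tau> u) * (pi * (1 - \<tau> u) - 10 * \<tau> u)) \<le> q * ((1 - t) * (pi * (1 - t) - 10 * t))"
      using q by (intro mult_left_mono) auto
    also have "\<dots> \<le> t * (Z + 8 * t * W) * S" using t\<tau> \<tau>u by (intro I) simp
    also have "\<dots> \<le> (\<theta> * q * u\<^sup>2) * (Z + 8 * \<tau> u * W) * S"
      using tq t\<tau> t S Z0 W0 \<theta> q by (intro mult_right_mono mult_mono add_left_mono) (auto intro!: add_nonneg_nonneg mult_nonneg_nonneg)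
    also have "\<dots> = q * (\<theta> * (Z + 8 * \<tau> u * W) * (u\<^sup>2 * S))" by (simp add: mult_ac)
    finally have "(1 - \<tau> u) * (pi * (1 - \<tau> u) - 10 * \<tau> u) \<le> \<theta> * (Z + 8 * \<tau> u * W) * (u\<^sup>2 * S)"
      using q by simp
    moreover have "u\<^sup>2 * S \<le> E u / z"
    proof -
      define L where "L = ln (real h * real K ^ 2)"
      have L: "L = ln (real h) + c"
        unfolding L_def c_def using h2 K(2) by (simp add: ln_mult ln_realpow)
      have Lu: "L * u = 1 + c * u" unfolding L distrib_right lu ..
      have "u\<^sup>2 * (z * S) \<le> u\<^sup>2 * (L\<^sup>2 / 2 + 2 * L + 1 + z)"
        using B unfolding L_def by (intro mult_left_mono) auto
      also have "\<dots> = (L * u)\<^sup>2 / 2 + 2 * (L * u) * u + (1 + z) * u\<^sup>2"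
        by (simp add: power2_eq_square algebra_simps)
      also have "\<dots> = E u" unfolding Lu E_def by (simp add: power2_eq_square algebra_simps)
      finally show ?thesis using z0 by (simp add: le_divide_eq mult_ac)
    qed
    then have "\<theta> * (Z + 8 * \<tau> u * W) * (u\<^sup>2 * S) \<le> \<theta> * (Z + 8 * \<tau> u * W) * (E u / z)"
      using \<theta> Z0 W0 t t\<tau> by (intro mult_left_mono) auto
    ultimately show False using fu unfolding f_def by simp
  qed
  show ?thesis
    using goal K(2) unfolding \<theta>_def Z_def W_def z_def zK_def by (intro exI[of _ H]) blast
qed

lemma epsilon_from_thresholds:
  fixes P :: "real \<Rightarrow> nat \<Rightarrow> bool"
  assumes "\<And>\<delta>. \<delta> > 0 \<Longrightarrow> \<exists>H. \<forall>h\<ge>H. P \<delta> h" and "\<And>h. P \<delta>\<^sub>0 h"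
  shows "\<exists>\<epsilon> :: nat \<Rightarrow> real. \<epsilon> \<longlonglongrightarrow> 0 \<and> (\<forall>h. P (- \<epsilon> h) h)"
proof -
  have "\<forall>k :: nat. \<exists>H. \<forall>h\<ge>H. P (1 / real (Suc k)) h" using assms(1) by simp
  then obtain H where H: "\<And>k h. h \<ge> H k \<Longrightarrow> P (1 / real (Suc k)) h" by metis
  define G where "G h = {k. k \<le> h \<and> H k \<le> h}" for h
  have fin: "finite (G h)" for h by (rule finite_subset[of _ "{..h}"]) (auto simp: G_def)
  define \<epsilon> where "\<epsilon> h = (if G h = {} then - \<delta>\<^sub>0 else - (1 / real (Suc (Max (G h)))))" for h
  have "P (- \<epsilon> h) h" for h
  proof (cases "G h = {}")
    case False
    then have "Max (G h) \<in> G h" using fin by (rule Max_in[rotated])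
    moreover have "\<forall>k\<in>G h. H k \<le> h" by (simp add: G_def)
    ultimately have "P (1 / real (Suc (Max (G h)))) h" by (intro H) blast
    then show ?thesis using False by (simp add: \<epsilon>_def)
  qed (simp add: \<epsilon>_def assms(2))
  moreover have "\<epsilon> \<longlonglongrightarrow> 0"
  proof (rule LIMSEQ_I)
    fix e :: real assume "e > 0"
    then obtain k where k: "1 / real (Suc k) < e" using nat_approx_posE by metis
    have "norm (\<epsilon> h - 0) < e" if h: "h \<ge> max k (H k)" for h
    proof -
      have "k \<in> G h" using h by (simp add: G_def)
      then have "k \<le> Max (G h)" "G h \<noteq> {}" using fin by auto
      then have "1 / real (Suc (Max (G h))) \<le> 1 / real (Suc k)" by (intro divide_left_mono) auto
      then show ?thesis using k \<open>G h \<noteq> {}\<close> by (simp add: \<epsilon>_def)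
    qed
    then show "\<exists>no. \<forall>h\<ge>no. norm (\<epsilon> h - 0) < e" by blast
  qed
  ultimately show ?thesis by blast
qed

section \<open>The L-function of the field: its positive zeros and the largest one\<close>

context imag_quadratic
begin

definition L :: "complex \<Rightarrow> complex" where "L = Dirichlet_L (\<lambda>n. of_int (kronecker (- d) (int n)))"

definition chi_real :: "nat \<Rightarrow> real" where "chi_real n = real_of_int (chi n)"

lemma chi_periodic_mean_zero: "\<exists>M>0. periodic_mean_zero M (\<lambda>n. of_int (chi (Suc n)))"
proof -
  obtain M where M: "M > 0" "\<And>n. chi (n + M) = chi n" "(\<Sum>n<M. chi n) = 0"
    using kronecker_periodic[OF fund] d_gt unfolding chi_def by auto
  have "(\<Sum>n<M. complex_of_int (chi n)) = of_int (\<Sum>n<M. chi n)" by simp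
  then have "periodic_mean_zero M (\<lambda>n. of_int (chi n))" using M by (simp add: periodic_mean_zero_def)
  from periodic_mean_zero_Suc[OF this] show ?thesis using M(1) by blast
qed

text \<open>The continuation built from periodicity has the defining property of
  \<open>L_continuation\<close>, so by uniqueness it is the function that \<open>Dirichlet_L\<close>
  denotes; it inherits the convergent series for Re s > 0.\<close>

lemma L_holomorphic: "L holomorphic_on UNIV"
  and L_sums: "Re s > 0 \<Longrightarrow> (\<lambda>n. of_int (chi (Suc n)) * of_nat (Suc n) powr (-s)) sums L s"
proof -
  obtain M where M: "M > 0" "periodic_mean_zero M (\<lambda>n. of_int (chi (Suc n)))"
    using chi_periodic_mean_zero by blast
  from periodic_Dirichlet_series_entire[OF M(2,1)] obtain F where
    F: "F holomorphic_on UNIV" "\<And>s. Re s > 0 \<Longrightarrow> (\<lambda>n. of_int (chi (Suc n)) * of_nat (Suc n) powr (-s)) sums F s"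
    by blast
  have "L_continuation (\<lambda>n. of_int (kronecker (- d) (int n))) F"
    using F unfolding L_continuation_def chi_def by (auto simp del: of_nat_Suc)
  then have "L = F" unfolding L_def by (rule Dirichlet_L_eq)
  then show "L holomorphic_on UNIV"
    "Re s > 0 \<Longrightarrow> (\<lambda>n. of_int (chi (Suc n)) * of_nat (Suc n) powr (-s)) sums L s" using F by auto
qed

lemma bounded_chi: "\<exists>Bd. bounded_character chi_real Bd"
proof -
  obtain M where M: "M > 0" "periodic_mean_zero M (\<lambda>n. complex_of_int (chi (Suc n)))"
    using chi_periodic_mean_zero by blast
  from periodic_mean_zero_primitive[OF M(2,1)] obtain D where
    D: "periodic_mean_zero M D" "\<And>n. complex_of_int (chi (Suc n)) = D (Suc n) - D n" by blast
  obtain K where K: "\<And>n. norm (D n) \<le> K"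
    using periodic_bounded[of D M] D(1) M(1) unfolding periodic_mean_zero_def by blast
  have "\<bar>\<Sum>e=1..k. chi_real e\<bar> \<le> 2 * K" for k
  proof -
    have "of_real (\<Sum>e=1..k. chi_real e) = D k - D 0"
      by (induction k) (simp_all add: chi_real_def D(2))
    then have "\<bar>\<Sum>e=1..k. chi_real e\<bar> = norm (D k - D 0)" by (metis norm_of_real)
    then show ?thesis using norm_triangle_ineq4[of "D k" "D 0"] K[of k] K[of 0] by linarith
  qed
  moreover have "\<bar>chi_real e\<bar> \<le> 1" for e using chi_range[of e] by (auto simp: chi_real_def)
  ultimately show ?thesis unfolding bounded_character_def by blast
qed

lemma divisor_sum_chi_real:
  assumes "N > 0"
  shows "divisor_sum chi_real N = real (rep N)"
proof -
  have "divisor_sum chi_real N = real_of_int (divisor_sum chi N)"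
    by (simp add: divisor_sum_def chi_real_def)
  then show ?thesis unfolding rep_eq_divisor_sum[OF assms, symmetric] by simp
qed

lemma L_partial_tendsto:
  assumes "bounded_character chi_real Bd" "b > 0"
  shows "(\<lambda>n. complex_of_real (bounded_character.L_partial chi_real b n)) \<longlonglongrightarrow> L (of_real b)"
proof -
  have "complex_of_real (bounded_character.L_partial chi_real b n) =
      (\<Sum>k<n. of_int (chi (Suc k)) * of_nat (Suc k) powr (- of_real b))" for n
  proof (induction n)
    case (Suc n)
    have "complex_of_real (real (Suc n) powr (-b)) = of_nat (Suc n) powr (- of_real b)"
      using powr_of_real[of "real (Suc n)" "-b"] by (simp del: of_nat_Suc)
    then show ?case using Suc unfolding bounded_character.L_partial_def[OF assms(1)]
      by (simp add: chi_real_def del: of_nat_Suc)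
  qed (simp add: bounded_character.L_partial_def[OF assms(1)])
  then show ?thesis using L_sums[of "of_real b"] assms(2) unfolding sums_def by simp
qed

lemma rep_le: "N > 0 \<Longrightarrow> rep N \<le> card {e. e dvd N}"
proof -
  assume N: "N > 0"
  have "int (rep N) = (\<Sum>e | e dvd N. chi e)" unfolding rep_eq_divisor_sum[OF N] divisor_sum_def ..
  also have "\<dots> \<le> (\<Sum>e | e dvd N. 1)"
  proof (rule sum_mono)
    show "chi e \<le> 1" for e using chi_range[of e] by auto
  qed
  finally show ?thesis by simp
qed

text \<open>The hypotheses of \<open>zero_distance_threshold\<close> for an arbitrary positive zero
  s, with t = 1 - s. A zero at 1 is excluded by L(1) \<ge> h \<pi>/\<surd>d > 0, one beyond 1 by
  positivity of the divisor sums. Here h \<ge> 1 because \<open>rep 1\<close> is 1.\<close>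

lemma zero_facts:
  assumes zero: "s > 0" "L (of_real s) = 0"
  defines "h \<equiv> class_number K" and "q \<equiv> real (class_number K) / sqrt (real_of_int d)"
  obtains S where "s < 1" "h \<ge> 1" "0 < q" "q \<le> 1 + ln (real h)" "0 \<le> S"
    "1 - s \<le> 1/8 \<Longrightarrow> q * ((1 - (1 - s)) * (pi * (1 - (1 - s)) - 10 * (1 - s))) \<le>
      (1 - s) * (zeta_real 2 + 8 * (1 - s) * zeta_real (3/2)) * S"
    "\<And>K. K \<ge> 1 \<Longrightarrow> (\<Sum>x=1..K. 1 / real x ^ 2) * S \<le>
      (ln (real h * real K ^ 2))\<^sup>2 / 2 + 2 * ln (real h * real K ^ 2) + 1 + (\<Sum>x=1..K. 1 / real x ^ 2)"
proof -
  obtain A B Cc where cf: "finite ideal_classes"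
    "\<And>C. C \<in> ideal_classes \<Longrightarrow> A C > 0 \<and> (B C)\<^sup>2 - 4 * A C * Cc C = - d \<and> 3 * (A C)\<^sup>2 \<le> d \<and> A C \<le> Cc C"
    "\<And>C N. C \<in> ideal_classes \<Longrightarrow> N > 0 \<Longrightarrow> finite {(x, y). A C * x\<^sup>2 + B C * x * y + Cc C * y\<^sup>2 = int N}"
    "\<And>N. N > 0 \<Longrightarrow> (\<Sum>C\<in>ideal_classes. card {(x, y). A C * x\<^sup>2 + B C * x * y + Cc C * y\<^sup>2 = int N}) = 2 * rep N"
    by (rule class_forms) blast
  interpret F: forms_family ideal_classes A B Cc d rep
  proof (unfold_locales)
    show "0 < d" using d_gt by simp
  qed (use cf rep_le in auto)
  obtain Bd where bc: "bounded_character chi_real Bd" using bounded_chi by blast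
  interpret X: bounded_character chi_real Bd by (rule bc)
  have hF: "F.h = h" unfolding F.h_def h_def class_number_eq ..
  have qF: "real F.h / F.sq = q" unfolding hF q_def h_def F.sq_def ..
  have "rep 1 = 1"
    using rep_eq_divisor_sum[of 1] by (simp add: divisor_sum_def chi_one[unfolded One_nat_def])
  then have "ideal_classes \<noteq> {}" using cf(4)[of 1] by auto
  then have h1: "h \<ge> 1" using cf(1) unfolding h_def class_number_eq by (simp add: Suc_le_eq card_gt_0_iff)
  have q0: "q > 0" using h1 d_gt unfolding q_def h_def by simp
  have real_lim: "X.L_partial b \<longlonglongrightarrow> Re (L (of_real b))" if "b > 0" for b
    using tendsto_Re[OF L_partial_tendsto[OF bc that]] by simp
  have lim0: "X.L_partial s \<longlonglongrightarrow> 0" using real_lim[OF zero(1)] zero(2) by simp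
  define L1 where "L1 = Re (L 1)"
  have L1: "X.L_partial 1 \<longlonglongrightarrow> L1" using real_lim[of 1] by (simp add: L1_def)
  have ds: "(\<Sum>N=1..M. divisor_sum chi_real N * f N) = (\<Sum>N=1..M. real (rep N) * f N)" for M and f :: "nat \<Rightarrow> real"
    by (intro sum.cong) (simp_all add: divisor_sum_chi_real)
  have avg: "real F.h * pi / F.sq \<le> L1"
  proof (rule F.average_ge)
    have "(\<Sum>N=1..M. divisor_sum chi_real N) = (\<Sum>N=1..M. real (rep N))" for M
      using ds[of "\<lambda>_. 1" M] by simp
    then show "(\<lambda>n. (\<Sum>N=1..n\<^sup>2. real (rep N)) / real n ^ 2) \<longlonglongrightarrow> L1"
      using X.divisor_sum_average[OF L1] by simp
  qed
  have L1_pos: "L1 > 0"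
  proof -
    have "0 < q * pi" using q0 by simp
    also have "\<dots> = real F.h * pi / F.sq" unfolding qF[symmetric] by simp
    finally show ?thesis using avg by linarith
  qed
  have "s < 1"
  proof (rule ccontr)
    assume "\<not> s < 1"
    then consider "s = 1" | "s > 1" by linarith
    then show False
    proof cases
      case 1
      then show ?thesis using L1_pos LIMSEQ_unique[OF L1] lim0 by simp
    next
      case 2
      have "\<not> X.L_partial s \<longlonglongrightarrow> 0"
        using 2 divisor_sum_chi_real chi_one
        by (intro X.L_partial_not_tendsto_zero) (auto simp: chi_real_def)
      then show ?thesis using lim0 by simp
    qed
  qed
  moreover have "q \<le> 1 + ln (real h)" using F.h_over_sq_le h1 unfolding hF[symmetric] qF[symmetric] by simp
  moreover have S0: "0 \<le> F.S" unfolding F.S_def using cf(2) by (intro sum_nonneg) (simp add: less_imp_le)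
  moreover have "q * ((1 - (1 - s)) * (pi * (1 - (1 - s)) - 10 * (1 - s))) \<le>
      (1 - s) * (zeta_real 2 + 8 * (1 - s) * zeta_real (3/2)) * F.S" if le: "1 - s \<le> 1/8"
  proof -
    define t where "t = 1 - s"
    have t: "0 < t" "t \<le> 1/8" "s = 1 - t" using \<open>s < 1\<close> le by (auto simp: t_def)
    have "(\<lambda>n. (\<Sum>N=1..n\<^sup>2. real (rep N) * real N powr (-(1 - t))) -
        L1 * real n powr (2 * (1 - (1 - t))) / (1 - (1 - t))) \<longlonglongrightarrow> 0"
      using X.divisor_sum_asymptotics_at_zero[OF _ _ L1 lim0] t unfolding ds t(3) by simp
    then have "real F.h / F.sq * ((1 - t) * (pi * (1 - t) - 10 * t)) \<le> t * zeta_real (2 - 2 * t) * F.S"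
      using t avg by (intro F.main_inequality) auto
    also have "\<dots> \<le> t * (zeta_real 2 + 8 * t * zeta_real (3/2)) * F.S"
      using t S0 zeta_real_near_two[of t] by (intro mult_right_mono mult_left_mono) auto
    finally show ?thesis unfolding qF t_def[symmetric] .
  qed
  moreover have "(\<Sum>x=1..K. 1 / real x ^ 2) * F.S \<le>
      (ln (real h * real K ^ 2))\<^sup>2 / 2 + 2 * ln (real h * real K ^ 2) + 1 + (\<Sum>x=1..K. 1 / real x ^ 2)" if "K \<ge> 1" for K
    using F.S_le[OF that] h1 unfolding hF by simp
  ultimately show ?thesis using that h1 q0 by blast
qed

text \<open>\<open>GREATEST\<close> denotes a zero only if a maximum exists. All positive zeros are
  below 1, and those in [s0, 1] form a nonempty compact set.\<close>

lemma greatest_zero: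
  assumes "\<exists>s :: real. s > 0 \<and> L (of_real s) = 0"
  shows "(GREATEST s :: real. s > 0 \<and> L (of_real s) = 0) > 0 \<and> L (of_real (GREATEST s :: real. s > 0 \<and> L (of_real s) = 0)) = 0"
proof -
  from assms obtain s0 :: real where s0: "s0 > 0" "L (of_real s0) = 0" by blast
  have lt1: "s < 1" if "s > 0" "L (of_real s) = 0" for s :: real
    by (rule zero_facts[OF that])
  have "continuous_on UNIV L" by (rule holomorphic_on_imp_continuous_on[OF L_holomorphic])
  then have "continuous_on UNIV (\<lambda>s :: real. L (of_real s))"
    by (rule continuous_on_compose2) (auto intro!: continuous_intros)
  then have "closed {s :: real. L (of_real s) = 0}" by (intro closed_Collect_eq) auto
  then have "compact ({s0..1} \<inter> {s :: real. L (of_real s) = 0})" by (intro compact_Int_closed) auto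
  moreover have "s0 \<in> {s0..1} \<inter> {s. L (of_real s) = 0}" using s0 lt1[OF s0] by simp
  ultimately obtain m where m: "m \<in> {s0..1} \<inter> {s. L (of_real s) = 0}"
    "\<And>s. s \<in> {s0..1} \<inter> {s. L (of_real s) = 0} \<Longrightarrow> s \<le> m"
    using compact_attains_sup[of "{s0..1} \<inter> {s :: real. L (of_real s) = 0}"] by blast
  have "(GREATEST s :: real. s > 0 \<and> L (of_real s) = 0) = m"
  proof (rule Greatest_equality)
    show "m > 0 \<and> L (of_real m) = 0" using m(1) s0(1) by auto
    fix s :: real assume s: "s > 0 \<and> L (of_real s) = 0"
    then have "s < 1" using lt1 by blast
    then show "s \<le> m" using m(1) m(2)[of s] s by (cases "s0 \<le> s") auto
  qed
  then show ?thesis using m(1) s0(1) by auto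
qed

end

theorem theorem2:
  shows "\<exists>\<epsilon> :: nat \<Rightarrow> real. \<epsilon> \<longlonglongrightarrow> 0 \<and>
    (\<forall>d :: int. d > 300000000 \<and> fundamental_discriminant (-d) \<longrightarrow>
      (let L = Dirichlet_L (\<lambda>n. of_int (kronecker (-d) (int n)));
           h = class_number (quadratic_field (-d));
           is_zero = (\<lambda>s :: real. s > 0 \<and> L (of_real s) = 0);
           \<beta> = (GREATEST s. is_zero s)
       in (\<exists>s. is_zero s) \<longrightarrow>
          1 - \<beta> > (2 * pi + \<epsilon> h) * real h / ((ln (real h))\<^sup>2 * sqrt (real_of_int d))))"
proof -
  \<comment> \<open>Quantifying over all d with class number h, and over all positive zeros, makes
    the resulting \<epsilon> a function of h alone.\<close>
  define P where "P \<delta> h \<longleftrightarrow> (\<forall>d s. d > 300000000 \<longrightarrow> fundamental_discriminant (-d) \<longrightarrow>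
    class_number (quadratic_field (-d)) = h \<longrightarrow> s > 0 \<longrightarrow>
    Dirichlet_L (\<lambda>n. of_int (kronecker (-d) (int n))) (of_real s) = 0 \<longrightarrow>
    (2 * pi - \<delta>) * real h / ((ln (real h))\<^sup>2 * sqrt (real_of_int d)) < 1 - s)" for \<delta> :: real and h :: nat
  have "\<exists>\<epsilon> :: nat \<Rightarrow> real. \<epsilon> \<longlonglongrightarrow> 0 \<and> (\<forall>h. P (- \<epsilon> h) h)"
  proof (rule epsilon_from_thresholds)
    fix \<delta> :: real assume "\<delta> > 0"
    from zero_distance_threshold[OF this] obtain H :: nat where H: "\<And>h q S t. h \<ge> H \<Longrightarrow> 0 < q \<Longrightarrow> q \<le> 1 + ln (real h) \<Longrightarrow> 0 < t \<Longrightarrow> 0 \<le> S \<Longrightarrow>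
      (t \<le> 1/8 \<Longrightarrow> q * ((1 - t) * (pi * (1 - t) - 10 * t)) \<le> t * (zeta_real 2 + 8 * t * zeta_real (3/2)) * S) \<Longrightarrow>
      (\<And>K. K \<ge> 1 \<Longrightarrow> (\<Sum>x=1..K. 1 / real x ^ 2) * S \<le>
        (ln (real h * real K ^ 2))\<^sup>2 / 2 + 2 * ln (real h * real K ^ 2) + 1 + (\<Sum>x=1..K. 1 / real x ^ 2)) \<Longrightarrow>
      (2 * pi - \<delta>) * q / (ln (real h))\<^sup>2 < t" by blast
    have "P \<delta> h" if h: "h \<ge> H" for h
      unfolding P_def
    proof (intro allI impI)
      fix d :: int and s :: real
      assume d: "d > 300000000" and fund: "fundamental_discriminant (-d)" and hd: "class_number (quadratic_field (-d)) = h"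
        and s: "s > 0" and zero: "Dirichlet_L (\<lambda>n. of_int (kronecker (-d) (int n))) (of_real s) = 0"
      interpret imag_quadratic d by unfold_locales (use d fund in auto)
      have "L (of_real s) = 0" using zero unfolding L_def .
      then show "(2 * pi - \<delta>) * real h / ((ln (real h))\<^sup>2 * sqrt (real_of_int d)) < 1 - s"
      proof (rule zero_facts[OF s, unfolded hd])
        fix S
        assume S: "s < 1" "0 < real h / sqrt (real_of_int d)"
          "real h / sqrt (real_of_int d) \<le> 1 + ln (real h)" "0 \<le> S"
          "1 - s \<le> 1/8 \<Longrightarrow> real h / sqrt (real_of_int d) * ((1 - (1 - s)) * (pi * (1 - (1 - s)) - 10 * (1 - s))) \<le>
            (1 - s) * (zeta_real 2 + 8 * (1 - s) * zeta_real (3/2)) * S"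
          "\<And>K. K \<ge> 1 \<Longrightarrow> (\<Sum>x=1..K. 1 / real x ^ 2) * S \<le>
            (ln (real h * real K ^ 2))\<^sup>2 / 2 + 2 * ln (real h * real K ^ 2) + 1 + (\<Sum>x=1..K. 1 / real x ^ 2)"
        have "0 < 1 - s" using S(1) by simp
        from H[OF h S(2,3) this S(4) S(5) S(6)]
        show ?thesis by (simp add: mult.commute)
      qed
    qed
    then show "\<exists>H. \<forall>h\<ge>H. P \<delta> h" by blast
  next
    fix h
    \<comment> \<open>With this \<delta> the left side is nonpositive, also for h = 1, where
      division by ln 1 = 0 gives 0; then s < 1 suffices.\<close>
    show "P (2 * pi + 1) h"
      unfolding P_def
    proof (intro allI impI)
      fix d :: int and s :: real
      assume d: "d > 300000000" and fund: "fundamental_discriminant (-d)"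
        and s: "s > 0" and zero: "Dirichlet_L (\<lambda>n. of_int (kronecker (-d) (int n))) (of_real s) = 0"
      interpret imag_quadratic d by unfold_locales (use d fund in auto)
      have "s < 1" by (rule zero_facts[OF s]) (use zero in \<open>simp_all add: L_def\<close>)
      moreover have "(2 * pi - (2 * pi + 1)) * real h / ((ln (real h))\<^sup>2 * sqrt (real_of_int d)) \<le> 0"
        using d by (intro divide_nonpos_nonneg) auto
      ultimately show "(2 * pi - (2 * pi + 1)) * real h / ((ln (real h))\<^sup>2 * sqrt (real_of_int d)) < 1 - s"
        by linarith
    qed
  qed
  then obtain \<epsilon> :: "nat \<Rightarrow> real" where \<epsilon>: "\<epsilon> \<longlonglongrightarrow> 0" "\<And>h. P (- \<epsilon> h) h" by blast
  show ?thesis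
  proof (rule exI[of _ \<epsilon>], intro conjI allI impI, rule \<epsilon>(1), elim conjE)
    fix d :: int assume d: "d > 300000000" and fund: "fundamental_discriminant (-d)"
    interpret imag_quadratic d by unfold_locales (use d fund in auto)
    define h where "h = class_number (quadratic_field (-d))"
    define b where "b = (GREATEST s :: real. s > 0 \<and> L (of_real s) = 0)"
    have "1 - b > (2 * pi + \<epsilon> h) * real h / ((ln (real h))\<^sup>2 * sqrt (real_of_int d))"
      if "\<exists>s :: real. s > 0 \<and> L (of_real s) = 0"
    proof -
      have "b > 0" "L (of_real b) = 0" using greatest_zero[OF that] unfolding b_def by auto
      then show ?thesis
        using \<epsilon>(2)[of h] d fund unfolding P_def L_def h_def by simp
    qed
    then show "let L = Dirichlet_L (\<lambda>n. of_int (kronecker (-d) (int n)));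
           h = class_number (quadratic_field (-d));
           is_zero = (\<lambda>s :: real. s > 0 \<and> L (of_real s) = 0);
           \<beta> = (GREATEST s. is_zero s)
       in (\<exists>s. is_zero s) \<longrightarrow>
          1 - \<beta> > (2 * pi + \<epsilon> h) * real h / ((ln (real h))\<^sup>2 * sqrt (real_of_int d))"
      unfolding Let_def b_def h_def L_def by blast
  qed
qed

end
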